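(* Let $(A,\mathfrak{m})$ be a Gorenstein local ring and let $M$ be a non-zero finitely generated $A$-module of finite projective dimension. Then $$\ell\ell(M) \geq \operatorname{ord}(A).$$
   Context: Local rings are commutative and Noetherian. $\lambda(-)$ denotes length. Let $c$ be the embedding dimension of $A$ (the minimal number of generators of $\mathfrak{m}$). Order of $A$: if $A$ is singular (i.e. not regular), then $$\operatorname{ord}(A) = \min\Big\{ n\in \mathbb{N} \;\Big|\; \lambda(A/\mathfrak{m}^{n+1}) < \binom{n+c}{n} \Big\};$$ if $A$ is regular, then $\operatorname{ord}(A) = 1$. Loewy length: for an $A$-module $M$, $\ell\ell(M) = \min\{ i \geq 0 \mid \mathfrak{m}^i M = 0\}$, with $\ell\ell(M)=+\infty$ if no such $i$ exists. (For $M$ finitely generated, $\ell\ell(M)$ is finite if and only if $\lambda(M)$ is finite.) *)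

theory Defs
  imports "HOL-Algebra.Module" "HOL-Algebra.Ideal_Product" "HOL-Algebra.Ring_Divisibility"
    "HOL-Library.Extended_Nat"
begin

section \<open>Modules\<close>

definition module_homs ::
  "('a, 'r) ring_scheme \<Rightarrow> ('a, 'b, 's) module_scheme \<Rightarrow> ('a, 'c, 't) module_scheme \<Rightarrow> ('b \<Rightarrow> 'c) set"
  where "module_homs R M N = {f \<in> carrier M \<rightarrow> carrier N.
     (\<forall>x \<in> carrier M. \<forall>y \<in> carrier M. f (x \<oplus>\<^bsub>M\<^esub> y) = f x \<oplus>\<^bsub>N\<^esub> f y) \<and>
     (\<forall>a \<in> carrier R. \<forall>x \<in> carrier M. f (a \<odot>\<^bsub>M\<^esub> x) = a \<odot>\<^bsub>N\<^esub> f x)}"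

definition regular_module :: "('a, 'r) ring_scheme \<Rightarrow> ('a, 'a) module"
  where "regular_module R = \<lparr>carrier = carrier R, monoid.mult = (\<otimes>\<^bsub>R\<^esub>), one = \<one>\<^bsub>R\<^esub>,
     ring.zero = \<zero>\<^bsub>R\<^esub>, add = (\<oplus>\<^bsub>R\<^esub>), smult = (\<otimes>\<^bsub>R\<^esub>)\<rparr>"

text \<open>The fields \<open>mult\<close> and \<open>one\<close>, which the record type of modules inherits from
  rings, play no role for modules and are filled with dummies here.\<close>

definition quotient_module :: "('a, 'b, 's) module_scheme \<Rightarrow> 'b set \<Rightarrow> ('a, 'b set) module"
  where "quotient_module M N = \<lparr>carrier = a_rcosets\<^bsub>M\<^esub> N, monoid.mult = (\<lambda>_ _. N), one = N,
     ring.zero = N, add = set_add M, smult = (\<lambda>a X. \<Union>x\<in>X. N +>\<^bsub>M\<^esub> (a \<odot>\<^bsub>M\<^esub> x))\<rparr>"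

definition generated_submodule ::
  "('a, 'r) ring_scheme \<Rightarrow> ('a, 'b, 's) module_scheme \<Rightarrow> 'b set \<Rightarrow> 'b set"
  where "generated_submodule R M S = (\<lambda>N. submodule N R M) hull S"

definition finitely_generated_module ::
  "('a, 'r) ring_scheme \<Rightarrow> ('a, 'b, 's) module_scheme \<Rightarrow> bool"
  where "finitely_generated_module R M \<longleftrightarrow>
     (\<exists>S \<subseteq> carrier M. finite S \<and> generated_submodule R M S = carrier M)"

definition ideal_smult ::
  "('a, 'r) ring_scheme \<Rightarrow> 'a set \<Rightarrow> ('a, 'b, 's) module_scheme \<Rightarrow> 'b set"
  where "ideal_smult R I M =
     generated_submodule R M {a \<odot>\<^bsub>M\<^esub> x | a x. a \<in> I \<and> x \<in> carrier M}"

text \<open>The supremum of all \<open>n\<close> for which \<open>F\<close> contains a strict chain \<open>C 0 \<subset> \<dots> \<subset> C n\<close>.\<close>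

definition chain_length :: "'b set set \<Rightarrow> enat"
  where "chain_length F =
     Sup {enat n | n. \<exists>C. (\<forall>i \<le> n. C i \<in> F) \<and> (\<forall>i < n. C i \<subset> C (Suc i))}"

definition module_length :: "('a, 'r) ring_scheme \<Rightarrow> ('a, 'b, 's) module_scheme \<Rightarrow> enat"
  where "module_length R M = chain_length {N. submodule N R M}"

definition krull_dimension :: "('a, 'r) ring_scheme \<Rightarrow> enat"
  where "krull_dimension R = chain_length {P. primeideal P R}"


section \<open>Projective and injective dimension\<close>

text \<open>The lifting properties below can only quantify over modules whose elements are drawn
  from one fixed type, for which the element type \<open>'u\<close> of the given module is taken. The
  definitions agree with the usual ones as soon as \<open>'u\<close> is infinite and the carrier of \<open>R\<close>
  embeds into \<open>'u\<close>: then the free module on the carrier of \<open>P\<close> has a copy inside \<open>'u\<close>, and so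
  do \<open>R\<close> and its ideals, which suffice to test injectivity by Baer's criterion.\<close>

definition projective_module :: "('a, 'r) ring_scheme \<Rightarrow> ('a, 'u) module \<Rightarrow> bool"
  where "projective_module R P \<longleftrightarrow> module R P \<and>
     (\<forall>(N :: ('a, 'u) module) (L :: ('a, 'u) module).
        \<forall>g \<in> module_homs R N L. \<forall>f \<in> module_homs R P L.
          module R N \<and> module R L \<and> g ` carrier N = carrier L \<longrightarrow>
          (\<exists>h \<in> module_homs R P N. \<forall>x \<in> carrier P. g (h x) = f x))"

definition injective_module :: "('a, 'r) ring_scheme \<Rightarrow> ('a, 'u) module \<Rightarrow> bool"
  where "injective_module R E \<longleftrightarrow> module R E \<and>
     (\<forall>(N :: ('a, 'u) module) (L :: ('a, 'u) module).
        \<forall>g \<in> module_homs R N L. \<forall>f \<in> module_homs R N E.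
          module R N \<and> module R L \<and> inj_on g (carrier N) \<longrightarrow>
          (\<exists>h \<in> module_homs R L E. \<forall>x \<in> carrier N. h (g x) = f x))"

text \<open>An exact complex \<open>\<dots> \<rightarrow> P 1 \<rightarrow> P 0 \<rightarrow> M \<rightarrow> 0\<close>, with \<open>d i\<close> mapping \<open>P (i + 1)\<close> to \<open>P i\<close>.\<close>

definition projective_resolution ::
  "('a, 'r) ring_scheme \<Rightarrow> ('a, 'b, 's) module_scheme \<Rightarrow> (nat \<Rightarrow> ('a, 'u) module) \<Rightarrow>
   (nat \<Rightarrow> 'u \<Rightarrow> 'u) \<Rightarrow> ('u \<Rightarrow> 'b) \<Rightarrow> bool"
  where "projective_resolution R M P d \<epsilon> \<longleftrightarrow>
     (\<forall>i. projective_module R (P i)) \<and>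
     (\<forall>i. d i \<in> module_homs R (P (Suc i)) (P i)) \<and> \<epsilon> \<in> module_homs R (P 0) M \<and>
     \<epsilon> ` carrier (P 0) = carrier M \<and>
     d 0 ` carrier (P 1) = a_kernel (P 0) M \<epsilon> \<and>
     (\<forall>i. d (Suc i) ` carrier (P (Suc (Suc i))) = a_kernel (P (Suc i)) (P i) (d i))"

text \<open>An exact complex \<open>0 \<rightarrow> M \<rightarrow> E 0 \<rightarrow> E 1 \<rightarrow> \<dots>\<close>, with \<open>d i\<close> mapping \<open>E i\<close> to \<open>E (i + 1)\<close>.\<close>

definition injective_resolution ::
  "('a, 'r) ring_scheme \<Rightarrow> ('a, 'b, 's) module_scheme \<Rightarrow> (nat \<Rightarrow> ('a, 'u) module) \<Rightarrow>
   (nat \<Rightarrow> 'u \<Rightarrow> 'u) \<Rightarrow> ('b \<Rightarrow> 'u) \<Rightarrow> bool"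
  where "injective_resolution R M E d \<eta> \<longleftrightarrow>
     (\<forall>i. injective_module R (E i)) \<and>
     (\<forall>i. d i \<in> module_homs R (E i) (E (Suc i))) \<and> \<eta> \<in> module_homs R M (E 0) \<and>
     inj_on \<eta> (carrier M) \<and>
     \<eta> ` carrier M = a_kernel (E 0) (E 1) (d 0) \<and>
     (\<forall>i. d i ` carrier (E i) = a_kernel (E (Suc i)) (E (Suc (Suc i))) (d (Suc i)))"

text \<open>A definition cannot quantify over all types either, so resolutions of a module with
  elements in \<open>'b\<close> are taken in the following type, which is large enough for any
  commutative ring: up to isomorphism it contains \<open>M\<close>, the free module on any module it
  contains, and, since it has the cardinality of its own power by \<open>nat \<times> 'a\<close>, also the
  injective module \<open>Hom\<^sub>\<int>(R, D)\<close> into which such a module embeds for a suitable divisible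
  group \<open>D\<close>. It is closed under kernels and cokernels, so a module with a projective or
  injective resolution of length \<open>n\<close> has one of length at most \<open>n\<close> inside this type.\<close>

type_synonym ('a, 'b) resolution_elem = "nat \<times> 'a \<Rightarrow> 'a + 'b"

definition projective_dimension ::
  "('a, 'r) ring_scheme \<Rightarrow> ('a, 'b, 's) module_scheme \<Rightarrow> enat"
  where "projective_dimension R M =
     Inf {enat n | n. \<exists>(P :: nat \<Rightarrow> ('a, ('a, 'b) resolution_elem) module) d \<epsilon>.
       projective_resolution R M P d \<epsilon> \<and> (\<forall>i > n. carrier (P i) = {\<zero>\<^bsub>P i\<^esub>})}"

definition injective_dimension ::
  "('a, 'r) ring_scheme \<Rightarrow> ('a, 'b, 's) module_scheme \<Rightarrow> enat"
  where "injective_dimension R M =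
     Inf {enat n | n. \<exists>(E :: nat \<Rightarrow> ('a, ('a, 'b) resolution_elem) module) d \<eta>.
       injective_resolution R M E d \<eta> \<and> (\<forall>i > n. carrier (E i) = {\<zero>\<^bsub>E i\<^esub>})}"


section \<open>Local rings\<close>

locale local_noetherian_ring = cring R + noetherian_ring R for R (structure) +
  assumes unique_maximalideal: "\<exists>!I. maximalideal I R"

locale gorenstein_local_ring = local_noetherian_ring +
  assumes finite_injective_dimension: "injective_dimension R (regular_module R) < \<infinity>"

definition max_ideal :: "('a, 'r) ring_scheme \<Rightarrow> 'a set"
  where "max_ideal R = (THE I. maximalideal I R)"

text \<open>Powers are taken in the multiplicative monoid of ideals, so the power with exponent \<open>0\<close>
  is the whole ring.\<close>

definition max_ideal_power :: "('a, 'r) ring_scheme \<Rightarrow> nat \<Rightarrow> 'a set"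
  where "max_ideal_power R n = max_ideal R [^]\<^bsub>ideals_set R\<^esub> n"

definition embedding_dimension :: "('a, 'r) ring_scheme \<Rightarrow> nat"
  where "embedding_dimension R =
     (LEAST n. \<exists>S \<subseteq> carrier R. finite S \<and> card S = n \<and> Idl\<^bsub>R\<^esub> S = max_ideal R)"

definition regular_local_ring :: "('a, 'r) ring_scheme \<Rightarrow> bool"
  where "regular_local_ring R \<longleftrightarrow>
     local_noetherian_ring R \<and> krull_dimension R = enat (embedding_dimension R)"

definition local_ring_order :: "('a, 'r) ring_scheme \<Rightarrow> nat"
  where "local_ring_order R =
     (if regular_local_ring R then 1
      else LEAST n. module_length R (quotient_module (regular_module R) (max_ideal_power R (n + 1)))
             < enat ((n + embedding_dimension R) choose n))"

text \<open>The infimum of the empty set is \<open>\<infinity>\<close>.\<close>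

definition loewy_length :: "('a, 'r) ring_scheme \<Rightarrow> ('a, 'b, 's) module_scheme \<Rightarrow> enat"
  where "loewy_length R M =
     Inf {enat i | i. ideal_smult R (max_ideal_power R i) M = {\<zero>\<^bsub>M\<^esub>}}"

end

theory Submission
  imports Defs "HOL-Library.Countable_Set"
begin

text \<open>Let \<open>x\<^sub>1, \<dots>, x\<^sub>c\<close> be minimal generators of the maximal ideal \<open>\<mm>\<close> of a singular \<open>A\<close>, so that
  the Koszul complex \<open>K\<close> on them has \<open>H\<^sub>1(K) \<noteq> 0\<close>. Suppose \<open>\<mm>\<^sup>i M = 0\<close> with \<open>i < ord A\<close>. The length
  of \<open>A / \<mm>\<^bsup>i+1\<^esup>\<close> is then maximal, so the associated graded ring is a polynomial ring up to degree
  \<open>i\<close>, and a cycle \<open>z \<in> K\<^sub>1\<close> that does not bound can be corrected by boundaries to have its entries in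
  \<open>\<mm>\<^sup>i\<close>; it then annihilates \<open>M\<close>. In Tate's complex \<open>K\<langle>y\<rangle>\<close> with \<open>dy = z\<close> this makes \<open>y\<^bsup>(j)\<^esup> \<otimes> u\<close> a
  cycle for all \<open>u \<in> M\<close> and all \<open>j\<close>. Let \<open>T\<close> be a hyperplane of relations that contains the Koszul
  relations but not \<open>z\<close>. There is a chain map from \<open>K\<langle>y\<rangle>\<close> to the periodic exact complex
  \<open>\<dots> \<rightarrow> A\<^sup>c/T \<rightarrow> A \<rightarrow> A\<^sup>c/T \<rightarrow> A\<close> that sends every \<open>y\<^bsup>(j)\<^esup>\<close> to \<open>1\<close>. For large \<open>j\<close> the finite
  projective resolution of \<open>M\<close> forces the image of \<open>y\<^bsup>(j)\<^esup> \<otimes> u\<close> to bound, which means \<open>u \<in> \<mm>M\<close>.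
  Hence \<open>M = \<mm>M\<close>, and \<open>M = 0\<close> by Nakayama's lemma.\<close>

section \<open>Krull's principal ideal theorem\<close>

text \<open>Singularity speaks of dimension, while the argument needs
  \<open>H_1(K) \<noteq> 0\<close>. The bridge is Krull's height theorem, which bounds chains of
  primes by \<open>c\<close>: were \<open>H_1(K) = 0\<close>, the generators would form a regular
  sequence and the ideals generated by its initial segments would be a chain of primes of length
  \<open>c\<close>, so \<open>A\<close> would be regular. A regular \<open>A\<close> has order 1,
  and there only \<open>M \<noteq> 0\<close> has to be used. The periodic complex arises by splicing
  \<open>0 -> k -> A^c/T -> A -> k -> 0\<close> with itself, where \<open>k = A/\<mm>\<close>: the
  first \<open>k\<close> is the quotient of all relations by \<open>T\<close>, a line spanned by
  \<open>z\<close> because \<open>T\<close> is a hyperplane missing \<open>z\<close>. The complex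
  never stops, whereas the resolution of \<open>M\<close> does; this is what a large
  \<open>j\<close> exploits. Its terms need not be flat, but it is tensored only with the projective
  modules of the resolution, which preserves exactness. These modules need not be finitely
  generated, so flatness is drawn from dual bases instead of free bases.\<close>

locale noetherian_cring = cring R + noetherian_ring R for R (structure)

sublocale local_noetherian_ring \<subseteq> noetherian_cring ..

lemma (in ring) ideal_closed:
  assumes "ideal I R"
  shows "a \<in> I \<Longrightarrow> a \<in> carrier R" "\<zero> \<in> I" "a \<in> I \<Longrightarrow> b \<in> I \<Longrightarrow> a \<oplus> b \<in> I"
    "a \<in> I \<Longrightarrow> \<ominus> a \<in> I" "a \<in> I \<Longrightarrow> b \<in> I \<Longrightarrow> a \<ominus> b \<in> I"
    "r \<in> carrier R \<Longrightarrow> a \<in> I \<Longrightarrow> r \<otimes> a \<in> I" "r \<in> carrier R \<Longrightarrow> a \<in> I \<Longrightarrow> a \<otimes> r \<in> I"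
proof -
  interpret ideal I R by fact
  show "a \<in> I \<Longrightarrow> a \<in> carrier R" "\<zero> \<in> I" "a \<in> I \<Longrightarrow> b \<in> I \<Longrightarrow> a \<oplus> b \<in> I"
    "a \<in> I \<Longrightarrow> \<ominus> a \<in> I" "a \<in> I \<Longrightarrow> b \<in> I \<Longrightarrow> a \<ominus> b \<in> I"
    "r \<in> carrier R \<Longrightarrow> a \<in> I \<Longrightarrow> r \<otimes> a \<in> I" "r \<in> carrier R \<Longrightarrow> a \<in> I \<Longrightarrow> a \<otimes> r \<in> I"
    by (auto simp: a_minus_def I_l_closed I_r_closed)
qed

lemma (in cring) ideal_by_closure:
  assumes sub: "I \<subseteq> carrier R" and z: "\<zero> \<in> I"
    and add: "\<And>a b. a \<in> I \<Longrightarrow> b \<in> I \<Longrightarrow> a \<oplus> b \<in> I"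
    and mult: "\<And>r a. r \<in> carrier R \<Longrightarrow> a \<in> I \<Longrightarrow> r \<otimes> a \<in> I"
  shows "ideal I R"
proof (rule idealI[OF ring_axioms])
  have "\<ominus> a \<in> I" if "a \<in> I" for a
    using mult[of "\<ominus> \<one>" a] that sub by (auto simp: l_minus)
  then show "subgroup I (add_monoid R)"
    using assms by (intro add.subgroupI) (auto simp: a_inv_def)
  show "a \<otimes> x \<in> I" if "a \<in> I" "x \<in> carrier R" for a x
    using mult[of x a] that sub by (auto simp: m_comm)
qed (use mult in auto)

text \<open>Zorn's lemma applies because the union of a nonempty chain of ideals is a member of the
  chain. The family is indexed so that an element \<open>a\<close> whose ideal \<open>N a\<close> is
  maximal can be picked, as is done with colon ideals.\<close>

lemma (in noetherian_ring) noetherian_maximal: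
  assumes "X \<noteq> {}" "\<And>a. a \<in> X \<Longrightarrow> ideal (N a) R"
  shows "\<exists>a\<in>X. \<forall>b\<in>X. N a \<subseteq> N b \<longrightarrow> N b = N a"
proof -
  have "\<exists>L\<in>N ` X. \<forall>K\<in>N ` X. L \<subseteq> K \<longrightarrow> K = L"
  proof (rule subset_Zorn)
    fix C assume C: "subset.chain (N ` X) C"
    show "\<exists>U\<in>N ` X. \<forall>X\<in>C. X \<subseteq> U"
    proof (cases "C = {}")
      case False
      have sub: "C \<subseteq> N ` X" using C by (simp add: pred_on.chain_def)
      then have "C \<subseteq> {I. ideal I R}" using assms(2) by auto
      then have "subset.chain {I. ideal I R} C" using C by (simp add: pred_on.chain_def)
      from ideal_chain_is_trivial[OF False this] have "\<Union>C \<in> N ` X" using sub by (rule subsetD[rotated])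
      then show ?thesis by (rule bexI[rotated]) auto
    qed (use assms(1) in auto)
  qed
  then obtain L where L: "L \<in> N ` X" "\<forall>K\<in>N ` X. L \<subseteq> K \<longrightarrow> K = L" ..
  then obtain a where "a \<in> X" "L = N a" by auto
  then show ?thesis using L(2) by auto
qed

definition adjoin :: "('a, 'r) ring_scheme \<Rightarrow> 'a set \<Rightarrow> 'a \<Rightarrow> 'a set"
  where "adjoin R L g = {l \<oplus>\<^bsub>R\<^esub> r \<otimes>\<^bsub>R\<^esub> g | l r. l \<in> L \<and> r \<in> carrier R}"

lemma (in cring) adjoin_ideal:
  assumes "ideal L R" "g \<in> carrier R"
  shows "ideal (adjoin R L g) R" "L \<subseteq> adjoin R L g" "g \<in> adjoin R L g"
proof -
  note L = ideal_closed[OF assms(1)]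
  show "ideal (adjoin R L g) R"
  proof (rule ideal_by_closure)
    show "adjoin R L g \<subseteq> carrier R" using L assms(2) by (auto simp: adjoin_def)
    have "\<zero> = \<zero> \<oplus> \<zero> \<otimes> g" using assms(2) by simp
    then show "\<zero> \<in> adjoin R L g" unfolding adjoin_def using L(2) by blast
  next
    fix a b assume "a \<in> adjoin R L g" "b \<in> adjoin R L g"
    then obtain l r l' r' where *: "a = l \<oplus> r \<otimes> g" "b = l' \<oplus> r' \<otimes> g"
      "l \<in> L" "l' \<in> L" "r \<in> carrier R" "r' \<in> carrier R" by (auto simp: adjoin_def)
    have "a \<oplus> b = (l \<oplus> l') \<oplus> (r \<oplus> r') \<otimes> g"
      using * L(1)[OF *(3)] L(1)[OF *(4)] assms(2) by algebra
    moreover have "l \<oplus> l' \<in> L" "r \<oplus> r' \<in> carrier R" using * L by auto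
    ultimately show "a \<oplus> b \<in> adjoin R L g" unfolding adjoin_def by blast
  next
    fix t a assume t: "t \<in> carrier R" and "a \<in> adjoin R L g"
    then obtain l r where *: "a = l \<oplus> r \<otimes> g" "l \<in> L" "r \<in> carrier R" by (auto simp: adjoin_def)
    have "t \<otimes> a = t \<otimes> l \<oplus> (t \<otimes> r) \<otimes> g"
      using * t L(1)[OF *(2)] assms(2) by algebra
    moreover have "t \<otimes> l \<in> L" "t \<otimes> r \<in> carrier R" using * L t by auto
    ultimately show "t \<otimes> a \<in> adjoin R L g" unfolding adjoin_def by blast
  qed
  show "L \<subseteq> adjoin R L g"
  proof
    fix l assume "l \<in> L"
    moreover have "l = l \<oplus> \<zero> \<otimes> g" using L(1)[OF \<open>l \<in> L\<close>] assms(2) by simp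
    ultimately show "l \<in> adjoin R L g" unfolding adjoin_def by blast
  qed
  have "g = \<zero> \<oplus> \<one> \<otimes> g" using assms(2) by simp
  then show "g \<in> adjoin R L g" unfolding adjoin_def using L(2) by blast
qed

lemma (in cring) adjoin_subset:
  assumes "ideal K R" "L \<subseteq> K" "g \<in> K"
  shows "adjoin R L g \<subseteq> K"
  using ideal_closed[OF assms(1)] assms(2,3) by (auto simp: adjoin_def)

section \<open>Prime ideals and localisation by explicit denominators\<close>

lemma (in primeideal) complement:
  shows "\<one> \<in> carrier R - I"
    and "s \<in> carrier R - I \<Longrightarrow> t \<in> carrier R - I \<Longrightarrow> s \<otimes> t \<in> carrier R - I"
    and "s \<in> carrier R - I \<Longrightarrow> x \<in> I \<Longrightarrow> s \<ominus> x \<in> carrier R - I"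
proof -
  show "\<one> \<in> carrier R - I" using one_imp_carrier I_notcarr by auto
  show "s \<in> carrier R - I \<Longrightarrow> t \<in> carrier R - I \<Longrightarrow> s \<otimes> t \<in> carrier R - I"
    using I_prime by blast
  show "s \<ominus> x \<in> carrier R - I" if s: "s \<in> carrier R - I" and x: "x \<in> I"
  proof -
    have "s \<in> carrier R" "x \<in> carrier R" using s Icarr[OF x] by auto
    then have "s = (s \<ominus> x) \<oplus> x" by algebra
    then have "s \<ominus> x \<in> I \<Longrightarrow> s \<in> I" using x additive_subgroup.a_closed[OF additive_subgroup_axioms] by metis
    then show ?thesis using s Icarr[OF x] by auto
  qed
qed

text \<open>For an ideal \<open>L\<close> this means that it is contracted from the localisation at
  \<open>P\<close>. No ring of fractions is formed: a statement about the localisation is written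
  with a denominator \<open>s\<close> outside \<open>P\<close>.\<close>

definition saturated :: "('a, 'r) ring_scheme \<Rightarrow> 'a set \<Rightarrow> 'a set \<Rightarrow> bool"
  where "saturated R P L \<longleftrightarrow>
    (\<forall>s \<in> carrier R - P. \<forall>a \<in> carrier R. s \<otimes>\<^bsub>R\<^esub> a \<in> L \<longrightarrow> a \<in> L)"

text \<open>Nakayama's lemma for the localisation at \<open>P\<close>, where the maximal ideal has been replaced
  by a single element \<open>x\<close>.\<close>

lemma (in noetherian_cring) principal_nakayama:
  assumes P: "primeideal P R" and x: "x \<in> P" and L: "ideal L R" "saturated R P L"
    and J: "J \<subseteq> carrier R"
    and step: "\<And>a. a \<in> J \<Longrightarrow> \<exists>s \<in> carrier R - P. \<exists>a' \<in> J. s \<otimes> a \<ominus> x \<otimes> a' \<in> L"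
  shows "J \<subseteq> L"
proof (rule ccontr)
  assume notsub: "\<not> J \<subseteq> L"
  interpret P: primeideal P R by fact
  note Lc = ideal_closed[OF L(1)]
  have sat: "a \<in> L" if "s \<in> carrier R - P" "a \<in> carrier R" "s \<otimes> a \<in> L" for s a
    using that L(2) unfolding saturated_def by blast
  have xc: "x \<in> carrier R" using x P.Icarr by blast
  \<comment> \<open>The contraction of the ideal that \<open>a\<close> generates in the localisation
    modulo \<open>L\<close>. An element of \<open>J - L\<close> for which it is maximal takes the
    place of a finite generating set; \<open>J\<close> is a mere subset here.\<close>
  define N where "N a = {b \<in> carrier R. \<exists>s \<in> carrier R - P. \<exists>r \<in> carrier R. s \<otimes> b \<ominus> r \<otimes> a \<in> L}" for a
  have N: "ideal (N a) R" if a: "a \<in> carrier R" for a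
  proof (rule ideal_by_closure)
    show "\<zero> \<in> N a"
      using P.complement(1) a Lc(2)
      by (auto simp: N_def a_minus_def intro!: bexI[of _ "\<one>"] bexI[of _ "\<zero>"])
  next
    fix b b' assume "b \<in> N a" "b' \<in> N a"
    then obtain s r s' r' where *: "s \<in> carrier R - P" "s' \<in> carrier R - P" "r \<in> carrier R"
      "r' \<in> carrier R" "s \<otimes> b \<ominus> r \<otimes> a \<in> L" "s' \<otimes> b' \<ominus> r' \<otimes> a \<in> L" "b \<in> carrier R" "b' \<in> carrier R"
      by (auto simp: N_def)
    have "(s \<otimes> s') \<otimes> (b \<oplus> b') \<ominus> (s' \<otimes> r \<oplus> s \<otimes> r') \<otimes> a
       = s' \<otimes> (s \<otimes> b \<ominus> r \<otimes> a) \<oplus> s \<otimes> (s' \<otimes> b' \<ominus> r' \<otimes> a)"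
      using DiffD1[OF *(1)] DiffD1[OF *(2)] *(3,4,7,8) a by algebra
    moreover have "\<dots> \<in> L" using * Lc by auto
    ultimately have "(s \<otimes> s') \<otimes> (b \<oplus> b') \<ominus> (s' \<otimes> r \<oplus> s \<otimes> r') \<otimes> a \<in> L" by simp
    moreover have "s \<otimes> s' \<in> carrier R - P" using * P.complement(2) by blast
    ultimately show "b \<oplus> b' \<in> N a" unfolding N_def using * by blast
  next
    fix t b assume t: "t \<in> carrier R" and "b \<in> N a"
    then obtain s r where *: "s \<in> carrier R - P" "r \<in> carrier R" "s \<otimes> b \<ominus> r \<otimes> a \<in> L" "b \<in> carrier R"
      by (auto simp: N_def)
    have "s \<otimes> (t \<otimes> b) \<ominus> (t \<otimes> r) \<otimes> a = t \<otimes> (s \<otimes> b \<ominus> r \<otimes> a)"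
      using DiffD1[OF *(1)] *(2,4) a t by algebra
    then have "s \<otimes> (t \<otimes> b) \<ominus> (t \<otimes> r) \<otimes> a \<in> L" using * t Lc by auto
    then show "t \<otimes> b \<in> N a" unfolding N_def using * t by blast
  qed (auto simp: N_def)
  have "\<exists>a\<in>J - L. \<forall>b\<in>J - L. N a \<subseteq> N b \<longrightarrow> N b = N a"
    using notsub N J by (intro noetherian_maximal) auto
  then obtain a where a: "a \<in> J - L" and amax: "\<And>a'. a' \<in> J - L \<Longrightarrow> N a \<subseteq> N a' \<Longrightarrow> N a' = N a"
    by blast
  have ac: "a \<in> carrier R" using a J by auto
  obtain s a' where s: "s \<in> carrier R - P" and a': "a' \<in> J" and sa: "s \<otimes> a \<ominus> x \<otimes> a' \<in> L"
    using step a by blast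
  have a'c: "a' \<in> carrier R" using a' J by auto
  have "a' \<notin> L"
  proof
    assume "a' \<in> L"
    then have "(s \<otimes> a \<ominus> x \<otimes> a') \<oplus> x \<otimes> a' \<in> L" using sa Lc xc by auto
    moreover have "(s \<otimes> a \<ominus> x \<otimes> a') \<oplus> x \<otimes> a' = s \<otimes> a" using DiffD1[OF s] ac a'c xc by algebra
    ultimately have "s \<otimes> a \<in> L" by simp
    then show False using sat s ac a by blast
  qed
  \<comment> \<open>Since \<open>s a = x a'\<close> modulo \<open>L\<close>, the element
    \<open>a\<close> is a multiple of \<open>a'\<close> in the localisation.\<close>
  have "N a \<subseteq> N a'"
  proof
    fix b assume "b \<in> N a"
    then obtain s1 r where *: "s1 \<in> carrier R - P" "r \<in> carrier R" "s1 \<otimes> b \<ominus> r \<otimes> a \<in> L" "b \<in> carrier R"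
      by (auto simp: N_def)
    have "(s \<otimes> s1) \<otimes> b \<ominus> (r \<otimes> x) \<otimes> a' = s \<otimes> (s1 \<otimes> b \<ominus> r \<otimes> a) \<oplus> r \<otimes> (s \<otimes> a \<ominus> x \<otimes> a')"
      using DiffD1[OF *(1)] *(2,4) DiffD1[OF s] ac a'c xc by algebra
    moreover have "\<dots> \<in> L" using * s sa Lc by auto
    ultimately have "(s \<otimes> s1) \<otimes> b \<ominus> (r \<otimes> x) \<otimes> a' \<in> L" by simp
    moreover have "s \<otimes> s1 \<in> carrier R - P" using * s P.complement(2) by blast
    ultimately show "b \<in> N a'" unfolding N_def using * xc by blast
  qed
  then have "N a' = N a" using amax a' \<open>a' \<notin> L\<close> by blast
  moreover have "a' \<in> N a'"
    unfolding N_def using P.complement(1) a'c Lc(2) by (auto simp: r_neg a_minus_def intro!: bexI[of _ "\<one>"])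
  ultimately have "a' \<in> N a" by simp
  then obtain s1 r where *: "s1 \<in> carrier R - P" "r \<in> carrier R" "s1 \<otimes> a' \<ominus> r \<otimes> a \<in> L"
    by (auto simp: N_def)
  \<comment> \<open>By maximality \<open>a'\<close> is in turn a multiple of \<open>a\<close>. Hence
    \<open>a\<close> is a multiple of \<open>x a\<close>, and it is killed by an element that
    differs from \<open>s1 s\<close> by a multiple of \<open>x\<close> and so lies outside
    \<open>P\<close>.\<close>
  have "(s1 \<otimes> s \<ominus> x \<otimes> r) \<otimes> a = s1 \<otimes> (s \<otimes> a \<ominus> x \<otimes> a') \<oplus> x \<otimes> (s1 \<otimes> a' \<ominus> r \<otimes> a)"
    using DiffD1[OF *(1)] *(2) DiffD1[OF s] ac a'c xc by algebra
  also have "\<dots> \<in> L" using Lc(3)[OF Lc(6)[OF DiffD1[OF *(1)] sa] Lc(6)[OF xc *(3)]] .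
  finally have "(s1 \<otimes> s \<ominus> x \<otimes> r) \<otimes> a \<in> L" .
  moreover have "s1 \<otimes> s \<ominus> x \<otimes> r \<in> carrier R - P"
    using P.complement(3)[OF P.complement(2)[OF *(1) s]] P.I_r_closed[OF x *(2)] .
  ultimately have "a \<in> L" using sat[OF _ ac] by blast
  then show False using a by simp
qed

text \<open>The contraction to \<open>R\<close> of the ideal generated by \<open>L\<close> in the
  localisation at \<open>P\<close>.\<close>

definition saturation :: "('a, 'r) ring_scheme \<Rightarrow> 'a set \<Rightarrow> 'a set \<Rightarrow> 'a set"
  where "saturation R P L = {a \<in> carrier R. \<exists>s \<in> carrier R - P. s \<otimes>\<^bsub>R\<^esub> a \<in> L}"

lemma (in cring) saturation_ideal:
  assumes P: "primeideal P R" and L: "ideal L R"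
  shows "ideal (saturation R P L) R" "L \<subseteq> saturation R P L" "saturated R P (saturation R P L)"
proof -
  interpret P: primeideal P R by fact
  note Lc = ideal_closed[OF L]
  show "ideal (saturation R P L) R"
  proof (rule ideal_by_closure)
    show "\<zero> \<in> saturation R P L"
      unfolding saturation_def using P.complement(1) Lc(2) by (auto intro!: bexI[of _ "\<one>"])
  next
    fix a b assume "a \<in> saturation R P L" "b \<in> saturation R P L"
    then obtain s t where *: "a \<in> carrier R" "b \<in> carrier R" "s \<in> carrier R - P"
      "t \<in> carrier R - P" "s \<otimes> a \<in> L" "t \<otimes> b \<in> L" unfolding saturation_def by auto
    have "(s \<otimes> t) \<otimes> (a \<oplus> b) = t \<otimes> (s \<otimes> a) \<oplus> s \<otimes> (t \<otimes> b)"
      using *(1,2) DiffD1[OF *(3)] DiffD1[OF *(4)] by algebra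
    also have "\<dots> \<in> L" using Lc(3)[OF Lc(6)[OF _ *(5)] Lc(6)[OF _ *(6)]] * by auto
    finally show "a \<oplus> b \<in> saturation R P L"
      unfolding saturation_def using P.complement(2)[OF *(3,4)] *(1,2) by auto
  next
    fix r a assume r: "r \<in> carrier R" and "a \<in> saturation R P L"
    then obtain s where *: "a \<in> carrier R" "s \<in> carrier R - P" "s \<otimes> a \<in> L"
      unfolding saturation_def by auto
    have "s \<otimes> (r \<otimes> a) = r \<otimes> (s \<otimes> a)"
      using *(1) DiffD1[OF *(2)] r by algebra
    also have "\<dots> \<in> L" using Lc(6)[OF r *(3)] .
    finally show "r \<otimes> a \<in> saturation R P L"
      unfolding saturation_def using *(1,2) r by auto
  qed (auto simp: saturation_def)
  show "L \<subseteq> saturation R P L"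
    unfolding saturation_def using P.complement(1) Lc(1) by (auto intro!: bexI[of _ "\<one>"])
  show "saturated R P (saturation R P L)"
    unfolding saturated_def
  proof (intro ballI impI)
    fix s a assume s: "s \<in> carrier R - P" and a: "a \<in> carrier R" and "s \<otimes> a \<in> saturation R P L"
    then obtain t where t: "t \<in> carrier R - P" "t \<otimes> (s \<otimes> a) \<in> L" unfolding saturation_def by auto
    have "(t \<otimes> s) \<otimes> a \<in> L" using t s a by (simp add: m_assoc)
    then show "a \<in> saturation R P L"
      unfolding saturation_def using P.complement(2)[OF t(1) s] a by auto
  qed
qed

section \<open>Descending chains and minimal primes\<close>

lemma (in cring) colon_ideal:
  assumes "ideal L R" "g \<in> carrier R"
  shows "ideal {a \<in> carrier R. a \<otimes> g \<in> L} R"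
  using ideal_closed[OF assms(1)] assms(2)
  by (intro ideal_by_closure) (auto simp: l_distr m_assoc)

text \<open>The descending chain condition for the localisation of \<open>R / L\<close> at \<open>P\<close>, one chain step at
  a time.\<close>

definition dcc_at :: "('a, 'r) ring_scheme \<Rightarrow> 'a set \<Rightarrow> 'a set \<Rightarrow> bool"
  where "dcc_at R P L \<longleftrightarrow>
    (\<forall>J. (\<forall>n. ideal (J n) R) \<longrightarrow> (\<forall>n. J (Suc n) \<subseteq> J n) \<longrightarrow>
      (\<exists>n0 :: nat. \<forall>n\<ge>n0. \<forall>a \<in> J n. \<exists>s \<in> carrier R - P. \<exists>b \<in> J (Suc n). s \<otimes>\<^bsub>R\<^esub> a \<ominus>\<^bsub>R\<^esub> b \<in> L))"

text \<open>An element of \<open>L\<close> outside \<open>P\<close> makes the localised quotient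
  zero; it serves as denominator for every \<open>a\<close>, with \<open>b = 0\<close>.\<close>

lemma (in cring) dcc_at_not_subset:
  assumes "ideal L R" "s \<in> L" "s \<notin> P"
  shows "dcc_at R P L"
  unfolding dcc_at_def
proof (intro allI impI exI ballI)
  fix J :: "nat \<Rightarrow> 'a set" and n a assume J: "\<forall>n. ideal (J n) R" and a: "a \<in> J n"
  note Lc = ideal_closed[OF assms(1)]
  have ac: "a \<in> carrier R" using J a ideal_closed(1) by blast
  have "s \<otimes> a \<ominus> \<zero> \<in> L" using Lc(7)[OF ac assms(2)] Lc(1)[OF assms(2)] ac by (simp add: a_minus_def)
  then show "\<exists>s\<in>carrier R - P. \<exists>b\<in>J (Suc n). s \<otimes> a \<ominus> b \<in> L"
    using Lc(1)[OF assms(2)] assms(3) J ideal_closed(2) by blast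
qed

lemma (in cring) dcc_at_saturation:
  assumes P: "primeideal P R" and L: "ideal L R" and dcc: "dcc_at R P (saturation R P L)"
  shows "dcc_at R P L"
  unfolding dcc_at_def
proof (intro allI impI)
  interpret P: primeideal P R by fact
  fix J :: "nat \<Rightarrow> 'a set" assume J: "\<forall>n. ideal (J n) R" "\<forall>n. J (Suc n) \<subseteq> J n"
  then obtain n0 where n0: "\<forall>n\<ge>n0. \<forall>a \<in> J n. \<exists>s \<in> carrier R - P. \<exists>b \<in> J (Suc n). s \<otimes> a \<ominus> b \<in> saturation R P L"
    using dcc unfolding dcc_at_def by blast
  show "\<exists>n0 :: nat. \<forall>n\<ge>n0. \<forall>a \<in> J n. \<exists>s \<in> carrier R - P. \<exists>b \<in> J (Suc n). s \<otimes> a \<ominus> b \<in> L"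
  proof (intro exI allI impI ballI)
    fix n a assume "n0 \<le> n" and a: "a \<in> J n"
    then obtain s b where s: "s \<in> carrier R - P" and b: "b \<in> J (Suc n)"
      and "s \<otimes> a \<ominus> b \<in> saturation R P L" using n0 by blast
    then obtain t where t: "t \<in> carrier R - P" "t \<otimes> (s \<otimes> a \<ominus> b) \<in> L"
      unfolding saturation_def by blast
    have c: "a \<in> carrier R" "b \<in> carrier R" using a b J(1) ideal_closed(1) by blast+
    have "(t \<otimes> s) \<otimes> a \<ominus> t \<otimes> b = t \<otimes> (s \<otimes> a \<ominus> b)"
      using DiffD1[OF s] DiffD1[OF t(1)] c by algebra
    then have "(t \<otimes> s) \<otimes> a \<ominus> t \<otimes> b \<in> L" using t(2) by simp
    moreover have "t \<otimes> b \<in> J (Suc n)" using ideal_closed(6)[OF J(1)[rule_format] _ b] t(1) by blast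
    ultimately show "\<exists>s\<in>carrier R - P. \<exists>b\<in>J (Suc n). s \<otimes> a \<ominus> b \<in> L"
      using P.complement(2)[OF t(1) s] by blast
  qed
qed

text \<open>Modulo \<open>L\<close> and localised at \<open>P\<close>, the submodule generated by
  \<open>g\<close> is zero or the residue field, because \<open>P\<close> kills it. A descending
  chain can lose it only once.\<close>

lemma (in cring) dcc_at_adjoin:
  assumes P: "primeideal P R" and L: "ideal L R" and g: "g \<in> carrier R"
    and Pg: "\<And>p. p \<in> P \<Longrightarrow> p \<otimes> g \<in> L" and dcc: "dcc_at R P (adjoin R L g)"
  shows "dcc_at R P L"
  unfolding dcc_at_def
proof (intro allI impI)
  interpret P: primeideal P R by fact
  note Lc = ideal_closed[OF L]
  fix J :: "nat \<Rightarrow> 'a set" assume J: "\<forall>n. ideal (J n) R" "\<forall>n. J (Suc n) \<subseteq> J n"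
  then obtain n0 where n0: "\<forall>n\<ge>n0. \<forall>a \<in> J n. \<exists>s \<in> carrier R - P. \<exists>b \<in> J (Suc n). s \<otimes> a \<ominus> b \<in> adjoin R L g"
    using dcc unfolding dcc_at_def by blast
  note Jc = ideal_closed[OF J(1)[rule_format]]
  \<comment> \<open>The image of \<open>J n\<close> in the localisation of \<open>R / L\<close>
    contains that of \<open>g\<close>. This is antitone in \<open>n\<close>, so its truth value is
    eventually constant.\<close>
  define \<Phi> where "\<Phi> n \<longleftrightarrow> (\<exists>t \<in> carrier R - P. \<exists>l \<in> L. t \<otimes> g \<oplus> l \<in> J n)" for n
  have anti: "\<Phi> n" if "\<Phi> (Suc n)" for n using that J(2) unfolding \<Phi>_def by blast
  have "\<exists>n1. \<forall>n\<ge>n1. \<Phi> n \<longrightarrow> \<Phi> (Suc n)"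
  proof (cases "\<forall>n. \<Phi> n")
    case False
    then obtain n1 where "\<not> \<Phi> n1" by blast
    have "\<not> \<Phi> n" if "n \<ge> n1" for n using that \<open>\<not> \<Phi> n1\<close> by (induction n rule: nat_induct_at_least) (use anti in auto)
    then show ?thesis by blast
  qed auto
  then obtain n1 where n1: "\<And>n. n \<ge> n1 \<Longrightarrow> \<Phi> n \<Longrightarrow> \<Phi> (Suc n)" by blast
  show "\<exists>n0 :: nat. \<forall>n\<ge>n0. \<forall>a \<in> J n. \<exists>s \<in> carrier R - P. \<exists>b \<in> J (Suc n). s \<otimes> a \<ominus> b \<in> L"
  proof (intro exI allI impI ballI)
    fix n a assume n: "max n0 n1 \<le> n" and a: "a \<in> J n"
    have "n0 \<le> n" "n1 \<le> n" using n by auto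
    then obtain s b where s: "s \<in> carrier R - P" and b: "b \<in> J (Suc n)"
      and "s \<otimes> a \<ominus> b \<in> adjoin R L g" using n0 a by blast
    then obtain l r where l: "l \<in> L" and r: "r \<in> carrier R" and e: "s \<otimes> a \<ominus> b = l \<oplus> r \<otimes> g"
      unfolding adjoin_def by blast
    have c: "a \<in> carrier R" "b \<in> carrier R" "l \<in> carrier R" "s \<in> carrier R"
      using Jc(1) a b Lc(1) l s by auto
    show "\<exists>s\<in>carrier R - P. \<exists>b\<in>J (Suc n). s \<otimes> a \<ominus> b \<in> L"
    proof (cases "r \<in> P")
      case True
      then have "s \<otimes> a \<ominus> b \<in> L" using Lc(3)[OF l Pg] e by simp
      then show ?thesis using s b by blast
    next
      case False
      have "b \<in> J n" using b J(2) by blast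
      then have "l \<oplus> r \<otimes> g \<in> J n" using e Jc(5)[OF Jc(6)[OF c(4) a]] by metis
      then have "r \<otimes> g \<oplus> l \<in> J n" using c r g by (simp add: a_comm)
      then have "\<Phi> n" unfolding \<Phi>_def using False r l by blast
      then obtain t l' where t: "t \<in> carrier R - P" and l': "l' \<in> L" and tg: "t \<otimes> g \<oplus> l' \<in> J (Suc n)"
        using n1[OF \<open>n1 \<le> n\<close>] unfolding \<Phi>_def by blast
      have tc: "t \<in> carrier R" "l' \<in> carrier R" using t l' Lc(1) by auto
      \<comment> \<open>After multiplication by \<open>t\<close>, the term \<open>r g\<close> is
        absorbed by \<open>r\<close> times the element \<open>t g + l'\<close> of
        \<open>J (Suc n)\<close>.\<close>
      have "s \<otimes> a = b \<oplus> (s \<otimes> a \<ominus> b)" using c by algebra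
      also have "\<dots> = b \<oplus> (l \<oplus> r \<otimes> g)" by (simp only: e)
      finally have sa: "s \<otimes> a = b \<oplus> (l \<oplus> r \<otimes> g)" .
      have "(t \<otimes> s) \<otimes> a \<ominus> (t \<otimes> b \<oplus> r \<otimes> (t \<otimes> g \<oplus> l')) = t \<otimes> (s \<otimes> a) \<ominus> (t \<otimes> b \<oplus> r \<otimes> (t \<otimes> g \<oplus> l'))"
        using c tc by (simp add: m_assoc)
      also have "\<dots> = t \<otimes> l \<ominus> r \<otimes> l'"
        unfolding sa using c tc r g by algebra
      also have "\<dots> \<in> L" using Lc(5)[OF Lc(6)[OF tc(1) l] Lc(6)[OF r l']] .
      finally have "(t \<otimes> s) \<otimes> a \<ominus> (t \<otimes> b \<oplus> r \<otimes> (t \<otimes> g \<oplus> l')) \<in> L" .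
      moreover have "t \<otimes> b \<oplus> r \<otimes> (t \<otimes> g \<oplus> l') \<in> J (Suc n)"
        using Jc(3)[OF Jc(6)[OF tc(1) b] Jc(6)[OF r tg]] .
      ultimately show ?thesis using P.complement(2)[OF t s] by blast
    qed
  qed
qed

text \<open>The localisation of \<open>R / L0\<close> at a minimal prime over \<open>L0\<close> is
  Artinian. By Noetherian induction, a largest counterexample \<open>L\<close> has an associated
  prime between \<open>L0\<close> and \<open>P\<close>, which must be \<open>P\<close>. Adjoining an
  element whose annihilator modulo \<open>L\<close> is \<open>P\<close> leaves the counterexamples,
  and the previous lemma brings the condition back to \<open>L\<close>.\<close>

lemma (in noetherian_cring) dcc_at_minimal_prime:
  assumes P: "primeideal P R" and L0: "ideal L0 R"
    and minimal: "\<And>Q. primeideal Q R \<Longrightarrow> L0 \<subseteq> Q \<Longrightarrow> Q \<subseteq> P \<Longrightarrow> Q = P"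
  shows "dcc_at R P L0"
proof (rule ccontr)
  assume not: "\<not> dcc_at R P L0"
  interpret P: primeideal P R by fact
  let ?X = "{L. ideal L R \<and> L0 \<subseteq> L \<and> \<not> dcc_at R P L}"
  have "\<exists>L\<in>?X. \<forall>K\<in>?X. L \<subseteq> K \<longrightarrow> K = L"
    using not L0 by (intro noetherian_maximal) auto
  then obtain L where LX: "L \<in> ?X" and max: "\<forall>K\<in>?X. L \<subseteq> K \<longrightarrow> K = L" by (elim bexE)
  then have L: "ideal L R" "L0 \<subseteq> L" "\<not> dcc_at R P L" by auto
  have Lmax: "K = L" if "ideal K R" "L \<subseteq> K" "\<not> dcc_at R P K" for K
    using max[rule_format, of K] that L(2) by simp
  note Lc = ideal_closed[OF L(1)]
  have LP: "L \<subseteq> P" using dcc_at_not_subset[OF L(1)] L(3) by blast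
  \<comment> \<open>A largest counterexample is saturated, as its saturation has the same
    localisation. This puts the colon ideals of elements outside \<open>L\<close> inside
    \<open>P\<close>.\<close>
  have "saturation R P L = L"
    using Lmax[OF saturation_ideal(1,2)[OF P L(1)]] dcc_at_saturation[OF P L(1)] L(3) by metis
  then have sat: "saturated R P L" using saturation_ideal(3)[OF P L(1)] by simp
  have one: "\<one> \<notin> L" using LP P.complement(1) by auto
  define C where "C g = {a \<in> carrier R. a \<otimes> g \<in> L}" for g
  have C: "ideal (C g) R" if "g \<in> carrier R" for g using colon_ideal[OF L(1) that] unfolding C_def .
  have "\<exists>g\<in>carrier R - L. \<forall>h\<in>carrier R - L. C g \<subseteq> C h \<longrightarrow> C h = C g"
    using one by (intro noetherian_maximal) (auto intro: C)
  then obtain g where g: "g \<in> carrier R" "g \<notin> L"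
    and max: "\<forall>h\<in>carrier R - L. C g \<subseteq> C h \<longrightarrow> C h = C g" by (elim bexE) auto
  have gmax: "C h = C g" if "h \<in> carrier R" "h \<notin> L" "C g \<subseteq> C h" for h
    using max[rule_format, of h] that by simp
  have "primeideal (C g) R"
  proof (rule primeidealI[OF C[OF g(1)] cring_axioms])
    have "\<one> \<notin> C g" using g by (simp add: C_def)
    then show "carrier R \<noteq> C g" by blast
  next
    fix a b assume ab: "a \<in> carrier R" "b \<in> carrier R" "a \<otimes> b \<in> C g"
    show "a \<in> C g \<or> b \<in> C g"
    proof (rule disjCI)
      assume "b \<notin> C g"
      then have "b \<otimes> g \<notin> L" using ab by (auto simp: C_def)
      moreover have "C g \<subseteq> C (b \<otimes> g)"
      proof
        fix x assume "x \<in> C g"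
        then have x: "x \<in> carrier R" "x \<otimes> g \<in> L" by (auto simp: C_def)
        have "x \<otimes> (b \<otimes> g) = b \<otimes> (x \<otimes> g)" using x(1) ab g by algebra
        then show "x \<in> C (b \<otimes> g)" using Lc(6)[OF ab(2) x(2)] x by (simp add: C_def)
      qed
      ultimately have "C (b \<otimes> g) = C g" using gmax[of "b \<otimes> g"] ab g by simp
      moreover have "a \<in> C (b \<otimes> g)" using ab g by (simp add: C_def m_assoc)
      ultimately show "a \<in> C g" by simp
    qed
  qed
  moreover have "L0 \<subseteq> C g" using L(2) Lc g by (auto simp: C_def)
  moreover have "C g \<subseteq> P"
    using sat g unfolding saturated_def C_def by blast
  ultimately have "C g = P" using minimal by blast
  then have Pg: "p \<otimes> g \<in> L" if "p \<in> P" for p using that by (auto simp: C_def)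
  have "adjoin R L g \<noteq> L" using adjoin_ideal(3)[OF L(1) g(1)] g(2) by blast
  then have "dcc_at R P (adjoin R L g)" using Lmax[OF adjoin_ideal(1,2)[OF L(1) g(1)]] by metis
  then show False using dcc_at_adjoin[OF P L(1) g(1) Pg] L(3) by blast
qed

text \<open>Krull's principal ideal theorem, in the form in which it moves a given element down a chain
  of primes. The ideals \<open>J n\<close> below are the contractions of the powers of \<open>y\<close> from the localisation
  of \<open>R / Q'\<close> at \<open>Q\<close>; they replace the symbolic powers of the classical proof.\<close>

lemma (in noetherian_cring) krull_principal_ideal:
  assumes Q': "primeideal Q' R" and Q: "primeideal Q R" and P: "primeideal P R"
    and chain: "Q' \<subset> Q" "Q \<subset> P" and x: "x \<in> P"
  shows "\<exists>Q''. primeideal Q'' R \<and> Q' \<subset> Q'' \<and> Q'' \<subset> P \<and> x \<in> Q''"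
proof (rule ccontr)
  assume contra: "\<not> ?thesis"
  interpret Q': primeideal Q' R by fact
  interpret Q: primeideal Q R by fact
  interpret P: primeideal P R by fact
  note Qc' = ideal_closed[OF Q'.is_ideal]
  have xQ: "x \<notin> Q"
  proof
    assume "x \<in> Q"
    then have "\<exists>Q''. primeideal Q'' R \<and> Q' \<subset> Q'' \<and> Q'' \<subset> P \<and> x \<in> Q''" using Q chain by (intro exI[of _ Q]) simp
    then show False using contra by contradiction
  qed
  have xc: "x \<in> carrier R" using P.Icarr[OF x] .
  define L where "L = adjoin R Q' x"
  have L: "ideal L R" "Q' \<subseteq> L" "x \<in> L"
    unfolding L_def using adjoin_ideal[OF Q'.is_ideal xc] by auto
  \<comment> \<open>The assumption to be refuted makes \<open>P\<close> minimal over
    \<open>Q' + R x\<close>: a prime in between contains \<open>x\<close>, so it differs from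
    \<open>Q'\<close>.\<close>
  have "dcc_at R P L"
  proof (rule dcc_at_minimal_prime[OF P L(1)])
    fix Q'' assume "primeideal Q'' R" "L \<subseteq> Q''" "Q'' \<subseteq> P"
    moreover from this have "Q' \<subset> Q''" using L(2,3) xQ chain(1) by blast
    ultimately show "Q'' = P" using contra L(3) by blast
  qed
  obtain y where y: "y \<in> Q" "y \<notin> Q'" using chain by blast
  have yc: "y \<in> carrier R" using Q.Icarr[OF y(1)] .
  define J where "J n = {a \<in> carrier R. \<exists>s \<in> carrier R - Q. \<exists>r \<in> carrier R. s \<otimes> a \<ominus> r \<otimes> y [^] n \<in> Q'}" for n :: nat
  have Jid: "ideal (J n) R" for n
  proof (rule ideal_by_closure)
    show "\<zero> \<in> J n"
      using Q.complement(1) yc Qc'(2)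
      by (auto simp: J_def a_minus_def intro!: bexI[of _ "\<one>"] bexI[of _ "\<zero>"])
  next
    define z where "z = y [^] n"
    have a: "z \<in> carrier R" using yc by (simp add: z_def)
    fix b b' assume "b \<in> J n" "b' \<in> J n"
    then obtain s r s' r' where *: "s \<in> carrier R - Q" "s' \<in> carrier R - Q" "r \<in> carrier R"
      "r' \<in> carrier R" "s \<otimes> b \<ominus> r \<otimes> z \<in> Q'" "s' \<otimes> b' \<ominus> r' \<otimes> z \<in> Q'" "b \<in> carrier R" "b' \<in> carrier R"
      by (auto simp: J_def z_def)
    have "(s \<otimes> s') \<otimes> (b \<oplus> b') \<ominus> (s' \<otimes> r \<oplus> s \<otimes> r') \<otimes> z
       = s' \<otimes> (s \<otimes> b \<ominus> r \<otimes> z) \<oplus> s \<otimes> (s' \<otimes> b' \<ominus> r' \<otimes> z)"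
      using DiffD1[OF *(1)] DiffD1[OF *(2)] *(3,4,7,8) a by algebra
    also have "\<dots> \<in> Q'"
      using Qc'(3)[OF Qc'(6)[OF DiffD1[OF *(2)] *(5)] Qc'(6)[OF DiffD1[OF *(1)] *(6)]] .
    finally have "(s \<otimes> s') \<otimes> (b \<oplus> b') \<ominus> (s' \<otimes> r \<oplus> s \<otimes> r') \<otimes> z \<in> Q'" .
    moreover have "s' \<otimes> r \<oplus> s \<otimes> r' \<in> carrier R" "b \<oplus> b' \<in> carrier R" using * by auto
    ultimately show "b \<oplus> b' \<in> J n" 
      unfolding J_def z_def using Q.complement(2)[OF *(1,2)] by blast
  next
    define z where "z = y [^] n"
    have a: "z \<in> carrier R" using yc by (simp add: z_def)
    fix t b assume t: "t \<in> carrier R" and "b \<in> J n"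
    then obtain s r where *: "s \<in> carrier R - Q" "r \<in> carrier R" "s \<otimes> b \<ominus> r \<otimes> z \<in> Q'" "b \<in> carrier R"
      by (auto simp: J_def z_def)
    have "s \<otimes> (t \<otimes> b) \<ominus> (t \<otimes> r) \<otimes> z = t \<otimes> (s \<otimes> b \<ominus> r \<otimes> z)"
      using DiffD1[OF *(1)] *(2,4) a t by algebra
    also have "\<dots> \<in> Q'" using Qc'(6)[OF t *(3)] .
    finally have "s \<otimes> (t \<otimes> b) \<ominus> (t \<otimes> r) \<otimes> z \<in> Q'" .
    moreover have "t \<otimes> r \<in> carrier R" "t \<otimes> b \<in> carrier R" using * t by auto
    ultimately show "t \<otimes> b \<in> J n" unfolding J_def z_def using *(1) by blast
  qed (auto simp: J_def)
  note Jc = ideal_closed[OF Jid]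
  have Jdec: "J (Suc n) \<subseteq> J n" for n
  proof
    fix a assume "a \<in> J (Suc n)"
    then obtain s r where *: "a \<in> carrier R" "s \<in> carrier R - Q" "r \<in> carrier R" "s \<otimes> a \<ominus> r \<otimes> y [^] Suc n \<in> Q'"
      by (auto simp: J_def)
    have "r \<otimes> y [^] Suc n = (r \<otimes> y) \<otimes> y [^] n"
      using yc *(3) nat_pow_closed[OF yc, of n] unfolding nat_pow_Suc by algebra
    then have "s \<otimes> a \<ominus> (r \<otimes> y) \<otimes> y [^] n \<in> Q'" using *(4) by simp
    moreover have "r \<otimes> y \<in> carrier R" using *(3) yc by simp
    ultimately show "a \<in> J n" unfolding J_def using *(1,2) by blast
  qed
  have JQ': "Q' \<subseteq> J n" for n
  proof
    fix q assume q: "q \<in> Q'"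
    have "\<one> \<otimes> q \<ominus> \<zero> \<otimes> y [^] n \<in> Q'" using q yc Qc'(1)[OF q] by (simp add: a_minus_def)
    then show "q \<in> J n" unfolding J_def using Q.complement(1) Qc'(1)[OF q] by blast
  qed
  have Jsat: "b \<in> J n" if s: "s \<in> carrier R - Q" and b: "b \<in> carrier R" "s \<otimes> b \<in> J n" for s b n
  proof -
    obtain t r where *: "t \<in> carrier R - Q" "r \<in> carrier R" "t \<otimes> (s \<otimes> b) \<ominus> r \<otimes> y [^] n \<in> Q'"
      using b(2) by (auto simp: J_def)
    have "(t \<otimes> s) \<otimes> b \<ominus> r \<otimes> y [^] n \<in> Q'"
      using *(3) m_assoc[OF DiffD1[OF *(1)] DiffD1[OF s] b(1)] by simp
    then show ?thesis unfolding J_def using b(1) *(2) Q.complement(2)[OF *(1) s] by blast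
  qed
  have "\<forall>n. ideal (J n) R" "\<forall>n. J (Suc n) \<subseteq> J n" by (simp_all only: Jid Jdec simp_thms)
  then have "\<exists>n0. \<forall>k\<ge>n0. \<forall>a \<in> J k. \<exists>s \<in> carrier R - P. \<exists>b \<in> J (Suc k). s \<otimes> a \<ominus> b \<in> L"
    using spec[OF \<open>dcc_at R P L\<close>[unfolded dcc_at_def], of J] by (simp only: simp_thms)
  then obtain n where max: "\<forall>k\<ge>n. \<forall>a \<in> J k. \<exists>s \<in> carrier R - P. \<exists>b \<in> J (Suc k). s \<otimes> a \<ominus> b \<in> L" ..
  have n: "\<forall>a \<in> J n. \<exists>s \<in> carrier R - P. \<exists>b \<in> J (Suc n). s \<otimes> a \<ominus> b \<in> L"
    by (rule mp[OF spec[OF max] order_refl])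
  \<comment> \<open>After localisation at \<open>P\<close> the chain condition yields
    \<open>J n = J (Suc n) + x J n\<close>, because \<open>x\<close> is outside \<open>Q\<close> and
    can be cancelled in \<open>J n\<close>. Nakayama's lemma removes the last summand.\<close>
  have "J n \<subseteq> J (Suc n)"
  proof (rule principal_nakayama[OF P x Jid])
    show "saturated R P (J (Suc n))"
      unfolding saturated_def
    proof (intro ballI impI)
      fix s b assume "s \<in> carrier R - P" "b \<in> carrier R" "s \<otimes> b \<in> J (Suc n)"
      moreover from this have "s \<in> carrier R - Q" using chain(2) by blast
      ultimately show "b \<in> J (Suc n)" using Jsat by metis
    qed
    show "J n \<subseteq> carrier R" by (auto simp: J_def)
    fix a assume a: "a \<in> J n"
    then obtain s b where s: "s \<in> carrier R - P" and b: "b \<in> J (Suc n)" and "s \<otimes> a \<ominus> b \<in> L"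
      using bspec[OF n a] by (elim bexE)
    then obtain q r where q: "q \<in> Q'" and r: "r \<in> carrier R" and e: "s \<otimes> a \<ominus> b = q \<oplus> r \<otimes> x"
      unfolding L_def adjoin_def by blast
    have c: "a \<in> carrier R" "b \<in> carrier R" "q \<in> carrier R" "s \<in> carrier R"
      using Jc(1) a b q s Q'.Icarr by auto
    have "x \<otimes> r = (q \<oplus> r \<otimes> x) \<ominus> q" using xc r c by algebra
    also have "\<dots> = s \<otimes> a \<ominus> b \<ominus> q" by (simp only: e)
    also have "\<dots> \<in> J n"
      using Jc(5)[OF Jc(5)[OF Jc(6)[OF c(4) a]]] b Jdec q JQ' by blast
    finally have "r \<in> J n" using Jsat xc xQ r by blast
    have "s \<otimes> a \<ominus> x \<otimes> r = b \<oplus> (s \<otimes> a \<ominus> b) \<ominus> x \<otimes> r" using c xc r by algebra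
    also have "\<dots> = b \<oplus> (q \<oplus> r \<otimes> x) \<ominus> x \<otimes> r" by (simp only: e)
    also have "\<dots> = b \<oplus> q" using c xc r by algebra
    also have "\<dots> \<in> J (Suc n)" using Jc(3)[OF b] q JQ' by blast
    finally have "s \<otimes> a \<ominus> x \<otimes> r \<in> J (Suc n)" .
    then show "\<exists>s\<in>carrier R - P. \<exists>a'\<in>J n. s \<otimes> a \<ominus> x \<otimes> a' \<in> J (Suc n)"
      using s \<open>r \<in> J n\<close> by blast
  qed
  moreover have "y [^] n \<in> J n"
    unfolding J_def using Q.complement(1) yc Qc'(2)
    by (auto simp: a_minus_def r_neg intro!: bexI[of _ "\<one>"])
  ultimately have "y [^] n \<in> J (Suc n)" by blast
  then obtain s r where s: "s \<in> carrier R - Q" and r: "r \<in> carrier R"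
    and e: "s \<otimes> y [^] n \<ominus> r \<otimes> y [^] Suc n \<in> Q'" by (auto simp: J_def)
  \<comment> \<open>Stationarity at \<open>n\<close> means \<open>y^n (s - r y) \<in> Q'\<close>.
    Neither factor lies in \<open>Q'\<close>: powers of \<open>y\<close> stay outside this prime,
    and \<open>s - r y\<close> is even outside \<open>Q\<close>.\<close>
  have "s \<otimes> y [^] n \<ominus> r \<otimes> y [^] Suc n = y [^] n \<otimes> (s \<ominus> r \<otimes> y)"
    using yc r DiffD1[OF s] nat_pow_closed[OF yc, of n] unfolding nat_pow_Suc by algebra
  then have "y [^] n \<otimes> (s \<ominus> r \<otimes> y) \<in> Q'" using e by simp
  moreover have "y [^] n \<notin> Q'" for n :: nat
  proof (induction n)
    case 0 then show ?case using Q'.complement(1) by simp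
  next
    case (Suc n) then show ?case using Q'.I_prime[of "y [^] n" y] yc y(2) by auto
  qed
  ultimately have "s \<ominus> r \<otimes> y \<in> Q'" using Q'.I_prime yc r s by (meson DiffD1 m_closed minus_closed nat_pow_closed)
  moreover have "s \<ominus> r \<otimes> y \<in> carrier R - Q" using Q.complement(3)[OF s] Q.I_l_closed[OF y(1) r] by blast
  ultimately show False using chain by blast
qed

text \<open>Krull's theorem, applied from the top of the chain downwards, replaces the middle one of
  three consecutive primes by a prime containing \<open>x\<close>. The bottom prime is left behind,
  so the chain becomes shorter by one.\<close>

lemma (in noetherian_cring) prime_chain_move:
  assumes "\<And>i. i \<le> Suc n \<Longrightarrow> primeideal (C i) R" "\<And>i. i \<le> n \<Longrightarrow> C i \<subset> C (Suc i)" "x \<in> C (Suc n)"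
  shows "\<exists>D. (\<forall>i \<le> n. primeideal (D i) R) \<and> (\<forall>i < n. D i \<subset> D (Suc i)) \<and> D n = C (Suc n) \<and> C 0 \<subset> D 0 \<and> x \<in> D 0"
  using assms
proof (induction n arbitrary: C)
  case 0
  then show ?case by (intro exI[of _ "\<lambda>i. C (Suc i)"]) auto
next
  case (Suc n)
  have "\<exists>Q. primeideal Q R \<and> C n \<subset> Q \<and> Q \<subset> C (Suc (Suc n)) \<and> x \<in> Q"
    using Suc.prems by (intro krull_principal_ideal[where Q = "C (Suc n)"]) auto
  then obtain Q where Q: "primeideal Q R" "C n \<subset> Q" "Q \<subset> C (Suc (Suc n))" "x \<in> Q" by blast
  define C' where "C' i = (if i = Suc n then Q else C i)" for i
  have "\<exists>D. (\<forall>i \<le> n. primeideal (D i) R) \<and> (\<forall>i < n. D i \<subset> D (Suc i)) \<and> D n = C' (Suc n) \<and> C' 0 \<subset> D 0 \<and> x \<in> D 0"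
    using Suc.prems Q by (intro Suc.IH) (auto simp: C'_def)
  then obtain D where D: "\<forall>i \<le> n. primeideal (D i) R" "\<forall>i < n. D i \<subset> D (Suc i)" "D n = Q" "C 0 \<subset> D 0" "x \<in> D 0"
    by (auto simp: C'_def)
  show ?case
  proof (intro exI[of _ "\<lambda>i. if i = Suc n then C (Suc (Suc n)) else D i"] conjI allI impI)
    fix i assume "i < Suc n"
    then show "(if i = Suc n then C (Suc (Suc n)) else D i) \<subset> (if Suc i = Suc n then C (Suc (Suc n)) else D (Suc i))"
      using D Q by (cases "i = n") auto
  qed (use D Q Suc.prems in auto)
qed

text \<open>Minimality is required over \<open>C 0\<close> and \<open>X\<close> jointly, so that
  \<open>x\<close> can be handed over from \<open>X\<close> to the bottom prime; each generator
  costs one step of the chain. Once \<open>X\<close> is empty, \<open>C 0\<close> itself competes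
  with \<open>C n\<close>.\<close>

lemma (in noetherian_cring) krull_height:
  assumes "finite X" "\<And>i. i \<le> n \<Longrightarrow> primeideal (C i) R" "\<And>i. i < n \<Longrightarrow> C i \<subset> C (Suc i)" "X \<subseteq> C n"
    and "\<And>Q. primeideal Q R \<Longrightarrow> C 0 \<subseteq> Q \<Longrightarrow> X \<subseteq> Q \<Longrightarrow> Q \<subseteq> C n \<Longrightarrow> Q = C n"
  shows "n \<le> card X"
  using assms
proof (induction X arbitrary: C n rule: finite_induct)
  case empty
  have sub: "C 0 \<subseteq> C i" if "i \<le> n" for i
    using that
  proof (induction i)
    case (Suc i) then show ?case using empty.prems(2)[of i] by auto
  qed auto
  have "C 0 = C n" using empty.prems(1)[of 0] empty.prems(4)[of "C 0"] sub[of n] by auto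
  moreover have "C 0 \<subset> C n" if "n > 0"
    using sub[of "n - 1"] empty.prems(2)[of "n - 1"] that by auto
  ultimately show ?case by auto
next
  case (insert x X)
  show ?case
  proof (cases n)
    case (Suc k)
    have "\<exists>D. (\<forall>i \<le> k. primeideal (D i) R) \<and> (\<forall>i < k. D i \<subset> D (Suc i)) \<and> D k = C (Suc k) \<and> C 0 \<subset> D 0 \<and> x \<in> D 0"
      using insert.prems Suc by (intro prime_chain_move) auto
    then obtain D where D: "\<And>i. i \<le> k \<Longrightarrow> primeideal (D i) R" "\<And>i. i < k \<Longrightarrow> D i \<subset> D (Suc i)"
      "D k = C n" "C 0 \<subset> D 0" "x \<in> D 0" using Suc by blast
    have "k \<le> card X"
    proof (rule insert.IH[of k D])
      fix Q assume "primeideal Q R" "D 0 \<subseteq> Q" "X \<subseteq> Q" "Q \<subseteq> D k"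
      moreover from this have "C 0 \<subseteq> Q" "insert x X \<subseteq> Q" using D(4,5) by blast+
      ultimately show "Q = D k" using insert.prems(4)[of Q] D(3) by simp
    qed (use D insert.prems(3) in auto)
    then show ?thesis using insert.hyps Suc by simp
  qed simp
qed

section \<open>Local rings and regularity\<close>

context local_noetherian_ring
begin

lemma maximal_max_ideal: "maximalideal (max_ideal R) R"
  unfolding max_ideal_def by (rule theI'[OF unique_maximalideal])

lemma prime_max_ideal: "primeideal (max_ideal R) R"
  by (rule maximalideal_prime[OF maximal_max_ideal])

lemma ideal_max_ideal: "ideal (max_ideal R) R"
  by (rule maximalideal.axioms(1)[OF maximal_max_ideal])

lemma max_ideal_closed [simp]: "a \<in> max_ideal R \<Longrightarrow> a \<in> carrier R"
  by (rule ideal_closed(1)[OF ideal_max_ideal])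

lemma one_notin_max_ideal: "\<one> \<notin> max_ideal R"
  using primeideal.complement(1)[OF prime_max_ideal] by auto

lemma subset_max_ideal:
  assumes I: "ideal I R" and one: "\<one> \<notin> I"
  shows "I \<subseteq> max_ideal R"
proof -
  let ?X = "{L. ideal L R \<and> I \<subseteq> L \<and> \<one> \<notin> L}"
  have "\<exists>L\<in>?X. \<forall>K\<in>?X. L \<subseteq> K \<longrightarrow> K = L"
    using assms by (intro noetherian_maximal) auto
  then obtain L where LX: "L \<in> ?X" and max: "\<forall>K\<in>?X. L \<subseteq> K \<longrightarrow> K = L" by (elim bexE)
  have "maximalideal L R"
  proof (rule maximalidealI)
    show "ideal L R" using LX by simp
    show "carrier R \<noteq> L" using LX by auto
    fix J assume J: "ideal J R" "L \<subseteq> J" "J \<subseteq> carrier R"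
    show "J = L \<or> J = carrier R"
    proof (cases "\<one> \<in> J")
      case True
      then show ?thesis using ideal.one_imp_carrier[OF J(1)] by simp
    next
      case False
      then have "J \<in> ?X" using J LX by auto
      then show ?thesis using max J(2) by simp
    qed
  qed
  then have "L = max_ideal R"
    using unique_maximalideal maximal_max_ideal by (elim ex1E) metis
  then show ?thesis using LX by auto
qed

lemma Units_of_not_max_ideal:
  assumes "a \<in> carrier R" "a \<notin> max_ideal R"
  shows "a \<in> Units R"
proof -
  note id = adjoin_ideal[OF zeroideal assms(1)]
  have "\<one> \<in> adjoin R {\<zero>} a" using subset_max_ideal[OF id(1)] id(3) assms(2) by auto
  then obtain r where r: "r \<in> carrier R" "\<one> = r \<otimes> a" using assms(1) by (auto simp: adjoin_def)
  then have "a \<otimes> r = \<one>" using m_comm assms(1) by simp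
  then show ?thesis using r assms(1) unfolding Units_def by auto
qed

lemma mem_ideal_unit:
  assumes "ideal L R" "s \<in> carrier R" "s \<notin> max_ideal R" "a \<in> carrier R" "s \<otimes> a \<in> L"
  shows "a \<in> L"
proof -
  have s: "s \<in> Units R" using Units_of_not_max_ideal assms(2,3) .
  have "inv s \<otimes> (s \<otimes> a) \<in> L" using ideal_closed(6)[OF assms(1) Units_inv_closed[OF s] assms(5)] .
  moreover have "inv s \<otimes> (s \<otimes> a) = a"
    using s assms(2,4) by (simp add: Units_l_inv flip: m_assoc)
  ultimately show ?thesis by simp
qed

lemma local_principal_nakayama:
  assumes x: "x \<in> max_ideal R" and L: "ideal L R" and J: "J \<subseteq> carrier R"
    and step: "\<And>a. a \<in> J \<Longrightarrow> \<exists>a' \<in> J. a \<ominus> x \<otimes> a' \<in> L"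
  shows "J \<subseteq> L"
proof (rule principal_nakayama[OF prime_max_ideal x L _ J])
  show "saturated R (max_ideal R) L"
    unfolding saturated_def using mem_ideal_unit[OF L] by auto
  fix a assume a: "a \<in> J"
  then obtain a' where "a' \<in> J" "a \<ominus> x \<otimes> a' \<in> L" using step by blast
  moreover have "\<one> \<otimes> a = a" using a J by auto
  ultimately show "\<exists>s\<in>carrier R - max_ideal R. \<exists>a'\<in>J. s \<otimes> a \<ominus> x \<otimes> a' \<in> L"
    using one_notin_max_ideal by (intro bexI[of _ "\<one>"] bexI[of _ a']) auto
qed

text \<open>By Nakayama's lemma a zero divisor modulo \<open>J\<close> is killed by some element
  outside the prime \<open>J + R x\<close>. Doing this for \<open>a\<close> and then for the element
  found produces two elements outside that prime with product in \<open>J\<close>.\<close>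

lemma prime_of_adjoin:
  assumes J: "ideal J R" and x: "x \<in> max_ideal R"
    and reg: "\<And>a. a \<in> carrier R \<Longrightarrow> x \<otimes> a \<in> J \<Longrightarrow> a \<in> J"
    and prime: "primeideal (adjoin R J x) R"
  shows "primeideal J R"
proof (rule primeidealI[OF J cring_axioms])
  interpret P: primeideal "adjoin R J x" R by fact
  note Jc = ideal_closed[OF J]
  have xc: "x \<in> carrier R" using x by simp
  note adj = adjoin_ideal[OF J xc]
  have "J \<subseteq> adjoin R J x" using adj by simp
  then show "carrier R \<noteq> J" using P.I_notcarr Jc(1) P.Icarr by blast
  have step: "\<exists>c. c \<in> carrier R \<and> c \<otimes> a \<in> J \<and> c \<notin> adjoin R J x"
    if a: "a \<in> carrier R" and b: "b \<in> carrier R" "b \<otimes> a \<in> J" "b \<notin> J" for a b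
  proof (rule ccontr)
    assume contra: "\<not> ?thesis"
    \<comment> \<open>The annihilator of \<open>a\<close> modulo \<open>J\<close>. If it lay in
      \<open>J + R x\<close>, regularity of \<open>x\<close> would allow \<open>x\<close> to be
      divided out, giving \<open>K \<subseteq> J + x K\<close>.\<close>
    define K where "K = {c \<in> carrier R. c \<otimes> a \<in> J}"
    have "K \<subseteq> J"
    proof (rule local_principal_nakayama[OF x J])
      show "K \<subseteq> carrier R" by (auto simp: K_def)
      fix c assume "c \<in> K"
      then have c: "c \<in> carrier R" "c \<otimes> a \<in> J" by (auto simp: K_def)
      then have "c \<in> adjoin R J x" using contra by auto
      then obtain j r where jr: "j \<in> J" "r \<in> carrier R" "c = j \<oplus> r \<otimes> x"
        unfolding adjoin_def by blast
      have jc: "j \<in> carrier R" using Jc(1)[OF jr(1)] .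
      have "x \<otimes> (r \<otimes> a) = c \<otimes> a \<ominus> j \<otimes> a" unfolding jr(3) using jc jr(2) xc a by algebra
      also have "\<dots> \<in> J" using Jc(5)[OF c(2) Jc(7)[OF a jr(1)]] .
      finally have "r \<otimes> a \<in> J" using reg a jr(2) by simp
      then have "r \<in> K" using jr(2) by (simp add: K_def)
      moreover have "c \<ominus> x \<otimes> r = j" unfolding jr(3) using jc jr(2) xc by algebra
      ultimately show "\<exists>a'\<in>K. c \<ominus> x \<otimes> a' \<in> J" using jr(1) by auto
    qed
    then show False using b by (auto simp: K_def)
  qed
  fix a b assume ab: "a \<in> carrier R" "b \<in> carrier R" "a \<otimes> b \<in> J"
  show "a \<in> J \<or> b \<in> J"
  proof (rule ccontr)
    assume n: "\<not> (a \<in> J \<or> b \<in> J)"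
    have "b \<otimes> a \<in> J" using ab m_comm by simp
    then obtain c where c: "c \<in> carrier R" "c \<otimes> a \<in> J" "c \<notin> adjoin R J x"
      using step[OF ab(1,2)] n by auto
    have "a \<otimes> c \<in> J" using c ab m_comm by simp
    then obtain d where d: "d \<in> carrier R" "d \<otimes> c \<in> J" "d \<notin> adjoin R J x"
      using step[OF c(1) ab(1)] n by auto
    then have "d \<otimes> c \<in> adjoin R J x" using adj(2) by auto
    then show False using P.I_prime c d by auto
  qed
qed

end

text \<open>Generating the ideal one element at a time yields the initial ideals of the sequence,
  which carry both the notion of a regular sequence and the chain of primes.\<close>

primrec span_ideal :: "('a, 'r) ring_scheme \<Rightarrow> (nat \<Rightarrow> 'a) \<Rightarrow> nat \<Rightarrow> 'a set"
  where "span_ideal R x 0 = {\<zero>\<^bsub>R\<^esub>}"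
  | "span_ideal R x (Suc n) = adjoin R (span_ideal R x n) (x n)"

lemma (in cring) span_ideal_ideal:
  "(\<And>l. l < n \<Longrightarrow> x l \<in> carrier R) \<Longrightarrow> ideal (span_ideal R x n) R"
  by (induction n) (auto simp: zeroideal intro: adjoin_ideal)

lemma (in cring) span_ideal_mem:
  "(\<And>l. l < n \<Longrightarrow> x l \<in> carrier R) \<Longrightarrow> l < n \<Longrightarrow> x l \<in> span_ideal R x n"
proof (induction n)
  case (Suc n)
  have id: "ideal (span_ideal R x n) R" using Suc.prems by (intro span_ideal_ideal) auto
  have "x n \<in> carrier R" using Suc.prems by simp
  note adj = adjoin_ideal[OF id this]
  show ?case
  proof (cases "l = n")
    case False
    then have "x l \<in> span_ideal R x n" using Suc by simp
    then show ?thesis using adj(2) by auto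
  qed (use adj in simp)
qed simp

lemma (in cring) span_ideal_least:
  "ideal K R \<Longrightarrow> (\<And>l. l < n \<Longrightarrow> x l \<in> K) \<Longrightarrow> span_ideal R x n \<subseteq> K"
  by (induction n) (auto simp: ideal_closed(2) dest: adjoin_subset)

text \<open>Minimality is recorded as strictness of the chain of initial ideals, the form in which
  it produces a strict chain of primes.\<close>

definition minimal_generators :: "('a, 'r) ring_scheme \<Rightarrow> (nat \<Rightarrow> 'a) \<Rightarrow> nat \<Rightarrow> bool"
  where "minimal_generators R x c \<longleftrightarrow> (\<forall>l < c. x l \<in> carrier R) \<and>
    span_ideal R x c = max_ideal R \<and> (\<forall>l < c. x l \<notin> span_ideal R x l)"

context local_noetherian_ring
begin

lemma exists_minimal_generators: "\<exists>x. minimal_generators R x (embedding_dimension R)"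
proof -
  let ?P = "\<lambda>n. \<exists>S \<subseteq> carrier R. finite S \<and> card S = n \<and> Idl S = max_ideal R"
  have "\<exists>n. ?P n" using finetely_gen[OF ideal_max_ideal] by metis
  then have "?P (embedding_dimension R)" unfolding embedding_dimension_def by (rule LeastI_ex)
  then obtain S where S: "S \<subseteq> carrier R" "finite S" "card S = embedding_dimension R" "Idl S = max_ideal R"
    by blast
  obtain x where bij: "bij_betw x {0..<card S} S" using ex_bij_betw_nat_finite[OF S(2)] by blast
  let ?c = "embedding_dimension R"
  have img: "x ` {0..<?c} = S" using bij S(3) by (simp add: bij_betw_def)
  have xS: "x l \<in> S" if "l < ?c" for l using img that by auto
  then have xc: "x l \<in> carrier R" if "l < ?c" for l using that S(1) by auto
  have "x l \<notin> span_ideal R x l" if l: "l < ?c" for l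
  proof
    assume mem: "x l \<in> span_ideal R x l"
    let ?T = "S - {x l}"
    have T: "?T \<subseteq> carrier R" using S(1) by auto
    have "x k \<in> Idl ?T" if "k < l" for k
    proof -
      have "x k \<noteq> x l" using inj_onD[OF bij_betw_imp_inj_on[OF bij], of k l] l that S(3) by auto
      then have "x k \<in> ?T" using xS that l by auto
      then show ?thesis using genideal_self[OF T] by auto
    qed
    then have "span_ideal R x l \<subseteq> Idl ?T" using genideal_ideal[OF T] by (intro span_ideal_least)
    then have "S \<subseteq> Idl ?T" using mem genideal_self[OF T] by auto
    then have "Idl S \<subseteq> Idl ?T" using genideal_minimal[OF genideal_ideal[OF T]] by simp
    moreover have "Idl ?T \<subseteq> Idl S"
      using genideal_minimal[OF genideal_ideal[OF S(1)]] genideal_self[OF S(1)] by blast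
    ultimately have "?P (card ?T)" using S T by (intro exI[of _ ?T]) auto
    then have "?c \<le> card ?T" unfolding embedding_dimension_def by (rule Least_le)
    moreover have "card ?T < ?c" using S xS[OF l] by (metis card_Diff1_less)
    ultimately show False by simp
  qed
  moreover have "span_ideal R x ?c = max_ideal R"
  proof
    show "span_ideal R x ?c \<subseteq> max_ideal R"
      using xS genideal_self[OF S(1)] S(4) by (intro span_ideal_least[OF ideal_max_ideal]) auto
    have id: "ideal (span_ideal R x ?c) R" using xc by (rule span_ideal_ideal)
    have "S \<subseteq> span_ideal R x ?c" using span_ideal_mem[of ?c x, OF xc] img by auto
    from genideal_minimal[OF id this] show "max_ideal R \<subseteq> span_ideal R x ?c" by (simp add: S(4))
  qed
  ultimately show ?thesis unfolding minimal_generators_def using xc by auto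
qed

lemma krull_dimension_le:
  assumes "\<And>l. l < c \<Longrightarrow> x l \<in> carrier R" "span_ideal R x c = max_ideal R"
  shows "krull_dimension R \<le> enat c"
  unfolding krull_dimension_def chain_length_def
proof (rule Sup_least, clarsimp)
  fix n C assume C: "\<forall>i\<le>n. primeideal (C i) R" "\<forall>i<n. C i \<subset> C (Suc i)"
  let ?X = "x ` {..<c}"
  have X: "Q = max_ideal R" if "primeideal Q R" "?X \<subseteq> Q" "Q \<subseteq> max_ideal R" for Q
    using span_ideal_least[of Q c x] that assms(2) primeideal.axioms(1)[OF that(1)] by auto
  have Xm: "?X \<subseteq> max_ideal R" using span_ideal_mem[of c x, OF assms(1)] assms(2) by auto
  have le: "k \<le> c" if D: "\<And>i. i \<le> k \<Longrightarrow> primeideal (D i) R" "\<And>i. i < k \<Longrightarrow> D i \<subset> D (Suc i)" "D k = max_ideal R" for k D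
  proof -
    have "k \<le> card ?X"
      by (rule krull_height[of ?X k D]) (use D X Xm in auto)
    also have "\<dots> \<le> c" using card_image_le[of "{..<c}" x] by simp
    finally show ?thesis .
  qed
  show "n \<le> c"
  proof (cases "C n = max_ideal R")
    case True
    then show ?thesis using le[of n C] C by auto
  next
    case False
    interpret P: primeideal "C n" R using C by simp
    have "C n \<subset> max_ideal R"
      using subset_max_ideal[OF P.is_ideal] P.complement(1) False by auto
    \<comment> \<open>The height bound concerns chains that end at \<open>\<mm>\<close>, so any
      other chain is first prolonged by \<open>\<mm>\<close>.\<close>
    define D where "D i = (if i = Suc n then max_ideal R else C i)" for i
    have "Suc n \<le> c"
    proof (rule le[of "Suc n" D])
      show "primeideal (D i) R" if "i \<le> Suc n" for i
        using that C(1) prime_max_ideal by (cases "i = Suc n") (simp_all add: D_def)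
      show "D i \<subset> D (Suc i)" if "i < Suc n" for i
        using that C(2) \<open>C n \<subset> max_ideal R\<close> by (cases "i = n") (simp_all add: D_def)
    qed (simp add: D_def)
    then show ?thesis by simp
  qed
qed

text \<open>The hypothesis says that the generators form a regular sequence. Primality descends from
  \<open>\<mm>\<close> to all initial ideals by removing the last generator, which gives a strict
  chain of \<open>c + 1\<close> primes; the height theorem supplies the other inequality.\<close>

lemma regular_local_ringI:
  assumes gens: "minimal_generators R x (embedding_dimension R)"
    and reg: "\<And>l a. l < embedding_dimension R \<Longrightarrow> a \<in> carrier R \<Longrightarrow>
      x l \<otimes> a \<in> span_ideal R x l \<Longrightarrow> a \<in> span_ideal R x l"
  shows "regular_local_ring R"
proof -
  let ?c = "embedding_dimension R"
  have xc: "x l \<in> carrier R" if "l < ?c" for l using gens that by (auto simp: minimal_generators_def)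
  have top: "span_ideal R x ?c = max_ideal R" using gens by (auto simp: minimal_generators_def)
  have xm: "x l \<in> max_ideal R" if "l < ?c" for l using span_ideal_mem[of ?c x l, OF xc that] top by simp
  have id: "ideal (span_ideal R x i) R" if "i \<le> ?c" for i using that xc by (intro span_ideal_ideal) auto
  have prime: "primeideal (span_ideal R x i) R" if "i \<le> ?c" for i
    using that
  proof (induction rule: inc_induct)
    case base
    then show ?case using prime_max_ideal top by simp
  next
    case (step i)
    then show ?case using prime_of_adjoin[OF id xm reg, of i i] by auto
  qed
  have "enat ?c \<le> krull_dimension R"
    unfolding krull_dimension_def chain_length_def
  proof (rule Sup_upper, clarsimp, intro exI[of _ "span_ideal R x"] conjI allI impI)
    fix i assume i: "i < ?c"
    have "x i \<notin> span_ideal R x i" using gens i by (auto simp: minimal_generators_def)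
    then show "span_ideal R x i \<subset> span_ideal R x (Suc i)"
      using adjoin_ideal[OF id xc, of i i] i by auto
  qed (use prime in auto)
  then have "krull_dimension R = enat ?c"
    using krull_dimension_le[OF xc top] by (intro antisym) auto
  then show ?thesis unfolding regular_local_ring_def using local_noetherian_ring_axioms by simp
qed

end

section \<open>Koszul relations\<close>

lemma (in abelian_monoid) finsum_lessThan_Suc:
  fixes c :: nat
  assumes "\<And>l. l < Suc c \<Longrightarrow> f l \<in> carrier G"
  shows "(\<Oplus>l\<in>{..<Suc c}. f l) = (\<Oplus>l\<in>{..<c}. f l) \<oplus> f c"
proof -
  have "(\<Oplus>l\<in>{..<Suc c}. f l) = f c \<oplus> (\<Oplus>l\<in>{..<c}. f l)"
    unfolding lessThan_Suc using assms by (intro finsum_insert) auto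
  also have "\<dots> = (\<Oplus>l\<in>{..<c}. f l) \<oplus> f c"
    using assms by (intro a_comm finsum_closed) auto
  finally show ?thesis .
qed

lemma (in abelian_monoid) finsum_single:
  assumes "finite A" "i \<in> A" "f i \<in> carrier G" "\<And>j. j \<in> A \<Longrightarrow> j \<noteq> i \<Longrightarrow> f j = \<zero>"
  shows "(\<Oplus>j\<in>A. f j) = f i"
proof -
  have "(\<Oplus>j\<in>A. f j) = (\<Oplus>j\<in>A. if i = j then f j else \<zero>)"
    using assms by (intro finsum_cong') auto
  also have "\<dots> = f i"
  proof (rule trans[OF finsum_cong' finsum_singleton[OF assms(2,1), of "\<lambda>_. f i"]])
  qed (use assms in auto)
  finally show ?thesis .
qed

lemma (in abelian_group) neg_zero: "\<ominus> \<zero> = \<zero>"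
  by (rule minus_equality) simp_all

lemma (in abelian_group) minus_zero_right: "a \<in> carrier G \<Longrightarrow> a \<ominus> \<zero> = a"
  unfolding a_minus_def neg_zero by simp

lemma (in abelian_group) finsum_neg:
  assumes "f \<in> A \<rightarrow> carrier G"
  shows "(\<Oplus>i\<in>A. \<ominus> f i) = \<ominus> (\<Oplus>i\<in>A. f i)"
proof (cases "finite A")
  case True
  have "(\<Oplus>i\<in>A. f i) \<oplus> (\<Oplus>i\<in>A. \<ominus> f i) = (\<Oplus>i\<in>A. f i \<oplus> \<ominus> f i)"
    using assms by (intro finsum_addf[symmetric]) auto
  also have "\<dots> = (\<Oplus>i\<in>A. \<zero>)" using assms by (intro finsum_cong') (auto simp: r_neg Pi_iff)
  finally have "(\<Oplus>i\<in>A. f i) \<oplus> (\<Oplus>i\<in>A. \<ominus> f i) = \<zero>" by simp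
  moreover have "(\<Oplus>i\<in>A. f i) \<in> carrier G" "(\<Oplus>i\<in>A. \<ominus> f i) \<in> carrier G"
    using assms by (auto intro!: finsum_closed)
  ultimately show ?thesis by (metis a_comm minus_equality)
next
  case False
  then show ?thesis by (simp only: finsum_infinite[OF False] neg_zero)
qed

text \<open>The computation behind every \<open>d d = 0\<close>: terms off the diagonal cancel in
  pairs. The diagonal is kept, since it vanishes for Koszul boundaries but for Tate's differential
  adds up to \<open>lin R x c z\<close> acting on a coefficient.\<close>

lemma (in abelian_group) finsum_alternating:
  fixes c :: nat
  assumes "\<And>l k. l < c \<Longrightarrow> k < c \<Longrightarrow> f l k \<in> carrier G"
    and "\<And>l k. l < c \<Longrightarrow> k < c \<Longrightarrow> l \<noteq> k \<Longrightarrow> f l k = \<ominus> f k l"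
  shows "(\<Oplus>l\<in>{..<c}. \<Oplus>k\<in>{..<c}. f l k) = (\<Oplus>l\<in>{..<c}. f l l)"
  using assms
proof (induction c)
  case (Suc c)
  have cl: "f l k \<in> carrier G" if "l \<le> c" "k \<le> c" for l k using Suc.prems(1) that by simp
  have "(\<Oplus>l\<in>{..<Suc c}. \<Oplus>k\<in>{..<Suc c}. f l k)
      = (\<Oplus>l\<in>{..<Suc c}. (\<Oplus>k\<in>{..<c}. f l k) \<oplus> f l c)"
    using cl by (intro finsum_cong' finsum_lessThan_Suc) auto
  also have "\<dots> = (\<Oplus>l\<in>{..<c}. (\<Oplus>k\<in>{..<c}. f l k) \<oplus> f l c) \<oplus> ((\<Oplus>k\<in>{..<c}. f c k) \<oplus> f c c)"
    using cl by (intro finsum_lessThan_Suc) auto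
  also have "(\<Oplus>l\<in>{..<c}. (\<Oplus>k\<in>{..<c}. f l k) \<oplus> f l c) = (\<Oplus>l\<in>{..<c}. \<Oplus>k\<in>{..<c}. f l k) \<oplus> (\<Oplus>l\<in>{..<c}. f l c)"
    using cl by (intro finsum_addf) auto
  also have "(\<Oplus>l\<in>{..<c}. \<Oplus>k\<in>{..<c}. f l k) = (\<Oplus>l\<in>{..<c}. f l l)"
  proof (rule Suc.IH)
    fix l k assume lk: "l < c" "k < c"
    show "f l k \<in> carrier G" using cl lk by simp
    show "f l k = \<ominus> f k l" if "l \<noteq> k" using lk that by (intro Suc.prems(2)) auto
  qed
  also have "(\<Oplus>l\<in>{..<c}. f l c) = (\<Oplus>l\<in>{..<c}. \<ominus> f c l)"
    using Suc.prems(2)[of _ c] cl by (intro finsum_cong') auto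
  also have "\<dots> = \<ominus> (\<Oplus>l\<in>{..<c}. f c l)"
    using cl by (intro finsum_neg) auto
  finally have "(\<Oplus>l\<in>{..<Suc c}. \<Oplus>k\<in>{..<Suc c}. f l k) =
    ((\<Oplus>l\<in>{..<c}. f l l) \<oplus> \<ominus> (\<Oplus>l\<in>{..<c}. f c l)) \<oplus> ((\<Oplus>k\<in>{..<c}. f c k) \<oplus> f c c)" .
  moreover have "(p \<oplus> \<ominus> q) \<oplus> (q \<oplus> r) = p \<oplus> r" if "p \<in> carrier G" "q \<in> carrier G" "r \<in> carrier G" for p q r
    using that by (simp add: a_assoc r_neg2 r_neg1)
  ultimately have "(\<Oplus>l\<in>{..<Suc c}. \<Oplus>k\<in>{..<Suc c}. f l k) = (\<Oplus>l\<in>{..<c}. f l l) \<oplus> f c c"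
    using cl by simp
  also have "\<dots> = (\<Oplus>l\<in>{..<Suc c}. f l l)"
    using cl by (intro finsum_lessThan_Suc[symmetric]) auto
  finally show ?case .
qed simp

text \<open>Elements of \<open>R\<^sup>c\<close> are functions on \<open>nat\<close> that vanish from \<open>c\<close> on, so that \<open>R\<^sup>c\<close> is
  contained in \<open>R\<^bsup>c+1\<^esup>\<close>.\<close>

definition vectors :: "('a, 'r) ring_scheme \<Rightarrow> nat \<Rightarrow> (nat \<Rightarrow> 'a) set"
  where "vectors R c = {z. (\<forall>l. z l \<in> carrier R) \<and> (\<forall>l\<ge>c. z l = \<zero>\<^bsub>R\<^esub>)}"

definition lin :: "('a, 'r) ring_scheme \<Rightarrow> (nat \<Rightarrow> 'a) \<Rightarrow> nat \<Rightarrow> (nat \<Rightarrow> 'a) \<Rightarrow> 'a"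
  where "lin R x c z = (\<Oplus>\<^bsub>R\<^esub>l\<in>{..<c}. z l \<otimes>\<^bsub>R\<^esub> x l)"

definition vector_submodule :: "('a, 'r) ring_scheme \<Rightarrow> nat \<Rightarrow> (nat \<Rightarrow> 'a) set \<Rightarrow> bool"
  where "vector_submodule R c Z \<longleftrightarrow> Z \<subseteq> vectors R c \<and> (\<lambda>_. \<zero>\<^bsub>R\<^esub>) \<in> Z \<and>
    (\<forall>u \<in> Z. \<forall>v \<in> Z. (\<lambda>l. u l \<oplus>\<^bsub>R\<^esub> v l) \<in> Z) \<and>
    (\<forall>r \<in> carrier R. \<forall>v \<in> Z. (\<lambda>l. r \<otimes>\<^bsub>R\<^esub> v l) \<in> Z)"

text \<open>The cycles of degree one in the Koszul complex.\<close>

definition relations :: "('a, 'r) ring_scheme \<Rightarrow> (nat \<Rightarrow> 'a) \<Rightarrow> nat \<Rightarrow> (nat \<Rightarrow> 'a) set"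
  where "relations R x c = {z \<in> vectors R c. lin R x c z = \<zero>\<^bsub>R\<^esub>}"

text \<open>The boundaries of degree one, with \<open>K_2\<close> presented by alternating matrices.
  The zero diagonal is a separate condition because \<open>2\<close> may be a zero divisor.\<close>

definition koszul_boundaries :: "('a, 'r) ring_scheme \<Rightarrow> (nat \<Rightarrow> 'a) \<Rightarrow> nat \<Rightarrow> (nat \<Rightarrow> 'a) set"
  where "koszul_boundaries R x c = {z \<in> vectors R c. \<exists>a. (\<forall>l k. a l k \<in> carrier R) \<and>
    (\<forall>l k. a l k = \<ominus>\<^bsub>R\<^esub> a k l) \<and> (\<forall>l. a l l = \<zero>\<^bsub>R\<^esub>) \<and>
    (\<forall>l < c. z l = (\<Oplus>\<^bsub>R\<^esub>k\<in>{..<c}. a l k \<otimes>\<^bsub>R\<^esub> x k))}"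

lemma koszul_boundariesI:
  assumes "z \<in> vectors R c" "\<And>l k. a l k \<in> carrier R" "\<And>l k. a l k = \<ominus>\<^bsub>R\<^esub> a k l" "\<And>l. a l l = \<zero>\<^bsub>R\<^esub>"
    "\<And>l. l < c \<Longrightarrow> z l = (\<Oplus>\<^bsub>R\<^esub>k\<in>{..<c}. a l k \<otimes>\<^bsub>R\<^esub> x k)"
  shows "z \<in> koszul_boundaries R x c"
  unfolding koszul_boundaries_def
  by (intro CollectI conjI exI[of _ a] allI impI) (fact assms)+

context cring
begin

lemma vector_submoduleD:
  assumes "vector_submodule R c Z"
  shows "v \<in> Z \<Longrightarrow> v l \<in> carrier R" "v \<in> Z \<Longrightarrow> c \<le> l \<Longrightarrow> v l = \<zero>" "(\<lambda>_. \<zero>) \<in> Z"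
    "u \<in> Z \<Longrightarrow> v \<in> Z \<Longrightarrow> (\<lambda>l. u l \<oplus> v l) \<in> Z" "r \<in> carrier R \<Longrightarrow> v \<in> Z \<Longrightarrow> (\<lambda>l. r \<otimes> v l) \<in> Z"
    "v \<in> Z \<Longrightarrow> (\<lambda>l. \<ominus> v l) \<in> Z" "u \<in> Z \<Longrightarrow> v \<in> Z \<Longrightarrow> (\<lambda>l. u l \<ominus> v l) \<in> Z"
proof -
  show 1: "v \<in> Z \<Longrightarrow> v l \<in> carrier R" "v \<in> Z \<Longrightarrow> c \<le> l \<Longrightarrow> v l = \<zero>" "(\<lambda>_. \<zero>) \<in> Z"
    "u \<in> Z \<Longrightarrow> v \<in> Z \<Longrightarrow> (\<lambda>l. u l \<oplus> v l) \<in> Z" "r \<in> carrier R \<Longrightarrow> v \<in> Z \<Longrightarrow> (\<lambda>l. r \<otimes> v l) \<in> Z" for v l u r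
    using assms unfolding vector_submodule_def vectors_def by blast+
  show 2: "(\<lambda>l. \<ominus> v l) \<in> Z" if "v \<in> Z" for v
  proof -
    have "(\<lambda>l. \<ominus> \<one> \<otimes> v l) = (\<lambda>l. \<ominus> v l)" using 1(1)[OF that] by (simp add: l_minus)
    then show ?thesis using 1(5)[OF _ that, of "\<ominus> \<one>"] by simp
  qed
  show "u \<in> Z \<Longrightarrow> v \<in> Z \<Longrightarrow> (\<lambda>l. u l \<ominus> v l) \<in> Z"
    using 1(4)[OF _ 2] by (simp add: a_minus_def)
qed

lemma vectors_mono: "c \<le> d \<Longrightarrow> vectors R c \<subseteq> vectors R d"
  by (auto simp: vectors_def)

lemma lin_closed [simp]:
  "z \<in> vectors R c \<Longrightarrow> (\<And>l. l < c \<Longrightarrow> x l \<in> carrier R) \<Longrightarrow> lin R x c z \<in> carrier R"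
  unfolding lin_def vectors_def by (intro finsum_closed) auto

lemma lin_add:
  assumes "\<And>l. l < c \<Longrightarrow> x l \<in> carrier R" "u \<in> vectors R c" "v \<in> vectors R c"
  shows "lin R x c (\<lambda>l. u l \<oplus> v l) = lin R x c u \<oplus> lin R x c v"
proof -
  have "lin R x c (\<lambda>l. u l \<oplus> v l) = (\<Oplus>l\<in>{..<c}. u l \<otimes> x l \<oplus> v l \<otimes> x l)"
    unfolding lin_def using assms by (intro finsum_cong') (auto simp: vectors_def l_distr)
  also have "\<dots> = lin R x c u \<oplus> lin R x c v"
    unfolding lin_def using assms by (intro finsum_addf) (auto simp: vectors_def)
  finally show ?thesis .
qed

lemma lin_smult:
  assumes "\<And>l. l < c \<Longrightarrow> x l \<in> carrier R" "r \<in> carrier R" "v \<in> vectors R c"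
  shows "lin R x c (\<lambda>l. r \<otimes> v l) = r \<otimes> lin R x c v"
proof -
  have "lin R x c (\<lambda>l. r \<otimes> v l) = (\<Oplus>l\<in>{..<c}. r \<otimes> (v l \<otimes> x l))"
    unfolding lin_def using assms by (intro finsum_cong') (auto simp: vectors_def m_assoc)
  also have "\<dots> = r \<otimes> lin R x c v"
    unfolding lin_def using assms by (intro finsum_rdistr[symmetric]) (auto simp: vectors_def)
  finally show ?thesis .
qed

lemma lin_Suc:
  assumes "\<And>l. l < Suc c \<Longrightarrow> x l \<in> carrier R" "z \<in> vectors R d"
  shows "lin R x (Suc c) z = lin R x c z \<oplus> z c \<otimes> x c"
  unfolding lin_def using assms by (intro finsum_lessThan_Suc) (auto simp: vectors_def)

lemma lin_cong:
  assumes "\<And>l. l < c \<Longrightarrow> x l \<in> carrier R" "\<And>l. l < c \<Longrightarrow> v l \<in> carrier R" "\<And>l. l < c \<Longrightarrow> u l = v l"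
  shows "lin R x c u = lin R x c v"
  unfolding lin_def using assms by (intro finsum_cong') auto

lemma span_ideal_eq_lin:
  assumes "\<And>l. l < c \<Longrightarrow> x l \<in> carrier R"
  shows "span_ideal R x c = lin R x c ` vectors R c"
  using assms
proof (induction c)
  case 0
  have "(\<lambda>_. \<zero>) \<in> vectors R 0" by (simp add: vectors_def)
  then show ?case by (auto simp: lin_def)
next
  case (Suc c)
  have IH: "span_ideal R x c = lin R x c ` vectors R c" using Suc by simp
  show ?case
  proof (intro equalityI subsetI)
    fix a assume "a \<in> span_ideal R x (Suc c)"
    then obtain z r where z: "z \<in> vectors R c" and r: "r \<in> carrier R" and a: "a = lin R x c z \<oplus> r \<otimes> x c"
      unfolding span_ideal.simps adjoin_def IH by blast
    have v: "z(c := r) \<in> vectors R (Suc c)" using z r by (auto simp: vectors_def)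
    have "lin R x (Suc c) (z(c := r)) = lin R x c (z(c := r)) \<oplus> r \<otimes> x c"
      using lin_Suc[OF Suc.prems v] by simp
    also have "lin R x c (z(c := r)) = lin R x c z"
      using Suc.prems z by (intro lin_cong) (auto simp: vectors_def)
    finally show "a \<in> lin R x (Suc c) ` vectors R (Suc c)" using v a by (metis imageI)
  next
    fix a assume "a \<in> lin R x (Suc c) ` vectors R (Suc c)"
    then obtain z where z: "z \<in> vectors R (Suc c)" and a: "a = lin R x (Suc c) z" by blast
    have v: "z(c := \<zero>) \<in> vectors R c" using z by (auto simp: vectors_def)
    have "lin R x c z = lin R x c (z(c := \<zero>))"
      using Suc.prems z by (intro lin_cong) (auto simp: vectors_def)
    then have "a = lin R x c (z(c := \<zero>)) \<oplus> z c \<otimes> x c" using lin_Suc[OF Suc.prems z] a by simp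
    moreover have "z c \<in> carrier R" using z by (auto simp: vectors_def)
    ultimately show "a \<in> span_ideal R x (Suc c)"
      unfolding span_ideal.simps adjoin_def IH using v by blast
  qed
qed

section \<open>Koszul cycles and boundaries of degree one\<close>

lemma relations_submodule:
  assumes "\<And>l. l < c \<Longrightarrow> x l \<in> carrier R"
  shows "vector_submodule R c (relations R x c)"
proof -
  have "lin R x c (\<lambda>_. \<zero>) = (\<Oplus>l\<in>{..<c}. \<zero>)"
    unfolding lin_def using assms by (intro finsum_cong') auto
  then have "lin R x c (\<lambda>_. \<zero>) = \<zero>" by simp
  then show ?thesis
    unfolding vector_submodule_def relations_def
    using lin_add[OF assms] lin_smult[OF assms] by (auto simp: vectors_def)
qed

lemma koszul_boundaries_submodule:
  assumes x: "\<And>l. l < c \<Longrightarrow> x l \<in> carrier R"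
  shows "vector_submodule R c (koszul_boundaries R x c)"
  unfolding vector_submodule_def
proof (intro conjI ballI)
  show "koszul_boundaries R x c \<subseteq> vectors R c" by (auto simp: koszul_boundaries_def)
  have "(\<Oplus>k\<in>{..<c}. \<zero> \<otimes> x k) = (\<Oplus>k\<in>{..<c}. \<zero>)" using x by (intro finsum_cong') auto
  then have "(\<Oplus>k\<in>{..<c}. \<zero> \<otimes> x k) = \<zero>" by simp
  then show "(\<lambda>_. \<zero>) \<in> koszul_boundaries R x c"
    unfolding koszul_boundaries_def by (auto simp: vectors_def intro!: exI[of _ "\<lambda>_ _. \<zero>"])
next
  fix u v assume "u \<in> koszul_boundaries R x c" "v \<in> koszul_boundaries R x c"
  then obtain a b where *: "u \<in> vectors R c" "v \<in> vectors R c" and a: "\<And>l k. a l k \<in> carrier R"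
    "\<And>l k. a l k = \<ominus> a k l" "\<And>l. a l l = \<zero>" "\<And>l. l < c \<Longrightarrow> u l = (\<Oplus>k\<in>{..<c}. a l k \<otimes> x k)"
    and b: "\<And>l k. b l k \<in> carrier R"
    "\<And>l k. b l k = \<ominus> b k l" "\<And>l. b l l = \<zero>" "\<And>l. l < c \<Longrightarrow> v l = (\<Oplus>k\<in>{..<c}. b l k \<otimes> x k)"
    unfolding koszul_boundaries_def by blast
  let ?a = "\<lambda>l k. a l k \<oplus> b l k"
  have 1: "?a l k = \<ominus> ?a k l" for l k
  proof -
    have "?a l k = \<ominus> a k l \<oplus> \<ominus> b k l" using a(2)[of l k] b(2)[of l k] by simp
    then show ?thesis using a(1) b(1) by (simp add: minus_add)
  qed
  have 2: "u l \<oplus> v l = (\<Oplus>k\<in>{..<c}. ?a l k \<otimes> x k)" if "l < c" for l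
  proof -
    have "u l \<oplus> v l = (\<Oplus>k\<in>{..<c}. a l k \<otimes> x k \<oplus> b l k \<otimes> x k)"
      unfolding a(4)[OF that] b(4)[OF that] using x a(1) b(1) by (intro finsum_addf[symmetric]) auto
    also have "\<dots> = (\<Oplus>k\<in>{..<c}. ?a l k \<otimes> x k)"
      using x a(1) b(1) by (intro finsum_cong') (auto simp: l_distr)
    finally show ?thesis .
  qed
  have 3: "(\<lambda>l. u l \<oplus> v l) \<in> vectors R c" using * by (auto simp: vectors_def)
  have "?a l k \<in> carrier R" "?a l l = \<zero>" for l k using a(1,3) b(1,3) by auto
  then show "(\<lambda>l. u l \<oplus> v l) \<in> koszul_boundaries R x c"
    by (intro koszul_boundariesI[of _ _ _ ?a] 1 2 3)
next
  fix r v assume r: "r \<in> carrier R" and "v \<in> koszul_boundaries R x c"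
  then obtain b where *: "v \<in> vectors R c" 
    and b: "\<And>l k. b l k \<in> carrier R"
    "\<And>l k. b l k = \<ominus> b k l" "\<And>l. b l l = \<zero>" "\<And>l. l < c \<Longrightarrow> v l = (\<Oplus>k\<in>{..<c}. b l k \<otimes> x k)"
    unfolding koszul_boundaries_def by blast
  let ?a = "\<lambda>l k. r \<otimes> b l k"
  have 1: "?a l k = \<ominus> ?a k l" for l k
  proof -
    have "?a l k = r \<otimes> \<ominus> b k l" using b(2)[of l k] by simp
    then show ?thesis using r b(1) by (simp add: r_minus)
  qed
  have 2: "r \<otimes> v l = (\<Oplus>k\<in>{..<c}. ?a l k \<otimes> x k)" if "l < c" for l
  proof -
    have "r \<otimes> v l = (\<Oplus>k\<in>{..<c}. r \<otimes> (b l k \<otimes> x k))"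
      unfolding b(4)[OF that] using x b(1) r by (intro finsum_rdistr) auto
    also have "\<dots> = (\<Oplus>k\<in>{..<c}. ?a l k \<otimes> x k)"
      using x r b(1) by (intro finsum_cong') (auto simp: m_assoc)
    finally show ?thesis .
  qed
  have 3: "(\<lambda>l. r \<otimes> v l) \<in> vectors R c" using * r by (auto simp: vectors_def)
  have "?a l k \<in> carrier R" "?a l l = \<zero>" for l k using b(1,3) r by auto
  then show "(\<lambda>l. r \<otimes> v l) \<in> koszul_boundaries R x c"
    by (intro koszul_boundariesI[of _ _ _ ?a] 1 2 3)
qed

lemma koszul_boundaries_relations:
  assumes x: "\<And>l. l < c \<Longrightarrow> x l \<in> carrier R"
  shows "koszul_boundaries R x c \<subseteq> relations R x c"
proof
  fix z assume "z \<in> koszul_boundaries R x c"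
  then obtain a where z: "z \<in> vectors R c"
    and a: "\<And>l k. a l k \<in> carrier R"
    "\<And>l k. a l k = \<ominus> a k l" "\<And>l. a l l = \<zero>" "\<And>l. l < c \<Longrightarrow> z l = (\<Oplus>k\<in>{..<c}. a l k \<otimes> x k)"
    unfolding koszul_boundaries_def by blast
  have "lin R x c z = (\<Oplus>l\<in>{..<c}. \<Oplus>k\<in>{..<c}. a l k \<otimes> x k \<otimes> x l)"
    unfolding lin_def using x a(1,4) by (intro finsum_cong') (auto simp: finsum_ldistr)
  also have "\<dots> = (\<Oplus>l\<in>{..<c}. a l l \<otimes> x l \<otimes> x l)"
  proof (rule finsum_alternating)
    fix l k assume lk: "l < c" "k < c"
    have "a l k \<otimes> x k \<otimes> x l = (\<ominus> a k l) \<otimes> x k \<otimes> x l" using a(2)[of l k] by simp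
    also have "\<dots> = \<ominus> (a k l \<otimes> x l \<otimes> x k)" using x lk a(1)[of k l] by algebra
    finally show "a l k \<otimes> x k \<otimes> x l = \<ominus> (a k l \<otimes> x l \<otimes> x k)" .
  qed (use x a(1) in auto)
  also have "\<dots> = (\<Oplus>l\<in>{..<c}. \<zero>)" using x a(3) by (intro finsum_cong') auto
  finally show "z \<in> relations R x c" using z by (simp add: relations_def)
qed

text \<open>Multiplication by \<open>x_k\<close> is homotopic to zero on the Koszul complex, the
  homotopy being the exterior product with \<open>e_k\<close>.\<close>

lemma mult_relation_boundary:
  assumes x: "\<And>l. l < c \<Longrightarrow> x l \<in> carrier R" and k: "k < c" and z: "z \<in> relations R x c"
  shows "(\<lambda>l. x k \<otimes> z l) \<in> koszul_boundaries R x c"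
proof -
  have zc: "z l \<in> carrier R" "l \<ge> c \<Longrightarrow> z l = \<zero>" for l using z by (auto simp: relations_def vectors_def)
  have lin0: "(\<Oplus>l\<in>{..<c}. z l \<otimes> x l) = \<zero>" using z by (simp add: relations_def lin_def)
  \<comment> \<open>Up to sign the exterior product of \<open>e_k\<close> and \<open>z\<close>:
    column \<open>k\<close> holds \<open>z\<close> and row \<open>k\<close> holds \<open>-z\<close>.
    The weighted sum of row \<open>k\<close> comes out as \<open>z_k x_k\<close> because
    \<open>z\<close> is a relation.\<close>
  define a where "a l j = (if l = j then \<zero> else if j = k then z l else if l = k then \<ominus> z j else \<zero>)" for l j
  have ac: "a l j \<in> carrier R" "a l j = \<ominus> a j l" "a l l = \<zero>" for l j
    using zc(1) by (auto simp: a_def)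
  have "x k \<otimes> z l = (\<Oplus>j\<in>{..<c}. a l j \<otimes> x j)" if l: "l < c" for l
  proof (cases "l = k")
    case False
    have "(\<Oplus>j\<in>{..<c}. a l j \<otimes> x j) = a l k \<otimes> x k"
      using k x zc(1) False by (intro finsum_single) (auto simp: a_def)
    then show ?thesis using False zc(1) x[OF k] by (simp add: a_def m_comm)
  next
    case True
    have "(\<Oplus>j\<in>{..<c}. a l j \<otimes> x j) = (\<Oplus>j\<in>{..<c}. (if j = k then z j \<otimes> x j else \<zero>) \<oplus> \<ominus> (z j \<otimes> x j))"
      using k x zc(1) True by (intro finsum_cong') (auto simp: a_def r_neg l_minus)
    also have "\<dots> = (\<Oplus>j\<in>{..<c}. if j = k then z j \<otimes> x j else \<zero>) \<oplus> (\<Oplus>j\<in>{..<c}. \<ominus> (z j \<otimes> x j))"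
      using x zc(1) by (intro finsum_addf) auto
    also have "(\<Oplus>j\<in>{..<c}. if j = k then z j \<otimes> x j else \<zero>) = z k \<otimes> x k"
      using k x zc(1) finsum_single[of "{..<c}" k "\<lambda>j. if j = k then z j \<otimes> x j else \<zero>"] by simp
    also have "(\<Oplus>j\<in>{..<c}. \<ominus> (z j \<otimes> x j)) = \<zero>"
      using finsum_neg[of "\<lambda>j. z j \<otimes> x j" "{..<c}"] x zc(1) lin0 by auto
    finally show ?thesis using True zc(1) x[OF k] by (simp add: m_comm)
  qed
  moreover have "(\<lambda>l. x k \<otimes> z l) \<in> vectors R c" using zc x[OF k] by (auto simp: vectors_def)
  ultimately show ?thesis by (intro koszul_boundariesI[of _ _ _ a] ac)
qed

text \<open>Up to sign the boundary of \<open>r\<close> times a basis element of \<open>K_2\<close>.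
  Modulo boundaries it trades \<open>r x_k\<close> in entry \<open>j\<close> for
  \<open>r x_j\<close> in entry \<open>k\<close>.\<close>

lemma koszul_vector_boundary:
  assumes x: "\<And>l. l < c \<Longrightarrow> x l \<in> carrier R" and jk: "j < c" "k < c" "j \<noteq> k" and r: "r \<in> carrier R"
  shows "(\<lambda>l. if l = j then r \<otimes> x k else if l = k then \<ominus> (r \<otimes> x j) else \<zero>) \<in> koszul_boundaries R x c"
    (is "?v \<in> _")
proof -
  define a where "a l i = (if l = j \<and> i = k then r else if l = k \<and> i = j then \<ominus> r else \<zero>)" for l i
  have ac: "a l i \<in> carrier R" "a l i = \<ominus> a i l" "a l l = \<zero>" for l i
    using r jk by (auto simp: a_def)
  have "?v l = (\<Oplus>i\<in>{..<c}. a l i \<otimes> x i)" if "l < c" for l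
  proof -
    consider "l = j" | "l = k" | "l \<noteq> j" "l \<noteq> k" by blast
    then show ?thesis
    proof cases
      case 1
      have "(\<Oplus>i\<in>{..<c}. a l i \<otimes> x i) = a l k \<otimes> x k"
        using jk x r 1 by (intro finsum_single) (auto simp: a_def)
      then show ?thesis using 1 by (simp add: a_def)
    next
      case 2
      have "(\<Oplus>i\<in>{..<c}. a l i \<otimes> x i) = a l j \<otimes> x j"
        using jk x r 2 by (intro finsum_single) (auto simp: a_def)
      then show ?thesis using 2 jk r x by (simp add: a_def l_minus)
    next
      case 3
      have "(\<Oplus>i\<in>{..<c}. a l i \<otimes> x i) = (\<Oplus>i\<in>{..<c}. \<zero>)"
        using 3 x by (intro finsum_cong') (auto simp: a_def)
      then show ?thesis using 3 by simp
    qed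
  qed
  moreover have "?v \<in> vectors R c" using jk x r by (auto simp: vectors_def)
  ultimately show ?thesis by (intro koszul_boundariesI[of _ _ _ a] ac)
qed

end

text \<open>Induction over the coordinates reduces this to ideals: the scalar version handles the
  last entry, and the vectors whose last entry is zero satisfy the hypothesis again.\<close>

lemma (in local_noetherian_ring) vector_nakayama:
  assumes "vector_submodule R c Z" "vector_submodule R c B" "B \<subseteq> Z" "x \<in> max_ideal R"
    and "\<And>z. z \<in> Z \<Longrightarrow> \<exists>b\<in>B. \<exists>\<zeta>\<in>Z. \<forall>l. z l = b l \<oplus> x \<otimes> \<zeta> l"
  shows "Z \<subseteq> B"
  using assms
proof (induction c arbitrary: Z B)
  case 0
  have "z = (\<lambda>_. \<zero>)" if "z \<in> Z" for z using vector_submoduleD(2)[OF 0(1) that] by auto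
  then show ?case using vector_submoduleD(3)[OF 0(2)] by auto
next
  case (Suc c)
  note Z = vector_submoduleD[OF Suc.prems(1)] and B = vector_submoduleD[OF Suc.prems(2)]
  have xc: "x \<in> carrier R" using Suc.prems(4) by simp
  let ?J = "(\<lambda>z. z c) ` Z" and ?L = "(\<lambda>z. z c) ` B"
  have L: "ideal ?L R"
  proof (rule ideal_by_closure)
    show "?L \<subseteq> carrier R" using B(1) by auto
    show "\<zero> \<in> ?L" using B(3) by (rule rev_image_eqI) simp
    show "a \<oplus> b \<in> ?L" if ab: "a \<in> ?L" "b \<in> ?L" for a b
    proof -
      from ab obtain u v where uv: "u \<in> B" "v \<in> B" "a = u c" "b = v c" by blast
      show ?thesis using B(4)[OF uv(1,2)] by (rule rev_image_eqI) (simp add: uv)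
    qed
    show "r \<otimes> a \<in> ?L" if r: "r \<in> carrier R" and a: "a \<in> ?L" for r a
    proof -
      from a obtain u where u: "u \<in> B" "a = u c" by blast
      show ?thesis using B(5)[OF r u(1)] by (rule rev_image_eqI) (simp add: u)
    qed
  qed
  have JL: "?J \<subseteq> ?L"
  proof (rule local_principal_nakayama[OF Suc.prems(4) L])
    show "?J \<subseteq> carrier R" using Z(1) by auto
    fix a assume "a \<in> ?J"
    then obtain z where z: "z \<in> Z" "a = z c" by blast
    then obtain b \<zeta> where b: "b \<in> B" "\<zeta> \<in> Z" "\<forall>l. z l = b l \<oplus> x \<otimes> \<zeta> l" using Suc.prems(5) by blast
    have "a = b c \<oplus> x \<otimes> \<zeta> c" using z(2) b(3) by simp
    then have "a \<ominus> x \<otimes> \<zeta> c = b c \<oplus> x \<otimes> \<zeta> c \<ominus> x \<otimes> \<zeta> c" by simp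
    also have "\<dots> = b c" using B(1)[OF b(1), of c] Z(1)[OF b(2), of c] xc by algebra
    finally have "a \<ominus> x \<otimes> \<zeta> c = b c" .
    then show "\<exists>a'\<in>?J. a \<ominus> x \<otimes> a' \<in> ?L" using b(1,2) by auto
  qed
  let ?Z = "Z \<inter> vectors R c" and ?B = "B \<inter> vectors R c"
  have sub: "vector_submodule R c (Y \<inter> vectors R c)" if Y: "vector_submodule R (Suc c) Y" for Y
    using vector_submoduleD(3-5)[OF Y] unfolding vector_submodule_def by (auto simp: vectors_def)
  have inter: "v \<in> vectors R c" if "v \<in> Z" "v c = \<zero>" for v
  proof -
    have "v l = \<zero>" if "c \<le> l" for l
      using that Z(2)[OF \<open>v \<in> Z\<close>, of l] \<open>v c = \<zero>\<close> by (cases "l = c") auto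
    then show ?thesis using Z(1)[OF that(1)] by (simp add: vectors_def)
  qed
  have "?Z \<subseteq> ?B"
  proof (rule Suc.IH[OF sub[OF Suc.prems(1)] sub[OF Suc.prems(2)] _ Suc.prems(4)])
    show "?B \<subseteq> ?Z" using Suc.prems(3) by blast
    fix z assume z: "z \<in> ?Z"
    then have zZ: "z \<in> Z" by simp
    then obtain b \<zeta> where b: "b \<in> B" "\<zeta> \<in> Z" "\<forall>l. z l = b l \<oplus> x \<otimes> \<zeta> l" using Suc.prems(5) by blast
    have "\<zeta> c \<in> ?L" using JL b(2) by auto
    then obtain b' where b': "b' \<in> B" "b' c = \<zeta> c" by auto
    have bZ: "b \<in> Z" "b' \<in> Z" using b b' Suc.prems(3) by auto
    \<comment> \<open>The last entry of \<open>\<zeta>\<close> need not vanish although that of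
      \<open>z\<close> does. Subtracting \<open>b'\<close> from \<open>\<zeta>\<close> and adding
      \<open>x b'\<close> to \<open>b\<close> repairs this without leaving \<open>Z\<close> and
      \<open>B\<close>.\<close>
    define \<zeta>0 where "\<zeta>0 = (\<lambda>l. \<zeta> l \<ominus> b' l)"
    define b0 where "b0 = (\<lambda>l. b l \<oplus> x \<otimes> b' l)"
    have e: "z l = b0 l \<oplus> x \<otimes> \<zeta>0 l" for l
    proof -
      have "z l = b l \<oplus> x \<otimes> \<zeta> l" using b(3) by simp
      also have "\<dots> = b0 l \<oplus> x \<otimes> \<zeta>0 l"
        unfolding b0_def \<zeta>0_def using Z(1)[OF b(2), of l] B(1)[OF b(1), of l] B(1)[OF b'(1), of l] xc by algebra
      finally show ?thesis .
    qed
    have \<zeta>0: "\<zeta>0 \<in> Z" unfolding \<zeta>0_def using Z(7)[OF b(2) bZ(2)] .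
    have \<zeta>0c: "\<zeta>0 c = \<zero>" unfolding \<zeta>0_def using b'(2) Z(1)[OF b(2), of c] by (simp add: a_minus_def r_neg)
    have b0: "b0 \<in> B" unfolding b0_def using B(4)[OF b(1) B(5)[OF xc b'(1)]] .
    have "b0 c = \<zero>"
      using e[of c] \<zeta>0c z xc B(1)[OF b0, of c] by (auto simp: vectors_def)
    then have "b0 \<in> ?B" using inter b0 Suc.prems(3) by auto
    moreover have "\<zeta>0 \<in> ?Z" using inter \<zeta>0 \<zeta>0c by auto
    ultimately show "\<exists>b\<in>?B. \<exists>\<zeta>\<in>?Z. \<forall>l. z l = b l \<oplus> x \<otimes> \<zeta> l" using e by blast
  qed
  show ?case
  proof
    fix z assume z: "z \<in> Z"
    then have "z c \<in> ?L" using JL by auto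
    then obtain b where b: "b \<in> B" "b c = z c" by auto
    define y where "y = (\<lambda>l. z l \<ominus> b l)"
    have y: "y \<in> Z" unfolding y_def using Z(7)[OF z] b Suc.prems(3) by auto
    have "y c = \<zero>" unfolding y_def using b(2) Z(1)[OF z, of c] by (simp add: a_minus_def r_neg)
    then have "y \<in> ?B" using \<open>?Z \<subseteq> ?B\<close> inter y by blast
    then have "(\<lambda>l. y l \<oplus> b l) \<in> B" using B(4) b(1) by auto
    moreover have "y l \<oplus> b l = z l" for l
      unfolding y_def using Z(1)[OF z, of l] B(1)[OF b(1), of l] by algebra
    ultimately show "z \<in> B" by simp
  qed
qed

text \<open>As in the long exact sequence of Koszul homology, vanishing of \<open>H_1\<close> for
  the longer sequence makes \<open>H_1\<close> of the shorter one equal to \<open>x_c\<close> times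
  itself, and Nakayama's lemma applies.\<close>

lemma (in local_noetherian_ring) koszul_exact_descend:
  assumes x: "\<And>l. l < Suc c \<Longrightarrow> x l \<in> max_ideal R"
    and exact: "relations R x (Suc c) \<subseteq> koszul_boundaries R x (Suc c)"
  shows "relations R x c \<subseteq> koszul_boundaries R x c"
proof (rule vector_nakayama[OF relations_submodule koszul_boundaries_submodule koszul_boundaries_relations])
  have xc: "x l \<in> carrier R" if "l < Suc c" for l using x[OF that] by simp
  then show "x l \<in> carrier R" if "l < c" for l using that by simp
  show "x c \<in> max_ideal R" using x by simp
  fix z assume z: "z \<in> relations R x c"
  have zv: "z \<in> vectors R c" "z \<in> vectors R (Suc c)" using z vectors_mono[of c "Suc c"] by (auto simp: relations_def)
  have z0: "z c = \<zero>" using zv(1) by (simp add: vectors_def)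
  have "lin R x (Suc c) z = \<zero>"
    using lin_Suc[of c x, OF xc zv(1)] z xc[of c] z0 by (simp add: relations_def)
  then have "z \<in> koszul_boundaries R x (Suc c)" using exact zv by (auto simp: relations_def)
  then obtain a where a: "\<And>l k. a l k \<in> carrier R"
    "\<And>l k. a l k = \<ominus> a k l" "\<And>l. a l l = \<zero>" "\<And>l. l < Suc c \<Longrightarrow> z l = (\<Oplus>k\<in>{..<Suc c}. a l k \<otimes> x k)"
    unfolding koszul_boundaries_def by blast
  have zl: "z l = (\<Oplus>k\<in>{..<c}. a l k \<otimes> x k) \<oplus> a l c \<otimes> x c" if "l < Suc c" for l
    unfolding a(4)[OF that] using xc a(1) by (intro finsum_lessThan_Suc) auto
  have fc: "(\<Oplus>k\<in>{..<c}. a l k \<otimes> x k) \<in> carrier R" for l using a(1) xc by (intro finsum_closed) auto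
  define b where "b = (\<lambda>l. if l < c then (\<Oplus>k\<in>{..<c}. a l k \<otimes> x k) else \<zero>)"
  \<comment> \<open>The last column of the alternating matrix. It is a relation because the last
    row, its negative, has weighted sum \<open>z c = 0\<close>.\<close>
  define \<zeta> where "\<zeta> = (\<lambda>l. if l < c then a l c else \<zero>)"
  have "b \<in> koszul_boundaries R x c"
  proof (rule koszul_boundariesI[of _ _ _ a])
    show "b \<in> vectors R c" using fc by (auto simp: b_def vectors_def)
    show "a l k = \<ominus> a k l" for l k by (rule a(2))
  qed (use a(1,3) in \<open>auto simp: b_def\<close>)
  moreover have "\<zeta> \<in> relations R x c"
  proof -
    have "lin R x c \<zeta> = (\<Oplus>k\<in>{..<c}. \<ominus> (a c k \<otimes> x k))"
      unfolding lin_def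
    proof (intro finsum_cong')
      fix k assume k: "k \<in> {..<c}"
      have "\<zeta> k = \<ominus> a c k" using k a(2)[of k c] by (simp add: \<zeta>_def)
      then show "\<zeta> k \<otimes> x k = \<ominus> (a c k \<otimes> x k)" using a(1) xc k by (simp add: l_minus)
    qed (use a(1) xc in auto)
    also have "\<dots> = \<ominus> (\<Oplus>k\<in>{..<c}. a c k \<otimes> x k)" using a(1) xc by (intro finsum_neg) auto
    also have "(\<Oplus>k\<in>{..<c}. a c k \<otimes> x k) = \<zero>"
      using zl[of c] fc[of c] xc[of c] a(3)[of c] z0 by simp
    finally show ?thesis using a(1) by (auto simp: relations_def \<zeta>_def vectors_def)
  qed
  moreover have "z l = b l \<oplus> x c \<otimes> \<zeta> l" for l
    using zl[of l] zv(1) xc[of c] a(1) by (auto simp: b_def \<zeta>_def vectors_def m_comm)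
  ultimately show "\<exists>b\<in>koszul_boundaries R x c. \<exists>\<zeta>\<in>relations R x c. \<forall>l. z l = b l \<oplus> x c \<otimes> \<zeta> l"
    by blast
qed (use x in auto)

text \<open>An equation \<open>x_c a = \<Sum> z_l x_l\<close> is a relation with last entry
  \<open>-a\<close>. As a boundary it has this entry in the ideal of the first \<open>c\<close>
  elements, because the matrix is zero on the diagonal.\<close>

lemma (in local_noetherian_ring) koszul_exact_last_regular:
  assumes x: "\<And>l. l < Suc c \<Longrightarrow> x l \<in> carrier R"
    and exact: "relations R x (Suc c) \<subseteq> koszul_boundaries R x (Suc c)"
    and a: "a \<in> carrier R" "x c \<otimes> a \<in> span_ideal R x c"
  shows "a \<in> span_ideal R x c"
proof -
  have span: "span_ideal R x c = lin R x c ` vectors R c" using x by (intro span_ideal_eq_lin) auto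
  obtain z where z: "z \<in> vectors R c" and e: "x c \<otimes> a = lin R x c z" using a(2) unfolding span by blast
  have v: "z(c := \<ominus> a) \<in> vectors R (Suc c)" using z a(1) by (auto simp: vectors_def)
  have "lin R x (Suc c) (z(c := \<ominus> a)) = lin R x c (z(c := \<ominus> a)) \<oplus> (\<ominus> a) \<otimes> x c"
    using lin_Suc[of c x, OF x v] by simp
  also have "lin R x c (z(c := \<ominus> a)) = lin R x c z"
    using x z by (intro lin_cong) (auto simp: vectors_def)
  also have "lin R x c z \<oplus> (\<ominus> a) \<otimes> x c = x c \<otimes> a \<oplus> (\<ominus> a) \<otimes> x c" by (simp only: e)
  also have "\<dots> = \<zero>"
  proof -
    have "x c \<in> carrier R" using x by simp
    then show ?thesis using a(1) by algebra
  qed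
  finally have "z(c := \<ominus> a) \<in> relations R x (Suc c)" using v by (simp add: relations_def del: fun_upd_apply)
  then have "z(c := \<ominus> a) \<in> koszul_boundaries R x (Suc c)" by (rule subsetD[OF exact])
  then obtain \<alpha> where \<alpha>: "\<And>l k. \<alpha> l k \<in> carrier R" "\<And>l. \<alpha> l l = \<zero>"
    "\<And>l. l < Suc c \<Longrightarrow> (z(c := \<ominus> a)) l = (\<Oplus>k\<in>{..<Suc c}. \<alpha> l k \<otimes> x k)"
    unfolding koszul_boundaries_def by blast
  define y where "y = (\<lambda>k. if k < c then \<alpha> c k else \<zero>)"
  have yv: "y \<in> vectors R c" using \<alpha>(1) by (auto simp: y_def vectors_def)
  have "\<ominus> a = (\<Oplus>k\<in>{..<c}. \<alpha> c k \<otimes> x k) \<oplus> \<alpha> c c \<otimes> x c"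
    using \<alpha>(3)[of c] finsum_lessThan_Suc[of c "\<lambda>k. \<alpha> c k \<otimes> x k"] \<alpha>(1) x by simp
  also have "(\<Oplus>k\<in>{..<c}. \<alpha> c k \<otimes> x k) = lin R x c y"
    unfolding lin_def using \<alpha>(1) x by (intro finsum_cong') (auto simp: y_def)
  finally have "\<ominus> a = lin R x c y" using \<alpha>(2) x yv by simp
  then have "\<ominus> a \<in> span_ideal R x c" unfolding span using yv by blast
  then have "\<ominus> (\<ominus> a) \<in> span_ideal R x c" using ideal_closed(4)[OF span_ideal_ideal] x by auto
  then show ?thesis using a(1) by simp
qed

text \<open>If \<open>H_1\<close> vanished, it would vanish for all initial segments, and the
  generators would be a regular sequence.\<close>

lemma (in local_noetherian_ring) exists_non_boundary_relation:
  assumes gens: "minimal_generators R x c" and c: "c = embedding_dimension R"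
    and singular: "\<not> regular_local_ring R"
  shows "\<exists>z \<in> relations R x c. z \<notin> koszul_boundaries R x c"
proof (rule ccontr)
  assume "\<not> ?thesis"
  then have exact: "relations R x c \<subseteq> koszul_boundaries R x c" by blast
  have xc: "x l \<in> carrier R" if "l < c" for l using gens that by (auto simp: minimal_generators_def)
  have xm: "x l \<in> max_ideal R" if "l < c" for l
    using span_ideal_mem[of c x l, OF xc that] gens by (simp add: minimal_generators_def)
  have desc: "relations R x i \<subseteq> koszul_boundaries R x i" if "i \<le> c" for i
    using that
  proof (induction rule: inc_induct)
    case (step i)
    show ?case
    proof (rule koszul_exact_descend)
      show "x l \<in> max_ideal R" if "l < Suc i" for l using that step.hyps xm by simp
    qed (rule step.IH)
  qed (rule exact)
  have "regular_local_ring R"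
  proof (rule regular_local_ringI)
    show "minimal_generators R x (embedding_dimension R)" using gens c by simp
    fix l a assume "l < embedding_dimension R" "a \<in> carrier R" "x l \<otimes> a \<in> span_ideal R x l"
    moreover have "relations R x (Suc l) \<subseteq> koszul_boundaries R x (Suc l)"
      using calculation(1) c by (intro desc) simp
    ultimately show "a \<in> span_ideal R x l"
      using xc c by (rule_tac koszul_exact_last_regular) simp_all
  qed
  then show False using singular by contradiction
qed

text \<open>A hyperplane of the \<open>R / \<mm>\<close>-vector space \<open>Z / B\<close>.\<close>

lemma (in local_noetherian_ring) exists_hyperplane:
  assumes Z: "vector_submodule R c Z" and B: "vector_submodule R c B" and BZ: "B \<subseteq> Z"
    and z: "z \<in> Z" "z \<notin> B"
    and mZ: "\<And>a q. a \<in> max_ideal R \<Longrightarrow> q \<in> Z \<Longrightarrow> (\<lambda>l. a \<otimes> q l) \<in> B"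
  obtains T where "vector_submodule R c T" "B \<subseteq> T" "T \<subseteq> Z"
    "\<And>q. q \<in> Z \<Longrightarrow> \<exists>r \<in> carrier R. (\<lambda>l. q l \<ominus> r \<otimes> z l) \<in> T"
    "\<And>a. a \<in> carrier R \<Longrightarrow> (\<lambda>l. a \<otimes> z l) \<in> T \<Longrightarrow> a \<in> max_ideal R"
proof -
  note Zc = vector_submoduleD[OF Z] and Bc = vector_submoduleD[OF B]
  \<comment> \<open>\<open>Z / B\<close> is a vector space over the residue field, and a subspace
    maximal among those that miss \<open>z\<close> is a hyperplane complementary to the line of
    \<open>z\<close>.\<close>
  define F where "F = {T. vector_submodule R c T \<and> B \<subseteq> T \<and> T \<subseteq> Z \<and> z \<notin> T}"
  have "\<exists>T\<in>F. \<forall>T'\<in>F. T \<subseteq> T' \<longrightarrow> T' = T"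
  proof (rule subset_Zorn)
    fix C assume C: "subset.chain F C"
    have CF: "C \<subseteq> F" and lin: "\<And>S T. S \<in> C \<Longrightarrow> T \<in> C \<Longrightarrow> S \<subseteq> T \<or> T \<subseteq> S"
      using C by (auto simp: pred_on.chain_def)
    show "\<exists>U\<in>F. \<forall>S\<in>C. S \<subseteq> U"
    proof (cases "C = {}")
      case True
      then show ?thesis using B BZ z by (auto simp: F_def)
    next
      case False
      have sub: "vector_submodule R c T" if "T \<in> C" for T using CF that by (auto simp: F_def)
      have "vector_submodule R c (\<Union>C)"
        unfolding vector_submodule_def
      proof (intro conjI ballI)
        show "\<Union>C \<subseteq> vectors R c" using sub unfolding vector_submodule_def by blast
        show "(\<lambda>_. \<zero>) \<in> \<Union>C" using vector_submoduleD(3)[OF sub] False by blast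
        show "(\<lambda>l. r \<otimes> v l) \<in> \<Union>C" if "r \<in> carrier R" "v \<in> \<Union>C" for r v
          using vector_submoduleD(5)[OF sub that(1)] that(2) by blast
        fix u v assume "u \<in> \<Union>C" "v \<in> \<Union>C"
        then obtain S T where ST: "S \<in> C" "T \<in> C" "u \<in> S" "v \<in> T" by blast
        then have "u \<in> T \<and> T \<in> C \<or> v \<in> S \<and> S \<in> C" using lin by blast
        then show "(\<lambda>l. u l \<oplus> v l) \<in> \<Union>C"
          using vector_submoduleD(4)[OF sub] ST by blast
      qed
      then have "\<Union>C \<in> F" using CF False unfolding F_def by blast
      then show ?thesis by blast
    qed
  qed
  then obtain T where TF: "T \<in> F" and Tmax: "\<forall>T'\<in>F. T \<subseteq> T' \<longrightarrow> T' = T" by (elim bexE)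
  have T: "vector_submodule R c T" "B \<subseteq> T" "T \<subseteq> Z" "z \<notin> T" using TF by (auto simp: F_def)
  note Tc = vector_submoduleD[OF T(1)]
  show ?thesis
  proof (rule that[OF T(1-3)])
    fix q assume q: "q \<in> Z"
    show "\<exists>r \<in> carrier R. (\<lambda>l. q l \<ominus> r \<otimes> z l) \<in> T"
    proof (cases "q \<in> T")
      case True
      have "(\<lambda>l. q l \<ominus> \<zero> \<otimes> z l) = q" using Zc(1)[OF q] Zc(1)[OF z(1)] by (simp add: a_minus_def)
      then show ?thesis using True by (intro bexI[of _ \<zero>]) auto
    next
      case False
      \<comment> \<open>Enlarging \<open>T\<close> by \<open>q\<close> captures \<open>z\<close>, by
        maximality. The coefficient of \<open>q\<close> in the resulting expression is a unit, since
        \<open>\<mm> q\<close> already lies in \<open>T\<close>, so the expression can be solved for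
        \<open>q\<close>.\<close>
      define T' where "T' = {\<lambda>l. t l \<oplus> r \<otimes> q l | t r. t \<in> T \<and> r \<in> carrier R}"
      have T'I: "(\<lambda>l. t l \<oplus> r \<otimes> q l) \<in> T'" if "t \<in> T" "r \<in> carrier R" for t r
        using that unfolding T'_def by blast
      have qc: "q l \<in> carrier R" for l using Zc(1)[OF q] .
      have "vector_submodule R c T'"
        unfolding vector_submodule_def
      proof (intro conjI ballI)
        show "T' \<subseteq> vectors R c"
        proof
          fix v assume "v \<in> T'"
          then obtain t r where *: "t \<in> T" "r \<in> carrier R" "v = (\<lambda>l. t l \<oplus> r \<otimes> q l)"
            unfolding T'_def by blast
          show "v \<in> vectors R c"
            unfolding *(3) using *(2) Tc(1)[OF *(1)] Tc(2)[OF *(1)] Zc(2)[OF q] qc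
            by (simp add: vectors_def)
        qed
        have "(\<lambda>l. \<zero> \<oplus> \<zero> \<otimes> q l) = (\<lambda>_. \<zero>)" using qc by simp
        then show "(\<lambda>_. \<zero>) \<in> T'" using T'I[OF Tc(3) zero_closed] by simp
      next
        fix u v assume "u \<in> T'" "v \<in> T'"
        then obtain t r s p where *: "t \<in> T" "s \<in> T" "r \<in> carrier R" "p \<in> carrier R"
          "u = (\<lambda>l. t l \<oplus> r \<otimes> q l)" "v = (\<lambda>l. s l \<oplus> p \<otimes> q l)" unfolding T'_def by blast
        have "u l \<oplus> v l = (t l \<oplus> s l) \<oplus> (r \<oplus> p) \<otimes> q l" for l
          unfolding *(5,6) using Tc(1)[OF *(1), of l] Tc(1)[OF *(2), of l] *(3,4) qc[of l] by algebra
        then show "(\<lambda>l. u l \<oplus> v l) \<in> T'" using T'I[OF Tc(4)[OF *(1,2)], of "r \<oplus> p"] *(3,4) by simp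
      next
        fix a v assume a: "a \<in> carrier R" and "v \<in> T'"
        then obtain s p where *: "s \<in> T" "p \<in> carrier R"
          "v = (\<lambda>l. s l \<oplus> p \<otimes> q l)" unfolding T'_def by blast
        have "a \<otimes> v l = (a \<otimes> s l) \<oplus> (a \<otimes> p) \<otimes> q l" for l
          unfolding *(3) using Tc(1)[OF *(1), of l] *(2) a qc[of l] by algebra
        then show "(\<lambda>l. a \<otimes> v l) \<in> T'" using T'I[OF Tc(5)[OF a *(1)], of "a \<otimes> p"] *(2) a by simp
      qed
      moreover have TT': "T \<subseteq> T'"
      proof
        fix t assume t: "t \<in> T"
        have "(\<lambda>l. t l \<oplus> \<zero> \<otimes> q l) = t" using qc Tc(1)[OF t] by simp
        then show "t \<in> T'" using T'I[OF t zero_closed] by simp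
      qed
      moreover have "T' \<subseteq> Z" unfolding T'_def using Zc(4)[OF _ Zc(5)[OF _ q]] T(3) by auto
      moreover have "T' \<noteq> T"
      proof -
        have "(\<lambda>l. \<zero> \<oplus> \<one> \<otimes> q l) = q" using qc by simp
        then have "q \<in> T'" using T'I[OF Tc(3) one_closed] by simp
        then show ?thesis using False by blast
      qed
      ultimately have "z \<in> T'" using Tmax T(2) unfolding F_def by blast
      then obtain t r where t: "t \<in> T" and r: "r \<in> carrier R" and zl: "z = (\<lambda>l. t l \<oplus> r \<otimes> q l)"
        unfolding T'_def by blast
      have "r \<notin> max_ideal R"
      proof
        assume "r \<in> max_ideal R"
        then have "z \<in> T" unfolding zl using Tc(4)[OF t] mZ[OF _ q] T(2) by blast
        then show False using T(4) by simp
      qed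
      then have rU: "r \<in> Units R" using Units_of_not_max_ideal r by blast
      define i where "i = inv r"
      have i: "i \<in> carrier R" "i \<otimes> r = \<one>" using rU by (auto simp: i_def)
      have "q l \<ominus> i \<otimes> z l = \<ominus> (i \<otimes> t l)" for l
      proof -
        have "q l \<ominus> i \<otimes> z l = q l \<ominus> (i \<otimes> t l \<oplus> (i \<otimes> r) \<otimes> q l)"
          unfolding zl using Tc(1)[OF t, of l] qc[of l] r i(1) by algebra
        also have "\<dots> = \<ominus> (i \<otimes> t l)"
          unfolding i(2) using Tc(1)[OF t, of l] qc[of l] i(1) by algebra
        finally show ?thesis .
      qed
      then have "(\<lambda>l. q l \<ominus> i \<otimes> z l) = (\<lambda>l. \<ominus> (i \<otimes> t l))" by (rule ext)
      then have "(\<lambda>l. q l \<ominus> i \<otimes> z l) \<in> T" using Tc(6)[OF Tc(5)[OF i(1) t]] by metis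
      then show ?thesis using i(1) by blast
    qed
  next
    fix a assume a: "a \<in> carrier R" "(\<lambda>l. a \<otimes> z l) \<in> T"
    show "a \<in> max_ideal R"
    proof (rule ccontr)
      assume "a \<notin> max_ideal R"
      then have aU: "a \<in> Units R" using Units_of_not_max_ideal a by blast
      have "(\<lambda>l. inv a \<otimes> (a \<otimes> z l)) \<in> T" using Tc(5)[OF _ a(2)] aU by simp
      moreover have "inv a \<otimes> (a \<otimes> z l) = z l" for l
        using aU a(1) Zc(1)[OF z(1), of l] by (simp flip: m_assoc)
      ultimately show False using T(4) by simp
    qed
  qed
qed

lemma (in local_noetherian_ring) mult_max_ideal_boundary:
  assumes x: "\<And>l. l < c \<Longrightarrow> x l \<in> carrier R" "span_ideal R x c = max_ideal R"
    and a: "a \<in> max_ideal R" and q: "q \<in> relations R x c"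
  shows "(\<lambda>l. a \<otimes> q l) \<in> koszul_boundaries R x c"
proof -
  note B = vector_submoduleD[OF koszul_boundaries_submodule[of c x, OF x(1)]]
  have qc: "q l \<in> carrier R" for l using q by (auto simp: relations_def vectors_def)
  let ?K = "{a \<in> carrier R. (\<lambda>l. a \<otimes> q l) \<in> koszul_boundaries R x c}"
  have "ideal ?K R"
  proof (rule ideal_by_closure)
    show "\<zero> \<in> ?K" using qc B(3) by simp
    show "a \<oplus> b \<in> ?K" if "a \<in> ?K" "b \<in> ?K" for a b using that B(4) qc by (simp add: l_distr)
    show "r \<otimes> a \<in> ?K" if "r \<in> carrier R" "a \<in> ?K" for r a using that B(5) qc by (simp add: m_assoc)
  qed auto
  moreover have "x k \<in> ?K" if "k < c" for k
    using mult_relation_boundary[of c x, OF x(1) that q] x(1) that by auto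
  ultimately have "max_ideal R \<subseteq> ?K" unfolding x(2)[symmetric] by (intro span_ideal_least)
  then show ?thesis using a by auto
qed

section \<open>Powers of the maximal ideal and lengths\<close>

lemma (in ring) max_ideal_power_0: "max_ideal_power R 0 = carrier R"
  by (simp add: max_ideal_power_def nat_pow_def ideals_set_def)

lemma (in ring) max_ideal_power_Suc:
  "max_ideal_power R (Suc n) = max_ideal_power R n \<cdot> max_ideal R"
  by (simp add: max_ideal_power_def nat_pow_def ideals_set_def)

lemma (in local_noetherian_ring) max_ideal_power_ideal: "ideal (max_ideal_power R n) R"
  by (induction n)
    (simp_all add: max_ideal_power_0 max_ideal_power_Suc oneideal ideal_prod_is_ideal ideal_max_ideal)

lemma (in local_noetherian_ring) max_ideal_power_mult:
  "a \<in> max_ideal_power R n \<Longrightarrow> p \<in> max_ideal R \<Longrightarrow> a \<otimes> p \<in> max_ideal_power R (Suc n)"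
  unfolding max_ideal_power_Suc by (rule ideal_prod.prod)

section \<open>Ideals generated by monomials\<close>

definition combinations :: "('a, 'r) ring_scheme \<Rightarrow> ('i \<Rightarrow> 'a) \<Rightarrow> 'i set \<Rightarrow> 'a set"
  where "combinations R f S = {(\<Oplus>\<^bsub>R\<^esub>e\<in>S. r e \<otimes>\<^bsub>R\<^esub> f e) | r. r \<in> S \<rightarrow> carrier R}"

lemma (in cring) combinations_ideal:
  assumes "finite S" and f: "\<And>e. e \<in> S \<Longrightarrow> f e \<in> carrier R"
  shows "ideal (combinations R f S) R" "e \<in> S \<Longrightarrow> f e \<in> combinations R f S"
proof -
  have I: "(\<Oplus>e\<in>S. r e \<otimes> f e) \<in> combinations R f S" if "r \<in> S \<rightarrow> carrier R" for r
    using that unfolding combinations_def by blast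
  show "ideal (combinations R f S) R"
  proof (rule ideal_by_closure)
    show "combinations R f S \<subseteq> carrier R"
      unfolding combinations_def using f by (auto intro!: finsum_closed)
    have "(\<Oplus>e\<in>S. \<zero> \<otimes> f e) = (\<Oplus>e\<in>S. \<zero>)" using f by (intro finsum_cong') auto
    then show "\<zero> \<in> combinations R f S" using I[of "\<lambda>_. \<zero>"] by simp
  next
    fix a b assume "a \<in> combinations R f S" "b \<in> combinations R f S"
    then obtain r s where *: "r \<in> S \<rightarrow> carrier R" "s \<in> S \<rightarrow> carrier R"
      "a = (\<Oplus>e\<in>S. r e \<otimes> f e)" "b = (\<Oplus>e\<in>S. s e \<otimes> f e)" unfolding combinations_def by blast
    have "a \<oplus> b = (\<Oplus>e\<in>S. r e \<otimes> f e \<oplus> s e \<otimes> f e)"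
      unfolding *(3,4) using *(1,2) f by (intro finsum_addf[symmetric]) auto
    also have "\<dots> = (\<Oplus>e\<in>S. (r e \<oplus> s e) \<otimes> f e)"
      using *(1,2) f by (intro finsum_cong') (auto simp: l_distr Pi_iff)
    finally show "a \<oplus> b \<in> combinations R f S" using I[of "\<lambda>e. r e \<oplus> s e"] *(1,2) by (auto simp: Pi_iff)
  next
    fix t a assume t: "t \<in> carrier R" and "a \<in> combinations R f S"
    then obtain r where *: "r \<in> S \<rightarrow> carrier R"
      "a = (\<Oplus>e\<in>S. r e \<otimes> f e)" unfolding combinations_def by blast
    have "t \<otimes> a = (\<Oplus>e\<in>S. t \<otimes> (r e \<otimes> f e))"
      unfolding *(2) using * f t assms(1) by (intro finsum_rdistr) auto
    also have "\<dots> = (\<Oplus>e\<in>S. (t \<otimes> r e) \<otimes> f e)"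
      using *(1) f t by (intro finsum_cong') (auto simp: m_assoc Pi_iff)
    finally show "t \<otimes> a \<in> combinations R f S" using I[of "\<lambda>e. t \<otimes> r e"] *(1) t by (auto simp: Pi_iff)
  qed
  assume e: "e \<in> S"
  define r where "r e' = (if e' = e then \<one> else \<zero>)" for e'
  have "(\<Oplus>e'\<in>S. r e' \<otimes> f e') = r e \<otimes> f e"
    using e f assms(1) by (intro finsum_single) (auto simp: r_def)
  moreover have "r \<in> S \<rightarrow> carrier R" by (auto simp: r_def)
  ultimately show "f e \<in> combinations R f S" using I[of r] e f by (simp add: r_def)
qed

lemma (in cring) ideal_finsum_closed:
  assumes "ideal K R" "finite S" "\<And>e. e \<in> S \<Longrightarrow> f e \<in> K"
  shows "(\<Oplus>e\<in>S. f e) \<in> K"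
  using assms(2,3)
proof (induction S rule: finite_induct)
  case empty
  then show ?case using ideal_closed(2)[OF assms(1)] by simp
next
  case (insert e S)
  have "(\<Oplus>e\<in>insert e S. f e) = f e \<oplus> (\<Oplus>e\<in>S. f e)"
    using insert ideal_closed(1)[OF assms(1)] by (intro finsum_insert) auto
  then show ?case using insert ideal_closed(3)[OF assms(1)] by auto
qed

lemma (in cring) combinations_least:
  assumes "finite S" "ideal K R" "\<And>e. e \<in> S \<Longrightarrow> f e \<in> K"
  shows "combinations R f S \<subseteq> K"
proof
  fix a assume "a \<in> combinations R f S"
  then obtain r where r: "r \<in> S \<rightarrow> carrier R" "a = (\<Oplus>e\<in>S. r e \<otimes> f e)"
    unfolding combinations_def by blast
  show "a \<in> K"
    unfolding r(2) using r(1) ideal_closed(6)[OF assms(2)] assms(3)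
    by (intro ideal_finsum_closed[OF assms(2,1)]) (auto simp: Pi_iff)
qed

definition exponents :: "nat \<Rightarrow> nat \<Rightarrow> (nat \<Rightarrow> nat) set"
  where "exponents c a = {\<alpha>. (\<forall>l\<ge>c. \<alpha> l = 0) \<and> (\<Sum>l<c. \<alpha> l) = a}"

lemma exponents_0: "exponents c 0 = {\<lambda>_. 0}"
  by (auto simp: exponents_def fun_eq_iff not_less[symmetric])

lemma exponents_incr:
  assumes "\<alpha> \<in> exponents c a" "l < c"
  shows "\<alpha>(l := Suc (\<alpha> l)) \<in> exponents c (Suc a)"
proof -
  have "(\<Sum>k<c. (\<alpha>(l := Suc (\<alpha> l))) k) = (\<Sum>k<c. \<alpha> k + (if k = l then 1 else 0))"
    by (intro sum.cong) auto
  also have "\<dots> = Suc (\<Sum>k<c. \<alpha> k)" using assms(2) by (simp add: sum.distrib)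
  finally show ?thesis using assms by (auto simp: exponents_def)
qed

lemma exponents_decr:
  assumes "\<alpha> \<in> exponents c (Suc a)" "\<alpha> l > 0"
  shows "l < c" "\<alpha>(l := \<alpha> l - 1) \<in> exponents c a" "(\<alpha>(l := \<alpha> l - 1))(l := Suc ((\<alpha>(l := \<alpha> l - 1)) l)) = \<alpha>"
proof -
  show l: "l < c" using assms by (auto simp: exponents_def not_less[symmetric])
  have "Suc (\<Sum>k<c. (\<alpha>(l := \<alpha> l - 1)) k) = (\<Sum>k<c. (\<alpha>(l := \<alpha> l - 1)) k + (if k = l then 1 else 0))"
    using l by (simp add: sum.distrib)
  also have "\<dots> = (\<Sum>k<c. \<alpha> k)" using assms(2) by (intro sum.cong) auto
  finally show "\<alpha>(l := \<alpha> l - 1) \<in> exponents c a" using assms by (auto simp: exponents_def)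
  show "(\<alpha>(l := \<alpha> l - 1))(l := Suc ((\<alpha>(l := \<alpha> l - 1)) l)) = \<alpha>" using assms(2) by (simp add: fun_eq_iff)
qed

lemma exponents_Suc_pos:
  assumes "\<alpha> \<in> exponents c (Suc a)"
  shows "\<exists>l. \<alpha> l > 0"
proof (rule ccontr)
  assume "\<not> ?thesis"
  then have "(\<Sum>l<c. \<alpha> l) = 0" by simp
  then show False using assms by (simp add: exponents_def)
qed

lemma card_exponents: "finite (exponents c a)" "card (exponents c a) = (a + c - 1) choose a"
proof -
  have bij: "bij_betw (\<lambda>\<alpha>. map \<alpha> [0..<c]) (exponents c a) {l. length l = c \<and> sum_list l = a}"
  proof (rule bij_betw_byWitness[where f' = "\<lambda>l i. if i < c then l ! i else 0"])
    show "\<forall>\<alpha>\<in>exponents c a. (\<lambda>i. if i < c then map \<alpha> [0..<c] ! i else 0) = \<alpha>"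
      by (auto simp: exponents_def fun_eq_iff)
    show "\<forall>l\<in>{l. length l = c \<and> sum_list l = a}. map (\<lambda>i. if i < c then l ! i else 0) [0..<c] = l"
      by (auto intro!: nth_equalityI)
    show "(\<lambda>\<alpha>. map \<alpha> [0..<c]) ` exponents c a \<subseteq> {l. length l = c \<and> sum_list l = a}"
      by (auto simp: exponents_def interv_sum_list_conv_sum_set_nat atLeast0LessThan)
    show "(\<lambda>l i. if i < c then l ! i else 0) ` {l. length l = c \<and> sum_list l = a} \<subseteq> exponents c a"
      by (auto simp: exponents_def sum_list_sum_nth atLeast0LessThan)
  qed
  have "{l. length l = c \<and> sum_list l = a} \<subseteq> {l. set l \<subseteq> {..a} \<and> length l = c}"
    using member_le_sum_list by fastforce
  then have "finite {l :: nat list. length l = c \<and> sum_list l = a}"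
    using finite_lists_length_eq[of "{..a}" c] finite_subset by blast
  then show "finite (exponents c a)" using bij bij_betw_finite by blast
  show "card (exponents c a) = (a + c - 1) choose a"
    using bij_betw_same_card[OF bij] card_length_sum_list[of c a] by simp
qed

text \<open>Homogenisation: a further variable fills up the degree to \<open>n\<close>. The result
  is the binomial coefficient in the definition of the order.\<close>

lemma sum_card_exponents: "(\<Sum>b\<le>n. card (exponents c b)) = (n + c) choose n"
proof -
  have "(\<Sum>b\<le>n. card (exponents c b)) = card (\<Union>b\<le>n. exponents c b)"
    by (rule card_UN_disjoint[symmetric]) (auto simp: card_exponents, auto simp: exponents_def)
  also have "\<dots> = card (exponents (Suc c) n)"
  proof (rule bij_betw_same_card, rule bij_betw_byWitness[where f' = "\<lambda>\<beta>. \<beta>(c := 0)"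
        and f = "\<lambda>\<alpha>. \<alpha>(c := n - (\<Sum>l<c. \<alpha> l))"])
    show "\<forall>\<alpha>\<in>\<Union>b\<le>n. exponents c b. (\<alpha>(c := n - (\<Sum>l<c. \<alpha> l)))(c := 0) = \<alpha>"
      by (auto simp: exponents_def fun_eq_iff)
    show "\<forall>\<beta>\<in>exponents (Suc c) n. (\<beta>(c := 0))(c := n - (\<Sum>l<c. (\<beta>(c := 0)) l)) = \<beta>"
      by (auto simp: exponents_def fun_eq_iff)
    show "(\<lambda>\<alpha>. \<alpha>(c := n - (\<Sum>l<c. \<alpha> l))) ` (\<Union>b\<le>n. exponents c b) \<subseteq> exponents (Suc c) n"
      by (auto simp: exponents_def)
    show "(\<lambda>\<beta>. \<beta>(c := 0)) ` exponents (Suc c) n \<subseteq> (\<Union>b\<le>n. exponents c b)"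
    proof (intro image_subsetI)
      fix \<beta> assume \<beta>: "\<beta> \<in> exponents (Suc c) n"
      have "(\<beta>(c := 0)) l = 0" if "c \<le> l" for l
        using \<beta> that by (cases "l = c") (auto simp: exponents_def)
      moreover have "(\<Sum>l<c. (\<beta>(c := 0)) l) \<le> n" using \<beta> by (auto simp: exponents_def)
      ultimately show "\<beta>(c := 0) \<in> (\<Union>b\<le>n. exponents c b)" by (auto simp: exponents_def)
    qed
  qed
  also have "\<dots> = (n + c) choose n" by (simp add: card_exponents)
  finally show ?thesis .
qed

definition monomial :: "('a, 'r) ring_scheme \<Rightarrow> (nat \<Rightarrow> 'a) \<Rightarrow> nat \<Rightarrow> (nat \<Rightarrow> nat) \<Rightarrow> 'a"
  where "monomial R x c \<alpha> = (\<Otimes>\<^bsub>R\<^esub>l\<in>{..<c}. x l [^]\<^bsub>R\<^esub> \<alpha> l)"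

context cring
begin

lemma monomial_closed [simp]:
  "(\<And>l. l < c \<Longrightarrow> x l \<in> carrier R) \<Longrightarrow> monomial R x c \<alpha> \<in> carrier R"
  unfolding monomial_def by (intro finprod_closed) auto

lemma monomial_incr:
  assumes x: "\<And>l. l < c \<Longrightarrow> x l \<in> carrier R" and l: "l < c"
  shows "monomial R x c (\<alpha>(l := Suc (\<alpha> l))) = monomial R x c \<alpha> \<otimes> x l"
proof -
  have e: "{..<c} = insert l ({..<c} - {l})" using l by auto
  have split: "monomial R x c \<beta> = x l [^] \<beta> l \<otimes> (\<Otimes>k\<in>{..<c} - {l}. x k [^] \<beta> k)" for \<beta>
    unfolding monomial_def by (subst e, subst finprod_insert) (use x l in auto)
  have "(\<Otimes>k\<in>{..<c} - {l}. x k [^] (\<alpha>(l := Suc (\<alpha> l))) k) = (\<Otimes>k\<in>{..<c} - {l}. x k [^] \<alpha> k)"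
    using x by (intro finprod_cong') auto
  moreover have "(\<Otimes>k\<in>{..<c} - {l}. x k [^] \<alpha> k) \<in> carrier R" using x by (intro finprod_closed) auto
  moreover have "x l \<in> carrier R" "x l [^] \<alpha> l \<in> carrier R" using x l by auto
  moreover have "(p \<otimes> q) \<otimes> r = (p \<otimes> r) \<otimes> q" if "p \<in> carrier R" "q \<in> carrier R" "r \<in> carrier R" for p q r
    using that by (simp add: m_ac)
  ultimately show ?thesis by (simp add: split)
qed

end

lemma (in local_noetherian_ring) max_ideal_power_eq_combinations:
  assumes x: "\<And>l. l < c \<Longrightarrow> x l \<in> carrier R" and span: "span_ideal R x c = max_ideal R"
  shows "max_ideal_power R a = combinations R (monomial R x c) (exponents c a)"
proof (induction a)
  case 0
  let ?K = "combinations R (monomial R x c) (exponents c 0)"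
  have K: "ideal ?K R" "\<And>\<alpha>. \<alpha> \<in> exponents c 0 \<Longrightarrow> monomial R x c \<alpha> \<in> ?K"
    using combinations_ideal[OF card_exponents(1), of c 0 "monomial R x c"] x by auto
  have "monomial R x c (\<lambda>_. 0) = (\<Otimes>l\<in>{..<c}. \<one>)"
    unfolding monomial_def using x by (intro finprod_cong') auto
  then have "monomial R x c (\<lambda>_. 0) = \<one>" by simp
  then have "\<one> \<in> ?K" using K(2)[of "\<lambda>_. 0"] by (simp add: exponents_0)
  then show ?case using ideal.one_imp_carrier[OF K(1)] max_ideal_power_0 by simp
next
  case (Suc a)
  let ?K = "combinations R (monomial R x c) (exponents c (Suc a))"
  have K: "ideal ?K R" "\<And>\<alpha>. \<alpha> \<in> exponents c (Suc a) \<Longrightarrow> monomial R x c \<alpha> \<in> ?K"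
    using combinations_ideal[OF card_exponents(1), of c "Suc a" "monomial R x c"] x by auto
  have xm: "x l \<in> max_ideal R" if "l < c" for l using span_ideal_mem[of c x l, OF x that] span by simp
  have gen: "monomial R x c \<alpha> \<otimes> j \<in> ?K" if \<alpha>: "\<alpha> \<in> exponents c a" and j: "j \<in> max_ideal R" for \<alpha> j
  proof -
    have "max_ideal R \<subseteq> {i \<in> carrier R. i \<otimes> monomial R x c \<alpha> \<in> ?K}"
      unfolding span[symmetric]
    proof (rule span_ideal_least)
      show "ideal {i \<in> carrier R. i \<otimes> monomial R x c \<alpha> \<in> ?K} R" using K(1) x by (intro colon_ideal) auto
      fix l assume l: "l < c"
      have "x l \<otimes> monomial R x c \<alpha> = monomial R x c (\<alpha>(l := Suc (\<alpha> l)))"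
        using monomial_incr[of c x l, OF x l] x l by (simp add: m_comm)
      then show "x l \<in> {i \<in> carrier R. i \<otimes> monomial R x c \<alpha> \<in> ?K}"
        using K(2)[OF exponents_incr[OF \<alpha> l]] x l by simp
    qed
    then have "j \<otimes> monomial R x c \<alpha> \<in> ?K" using j by blast
    then show ?thesis using m_comm j x by simp
  qed
  have prod: "i \<otimes> j \<in> ?K" if i: "i \<in> max_ideal_power R a" and j: "j \<in> max_ideal R" for i j
  proof -
    have "combinations R (monomial R x c) (exponents c a) \<subseteq> {i \<in> carrier R. i \<otimes> j \<in> ?K}"
    proof (rule combinations_least[OF card_exponents(1)])
      show "ideal {i \<in> carrier R. i \<otimes> j \<in> ?K} R" using K(1) j by (intro colon_ideal) auto
    qed (use gen j x in auto)
    then show ?thesis using i Suc by auto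
  qed
  show ?case
  proof
    show "max_ideal_power R (Suc a) \<subseteq> ?K"
    proof
      fix s assume "s \<in> max_ideal_power R (Suc a)"
      then show "s \<in> ?K"
        unfolding max_ideal_power_Suc
        by (induction rule: ideal_prod.induct) (auto intro: prod ideal_closed(3)[OF K(1)])
    qed
    show "?K \<subseteq> max_ideal_power R (Suc a)"
    proof (rule combinations_least[OF card_exponents(1) max_ideal_power_ideal])
      fix \<beta> assume \<beta>: "\<beta> \<in> exponents c (Suc a)"
      then obtain l where "\<beta> l > 0" using exponents_Suc_pos by blast
      note d = exponents_decr[OF \<beta> this]
      have "monomial R x c (\<beta>(l := \<beta> l - 1)) \<in> max_ideal_power R a"
        unfolding Suc by (rule combinations_ideal(2)[OF card_exponents(1) _ d(2)]) (use x in simp)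
      then have "monomial R x c (\<beta>(l := \<beta> l - 1)) \<otimes> x l \<in> max_ideal_power R (Suc a)"
        using max_ideal_power_mult xm d(1) by blast
      then show "monomial R x c \<beta> \<in> max_ideal_power R (Suc a)"
        using monomial_incr[of c x l "\<beta>(l := \<beta> l - 1)", OF x d(1)] d(3) by simp
    qed
  qed
qed

text \<open>An upper bound \<open>r\<close> for the length of \<open>L / N\<close>, witnessed by a rank function.\<close>

definition length_at_most :: "('a, 'r) ring_scheme \<Rightarrow> 'a set \<Rightarrow> 'a set \<Rightarrow> nat \<Rightarrow> bool"
  where "length_at_most R N L r \<longleftrightarrow> (\<exists>\<mu> :: 'a set \<Rightarrow> nat.
    (\<forall>C. ideal C R \<longrightarrow> N \<subseteq> C \<longrightarrow> C \<subseteq> L \<longrightarrow> \<mu> C \<le> r) \<and>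
    (\<forall>C C'. ideal C R \<longrightarrow> ideal C' R \<longrightarrow> N \<subseteq> C \<longrightarrow> C \<subset> C' \<longrightarrow> C' \<subseteq> L \<longrightarrow> \<mu> C < \<mu> C'))"

lemma length_at_most_refl: "length_at_most R N N 0"
  unfolding length_at_most_def by (intro exI[of _ "\<lambda>_. 0"]) auto

text \<open>Since \<open>\<mm> g \<subseteq> L\<close>, adjoining \<open>g\<close> adds at most one
  composition factor.\<close>

lemma (in local_noetherian_ring) length_at_most_adjoin:
  assumes L: "ideal L R" "N \<subseteq> L" and g: "g \<in> carrier R" "\<And>p. p \<in> max_ideal R \<Longrightarrow> p \<otimes> g \<in> L"
    and len: "length_at_most R N L r"
  shows "length_at_most R N (adjoin R L g) (Suc r)"
proof -
  obtain \<mu> where \<mu>: "\<And>C. ideal C R \<Longrightarrow> N \<subseteq> C \<Longrightarrow> C \<subseteq> L \<Longrightarrow> \<mu> C \<le> r"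
    "\<And>C C'. ideal C R \<Longrightarrow> ideal C' R \<Longrightarrow> N \<subseteq> C \<Longrightarrow> C \<subset> C' \<Longrightarrow> C' \<subseteq> L \<Longrightarrow> \<mu> C < \<mu> C'"
    using len unfolding length_at_most_def by blast
  note Lc = ideal_closed[OF L(1)]
  have mono: "\<mu> C \<le> \<mu> C'" if "ideal C R" "ideal C' R" "N \<subseteq> C" "C \<subseteq> C'" "C' \<subseteq> L" for C C'
    using \<mu>(2)[of C C', OF that(1-3) _ that(5)] that(4) by (cases "C = C'") (simp_all add: psubset_eq)
  \<comment> \<open>Intersect with \<open>L\<close>, and count one more for ideals reaching outside
    \<open>L\<close>; this mirrors additivity of length along
    \<open>L \<subseteq> L + R g\<close>.\<close>
  define \<nu> where "\<nu> C = \<mu> (C \<inter> L) + (if C \<subseteq> L then 0 else 1)" for C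
  have int: "ideal (C \<inter> L) R" if "ideal C R" for C using i_intersect[OF that L(1)] .
  have "\<nu> C \<le> Suc r" if "ideal C R" "N \<subseteq> C" for C
    using \<mu>(1)[OF int[OF that(1)]] that L(2) by (auto simp: \<nu>_def)
  moreover have "\<nu> C < \<nu> C'"
    if C: "ideal C R" "ideal C' R" "N \<subseteq> C" "C \<subset> C'" "C' \<subseteq> adjoin R L g" for C C'
  proof (cases "C \<subseteq> L")
    case True
    show ?thesis
    proof (cases "C' \<subseteq> L")
      case True
      then have "\<mu> C < \<mu> C'" using \<mu>(2) C by blast
      moreover have "C \<inter> L = C" "C' \<inter> L = C'" using True C(4) by auto
      ultimately show ?thesis using True C(4) by (auto simp: \<nu>_def)
    next
      case False
      have "\<mu> (C \<inter> L) \<le> \<mu> (C' \<inter> L)" using int C L(2) by (intro mono) auto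
      then show ?thesis using True False by (auto simp: \<nu>_def)
    qed
  next
    case False
    then obtain c0 where c0: "c0 \<in> C" "c0 \<notin> L" by blast
    have "c0 \<in> adjoin R L g" using c0 C by blast
    then obtain l0 r0 where r0: "l0 \<in> L" "r0 \<in> carrier R" "c0 = l0 \<oplus> r0 \<otimes> g"
      unfolding adjoin_def by blast
    have "r0 \<notin> max_ideal R" using c0(2) r0 g(2) Lc(3) by auto
    then have U: "r0 \<in> Units R" using Units_of_not_max_ideal r0(2) by blast
    define i where "i = inv r0"
    have i: "i \<in> carrier R" "i \<otimes> r0 = \<one>" using U by (auto simp: i_def)
    \<comment> \<open>\<open>C\<close> contains \<open>l0 + r0 g\<close> with \<open>r0\<close> a
      unit, so every element of \<open>C'\<close> can be moved into \<open>L\<close> by a multiple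
      of it. Equal intersections with \<open>L\<close> would force \<open>C = C'\<close>.\<close>
    have "\<not> C' \<inter> L \<subseteq> C \<inter> L"
    proof
      assume sub: "C' \<inter> L \<subseteq> C \<inter> L"
      obtain c' where c': "c' \<in> C'" "c' \<notin> C" using C(4) by blast
      have "c' \<in> adjoin R L g" using c' C by blast
      then obtain l r' where r': "l \<in> L" "r' \<in> carrier R" "c' = l \<oplus> r' \<otimes> g"
        unfolding adjoin_def by blast
      have lc: "l \<in> carrier R" "l0 \<in> carrier R" using r' r0 Lc(1) by auto
      have "c' \<ominus> (r' \<otimes> i) \<otimes> c0 = l \<oplus> r' \<otimes> g \<ominus> (r' \<otimes> i \<otimes> l0 \<oplus> r' \<otimes> (i \<otimes> r0) \<otimes> g)"
        unfolding r'(3) r0(3) using lc r'(2) r0(2) i(1) g(1) by algebra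
      also have "\<dots> = l \<ominus> (r' \<otimes> i) \<otimes> l0"
        unfolding i(2) using lc r'(2) r0(2) i(1) g(1) by algebra
      finally have e: "c' \<ominus> (r' \<otimes> i) \<otimes> c0 = l \<ominus> (r' \<otimes> i) \<otimes> l0" .
      have ri: "r' \<otimes> i \<in> carrier R" using r'(2) i(1) by simp
      have "c' \<ominus> (r' \<otimes> i) \<otimes> c0 \<in> L"
        unfolding e using Lc(5)[OF r'(1) Lc(6)[OF ri r0(1)]] .
      moreover have "c' \<ominus> (r' \<otimes> i) \<otimes> c0 \<in> C'"
        using ideal_closed(5,6)[OF C(2)] c'(1) ri c0(1) C(4) by blast
      ultimately have d: "c' \<ominus> (r' \<otimes> i) \<otimes> c0 \<in> C" using sub by blast
      have cc: "c' \<in> carrier R" "c0 \<in> carrier R"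
        using ideal_closed(1)[OF C(2)] ideal_closed(1)[OF C(1)] c' c0 by auto
      have "c' = (c' \<ominus> (r' \<otimes> i) \<otimes> c0) \<oplus> (r' \<otimes> i) \<otimes> c0" using cc ri by algebra
      moreover have "\<dots> \<in> C" using ideal_closed(3)[OF C(1) d ideal_closed(6)[OF C(1) ri c0(1)]] .
      ultimately show False using c'(2) by simp
    qed
    then have "C \<inter> L \<subset> C' \<inter> L" using C(4) by blast
    then have "\<mu> (C \<inter> L) < \<mu> (C' \<inter> L)" using \<mu>(2) int C L(2) by blast
    moreover have "\<not> C' \<subseteq> L" using c0 C(4) by blast
    ultimately show ?thesis using False by (simp add: \<nu>_def)
  qed
  ultimately show ?thesis unfolding length_at_most_def by blast
qed

lemma (in local_noetherian_ring) length_at_most_add_finite: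
  assumes "finite G" "ideal L R" "N \<subseteq> L" "length_at_most R N L r"
    and "\<And>g. g \<in> G \<Longrightarrow> g \<in> carrier R" "\<And>g p. g \<in> G \<Longrightarrow> p \<in> max_ideal R \<Longrightarrow> p \<otimes> g \<in> L"
  shows "\<exists>L'. ideal L' R \<and> L \<subseteq> L' \<and> G \<subseteq> L' \<and> length_at_most R N L' (r + card G)"
  using assms(1,5,6)
proof (induction G rule: finite_induct)
  case empty
  then show ?case using assms(2,4) by auto
next
  case (insert g G)
  then obtain L' where L': "ideal L' R" "L \<subseteq> L'" "G \<subseteq> L'" "length_at_most R N L' (r + card G)"
    by auto
  have gc: "g \<in> carrier R" using insert.prems by simp
  note adj = adjoin_ideal[OF L'(1) gc]
  have "length_at_most R N (adjoin R L' g) (Suc (r + card G))"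
    using L' assms(3) insert.prems by (intro length_at_most_adjoin) auto
  then show ?case using adj L' insert.hyps by (intro exI[of _ "adjoin R L' g"]) auto
qed

text \<open>The correspondence between submodules of \<open>R / I\<close> and ideals containing
  \<open>I\<close>. The last two facts recover \<open>H\<close> from its union, so that strict
  chains stay strict.\<close>

lemma (in cring) Union_submodule_quotient:
  assumes I: "ideal I R" and H: "submodule H R (quotient_module (regular_module R) I)"
  shows "ideal (\<Union>H) R" "I \<subseteq> \<Union>H" "\<And>a. a \<in> \<Union>H \<Longrightarrow> I +> a \<in> H"
    "\<And>X. X \<in> H \<Longrightarrow> \<exists>a\<in>X. X = I +> a"
proof -
  interpret I: ideal I R by fact
  interpret H: submodule H R "quotient_module (regular_module R) I" by fact
  let ?Q = "quotient_module (regular_module R) I"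
  have coset: "I +>\<^bsub>regular_module R\<^esub> a = I +> a" for a
    by (simp add: a_r_coset_def r_coset_def regular_module_def)
  have carr: "carrier ?Q = (\<Union>a\<in>carrier R. {I +> a})"
    by (simp add: quotient_module_def A_RCOSETS_def' coset) (simp add: regular_module_def)
  have add: "X \<oplus>\<^bsub>?Q\<^esub> Y = X <+> Y" for X Y
    by (simp add: quotient_module_def set_add_def set_mult_def regular_module_def)
  have smult: "r \<odot>\<^bsub>?Q\<^esub> X = (\<Union>x\<in>X. I +> (r \<otimes> x))" for r X
    by (simp add: quotient_module_def coset) (simp add: regular_module_def)
  have self: "a \<in> I +> a" if "a \<in> carrier R" for a
  proof -
    have "a = \<zero> \<oplus> a" using that by simp
    then show ?thesis unfolding a_r_coset_def' using I.zero_closed by blast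
  qed
  have rep: "I +> a = I +> b" if "b \<in> I +> a" "a \<in> carrier R" for a b
    using a_repr_independence[OF that I.a_subgroup] .
  have elem: "\<exists>a\<in>carrier R. X = I +> a" if "X \<in> H" for X
    using that H.subset carr by auto
  show cosets: "I +> a \<in> H" if "a \<in> \<Union>H" for a
    using that elem rep by force
  have mem: "a \<in> carrier R" if "a \<in> \<Union>H" for a
  proof -
    obtain X b where "X \<in> H" "a \<in> X" "b \<in> carrier R" "X = I +> b" using \<open>a \<in> \<Union>H\<close> elem by blast
    then show ?thesis using a_r_coset_subset_G[of I b] I.a_subset by auto
  qed
  show "\<exists>a\<in>X. X = I +> a" if "X \<in> H" for X
    using elem[OF that] self by blast
  have IH: "I \<in> H" using H.one_closed by (simp add: quotient_module_def)
  then show "I \<subseteq> \<Union>H" by blast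
  show "ideal (\<Union>H) R"
  proof (rule ideal_by_closure)
    show "\<Union>H \<subseteq> carrier R" using mem by blast
    show "\<zero> \<in> \<Union>H" using IH I.zero_closed by blast
  next
    fix a b assume ab: "a \<in> \<Union>H" "b \<in> \<Union>H"
    have "(I +> a) \<oplus>\<^bsub>?Q\<^esub> (I +> b) \<in> H" using H.m_closed[of "I +> a" "I +> b"] cosets ab by simp
    then have "I +> (a \<oplus> b) \<in> H" using I.a_rcos_sum mem ab add by simp
    then show "a \<oplus> b \<in> \<Union>H" using self[of "a \<oplus> b"] mem ab by blast
  next
    fix r a assume r: "r \<in> carrier R" and a: "a \<in> \<Union>H"
    have "r \<odot>\<^bsub>?Q\<^esub> (I +> a) \<in> H" using H.smult_closed r cosets a by simp
    moreover have "r \<otimes> a \<in> r \<odot>\<^bsub>?Q\<^esub> (I +> a)"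
      unfolding smult using self[OF mem[OF a]] self[of "r \<otimes> a"] r mem[OF a] by blast
    ultimately show "r \<otimes> a \<in> \<Union>H" by blast
  qed
qed

lemma (in cring) module_length_quotient_le:
  assumes I: "ideal I R" and len: "length_at_most R I (carrier R) r"
  shows "module_length R (quotient_module (regular_module R) I) \<le> enat r"
  unfolding module_length_def chain_length_def
proof (rule Sup_least, clarsimp)
  let ?Q = "quotient_module (regular_module R) I"
  obtain \<mu> where \<mu>: "\<And>C. ideal C R \<Longrightarrow> I \<subseteq> C \<Longrightarrow> C \<subseteq> carrier R \<Longrightarrow> \<mu> C \<le> r"
    "\<And>C C'. ideal C R \<Longrightarrow> ideal C' R \<Longrightarrow> I \<subseteq> C \<Longrightarrow> C \<subset> C' \<Longrightarrow> C' \<subseteq> carrier R \<Longrightarrow> \<mu> C < \<mu> C'"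
    using len unfolding length_at_most_def by blast
  fix n C assume sub: "\<forall>i\<le>n. submodule (C i) R ?Q" and strict: "\<forall>i<n. C i \<subset> C (Suc i)"
  note U = Union_submodule_quotient[OF I sub[rule_format]]
  have car: "\<Union>(C i) \<subseteq> carrier R" if "i \<le> n" for i using ideal_closed(1)[OF U(1)[OF that]] by blast
  have "i \<le> \<mu> (\<Union>(C i))" if "i \<le> n" for i
    using that
  proof (induction i)
    case (Suc i)
    have ss: "C i \<subset> C (Suc i)" using strict Suc.prems by simp
    have "\<Union>(C i) \<noteq> \<Union>(C (Suc i))"
    proof
      assume eq: "\<Union>(C i) = \<Union>(C (Suc i))"
      obtain X where X: "X \<in> C (Suc i)" "X \<notin> C i" using ss by blast
      obtain a where a: "a \<in> X" "X = I +> a" using U(4)[OF Suc.prems X(1)] by blast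
      have "a \<in> \<Union>(C i)" using a X(1) eq by blast
      then have "X \<in> C i" using U(3)[of i a] Suc.prems a(2) by simp
      then show False using X(2) by simp
    qed
    then have "\<Union>(C i) \<subset> \<Union>(C (Suc i))" using ss by blast
    then have "\<mu> (\<Union>(C i)) < \<mu> (\<Union>(C (Suc i)))"
      using U(1,2)[of i] U(1)[of "Suc i"] car[of "Suc i"] Suc.prems by (intro \<mu>(2)) auto
    then show ?case using Suc by simp
  qed simp
  then have "n \<le> \<mu> (\<Union>(C n))" by simp
  also have "\<dots> \<le> r" using U(1,2)[of n] car[of n] by (intro \<mu>(1)) auto
  finally show "n \<le> r" .
qed

text \<open>The filtration is climbed from \<open>\<mm>^(n+1)\<close> to \<open>R\<close>, each
  generator costing at most one. \<open>G b\<close> has to generate \<open>\<mm>^b\<close> only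
  modulo \<open>\<mm>^(b+1)\<close>, which permits leaving out a monomial that is redundant to
  leading order.\<close>

lemma (in local_noetherian_ring) module_length_max_ideal_power_le:
  assumes G: "\<And>b. b \<le> n \<Longrightarrow> finite (G b)" "\<And>b. b \<le> n \<Longrightarrow> G b \<subseteq> max_ideal_power R b"
    and gen: "\<And>b L. b \<le> n \<Longrightarrow> ideal L R \<Longrightarrow> max_ideal_power R (Suc b) \<subseteq> L \<Longrightarrow> G b \<subseteq> L \<Longrightarrow> max_ideal_power R b \<subseteq> L"
  shows "module_length R (quotient_module (regular_module R) (max_ideal_power R (n + 1))) \<le> enat (\<Sum>b\<le>n. card (G b))"
proof -
  let ?N = "max_ideal_power R (Suc n)"
  have "\<exists>L. ideal L R \<and> ?N \<subseteq> L \<and> max_ideal_power R (Suc n - k) \<subseteq> L \<and>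
      length_at_most R ?N L (\<Sum>b\<in>{Suc n - k..n}. card (G b))" if "k \<le> Suc n" for k
    using that
  proof (induction k)
    case 0
    then show ?case using max_ideal_power_ideal length_at_most_refl by auto
  next
    case (Suc k)
    define b where "b = n - k"
    have b: "Suc n - k = Suc b" "Suc n - Suc k = b" "b \<le> n" using Suc.prems by (auto simp: b_def)
    obtain L where L: "ideal L R" "?N \<subseteq> L" "max_ideal_power R (Suc b) \<subseteq> L"
      "length_at_most R ?N L (\<Sum>b\<in>{Suc b..n}. card (G b))" using Suc b by auto
    have gc: "g \<in> carrier R" if "g \<in> G b" for g
      using that G(2)[OF b(3)] ideal_closed(1)[OF max_ideal_power_ideal] by blast
    have pg: "p \<otimes> g \<in> L" if "g \<in> G b" "p \<in> max_ideal R" for g p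
    proof -
      have "g \<otimes> p \<in> L" using max_ideal_power_mult[OF _ that(2)] that(1) G(2)[OF b(3)] L(3) by blast
      then show ?thesis using m_comm gc[OF that(1)] that(2) by simp
    qed
    obtain L' where L': "ideal L' R" "L \<subseteq> L'" "G b \<subseteq> L'"
      "length_at_most R ?N L' ((\<Sum>b\<in>{Suc b..n}. card (G b)) + card (G b))"
      using length_at_most_add_finite[OF G(1)[OF b(3)] L(1,2,4) gc pg] by blast
    have "max_ideal_power R b \<subseteq> L'" using gen[OF b(3) L'(1)] L(3) L'(2,3) by blast
    moreover have "(\<Sum>b\<in>{Suc b..n}. card (G b)) + card (G b) = (\<Sum>b\<in>{b..n}. card (G b))"
      using b(3) by (simp add: sum.atLeast_Suc_atMost)
    ultimately show ?case unfolding b(2) using L' L(2) by (metis order_trans)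
  qed
  from this[of "Suc n"] obtain L where L: "ideal L R" "max_ideal_power R 0 \<subseteq> L"
    "length_at_most R ?N L (\<Sum>b\<in>{0..n}. card (G b))" by auto
  have "L = carrier R" using L(2) max_ideal_power_0 ideal_closed(1)[OF L(1)] by blast
  then show ?thesis
    using module_length_quotient_le[OF max_ideal_power_ideal, of "Suc n"] L(3) by (simp add: atLeast0AtMost)
qed

text \<open>If the length of \<open>R / \<mm>\<^bsup>n+1\<^esup>\<close> is as large as possible, then the associated graded ring is a
  polynomial ring up to degree \<open>n\<close>.\<close>

lemma (in local_noetherian_ring) coefficient_in_max_ideal:
  assumes x: "\<And>l. l < c \<Longrightarrow> x l \<in> carrier R" and span: "span_ideal R x c = max_ideal R"
    and len: "enat ((n + c) choose n) \<le> module_length R (quotient_module (regular_module R) (max_ideal_power R (n + 1)))"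
    and a: "a \<le> n" and r: "r \<in> exponents c a \<rightarrow> carrier R"
    and rel: "(\<Oplus>\<alpha>\<in>exponents c a. r \<alpha> \<otimes> monomial R x c \<alpha>) \<in> max_ideal_power R (Suc a)"
    and \<alpha>: "\<alpha> \<in> exponents c a"
  shows "r \<alpha> \<in> max_ideal R"
proof (rule ccontr)
  assume unit: "r \<alpha> \<notin> max_ideal R"
  \<comment> \<open>A unit coefficient makes the monomial of \<open>\<alpha>\<close> a combination
    of the others of its degree modulo \<open>\<mm>^(a+1)\<close>. Without it the generators are too
    few for the assumed length.\<close>
  define E where "E b = (if b = a then exponents c a - {\<alpha>} else exponents c b)" for b
  define G where "G b = monomial R x c ` E b" for b
  have pow: "max_ideal_power R b = combinations R (monomial R x c) (exponents c b)" for b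
    using max_ideal_power_eq_combinations[of c x, OF x span] .
  have Efin: "finite (E b)" for b by (simp add: E_def card_exponents)
  have sub: "E b \<subseteq> exponents c b" for b by (auto simp: E_def)
  have mc: "monomial R x c \<beta> \<in> carrier R" for \<beta> using x by simp
  have mpow: "monomial R x c \<beta> \<in> max_ideal_power R b" if "\<beta> \<in> exponents c b" for b \<beta>
    unfolding pow by (rule combinations_ideal(2)[OF card_exponents(1) mc that])
  have "module_length R (quotient_module (regular_module R) (max_ideal_power R (n + 1))) \<le> enat (\<Sum>b\<le>n. card (G b))"
  proof (rule module_length_max_ideal_power_le)
    show "finite (G b)" for b using Efin by (simp add: G_def)
    show "G b \<subseteq> max_ideal_power R b" for b using mpow sub by (auto simp: G_def)
    fix b L assume L: "ideal L R" "max_ideal_power R (Suc b) \<subseteq> L" "G b \<subseteq> L"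
    note Lc = ideal_closed[OF L(1)]
    have "monomial R x c \<beta> \<in> L" if \<beta>: "\<beta> \<in> exponents c b" for \<beta>
    proof (cases "\<beta> \<in> E b")
      case True
      then show ?thesis using L(3) by (auto simp: G_def)
    next
      case False
      then have ba: "b = a" "\<beta> = \<alpha>" using \<beta> by (auto simp: E_def split: if_splits)
      have e: "exponents c a = insert \<alpha> (E a)" using \<alpha> by (auto simp: E_def)
      have split: "(\<Oplus>\<alpha>\<in>exponents c a. r \<alpha> \<otimes> monomial R x c \<alpha>)
        = r \<alpha> \<otimes> monomial R x c \<alpha> \<oplus> (\<Oplus>\<alpha>\<in>E a. r \<alpha> \<otimes> monomial R x c \<alpha>)"
      proof -
        have "\<alpha> \<notin> E a" by (simp add: E_def)
        moreover have "(\<lambda>\<gamma>. r \<gamma> \<otimes> monomial R x c \<gamma>) \<in> E a \<rightarrow> carrier R"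
          using funcset_mem[OF r subsetD[OF sub]] mc by auto
        moreover have "r \<alpha> \<otimes> monomial R x c \<alpha> \<in> carrier R" using funcset_mem[OF r \<alpha>] mc by simp
        ultimately show ?thesis unfolding e by (intro finsum_insert Efin)
      qed
      have rest: "(\<Oplus>\<alpha>\<in>E a. r \<alpha> \<otimes> monomial R x c \<alpha>) \<in> L"
      proof (rule ideal_finsum_closed[OF L(1) Efin])
        fix \<gamma> assume \<gamma>: "\<gamma> \<in> E a"
        have "monomial R x c \<gamma> \<in> L" using L(3) \<gamma> by (auto simp: G_def ba(1))
        then show "r \<gamma> \<otimes> monomial R x c \<gamma> \<in> L"
          using Lc(6) funcset_mem[OF r subsetD[OF sub \<gamma>]] by blast
      qed
      have rm: "r \<alpha> \<in> carrier R" "r \<alpha> \<otimes> monomial R x c \<alpha> \<in> carrier R" using funcset_mem[OF r \<alpha>] mc by auto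
      have "r \<alpha> \<otimes> monomial R x c \<alpha> \<oplus> (\<Oplus>\<alpha>\<in>E a. r \<alpha> \<otimes> monomial R x c \<alpha>) \<in> L"
        unfolding split[symmetric] by (rule subsetD[OF L(2)]) (use rel ba(1) in simp)
      from Lc(5)[OF this rest] have "r \<alpha> \<otimes> monomial R x c \<alpha> \<in> L"
        using rm(2) Lc(1)[OF rest] by (simp add: a_minus_def a_assoc r_neg)
      then show ?thesis unfolding ba(2) using mem_ideal_unit[OF L(1) rm(1) unit mc] by simp
    qed
    then show "max_ideal_power R b \<subseteq> L" unfolding pow by (intro combinations_least[OF card_exponents(1) L(1)])
  qed
  also have "(\<Sum>b\<le>n. card (G b)) < (\<Sum>b\<le>n. card (exponents c b))"
  proof (rule sum_strict_mono_ex1)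
    show "\<forall>b\<in>{..n}. card (G b) \<le> card (exponents c b)"
      unfolding G_def by (intro ballI order_trans[OF card_image_le[OF Efin] card_mono[OF card_exponents(1) sub]])
    have "card (G a) \<le> card (E a)" unfolding G_def by (rule card_image_le[OF Efin])
    also have "\<dots> < card (exponents c a)"
      using \<alpha> card_exponents(1) by (intro psubset_card_mono) (auto simp: E_def)
    finally show "\<exists>b\<in>{..n}. card (G b) < card (exponents c b)" using a by blast
  qed simp
  finally show False using len by (simp add: sum_card_exponents)
qed

section \<open>Relations whose entries lie deep in the maximal ideal\<close>

lemma (in cring) vector_submodule_sum:
  assumes "vector_submodule R c Y" "vector_submodule R c Z"
  shows "vector_submodule R c {\<lambda>l. y l \<oplus> z l | y z. y \<in> Y \<and> z \<in> Z}" (is "vector_submodule R c ?S")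
  unfolding vector_submodule_def
proof (intro conjI ballI)
  note Y = vector_submoduleD[OF assms(1)] and Z = vector_submoduleD[OF assms(2)]
  have I: "(\<lambda>l. y l \<oplus> z l) \<in> ?S" if "y \<in> Y" "z \<in> Z" for y z using that by blast
  show "?S \<subseteq> vectors R c"
    using Y(1,2) Z(1,2) by (auto simp: vectors_def)
  show "(\<lambda>_. \<zero>) \<in> ?S" using I[OF Y(3) Z(3)] by simp
  fix u assume "u \<in> ?S"
  then obtain y z where u: "u = (\<lambda>l. y l \<oplus> z l)" "y \<in> Y" "z \<in> Z" by blast
  show "(\<lambda>l. r \<otimes> u l) \<in> ?S" if r: "r \<in> carrier R" for r
  proof -
    have "(\<lambda>l. r \<otimes> u l) = (\<lambda>l. r \<otimes> y l \<oplus> r \<otimes> z l)" using u Y(1) Z(1) r by (simp add: r_distr)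
    then show ?thesis using I[OF Y(5)[OF r u(2)] Z(5)[OF r u(3)]] by simp
  qed
  fix v assume "v \<in> ?S"
  then obtain y' z' where v: "v = (\<lambda>l. y' l \<oplus> z' l)" "y' \<in> Y" "z' \<in> Z" by blast
  have "u l \<oplus> v l = (y l \<oplus> y' l) \<oplus> (z l \<oplus> z' l)" for l
    unfolding u(1) v(1) using Y(1)[OF u(2), of l] Y(1)[OF v(2), of l] Z(1)[OF u(3), of l] Z(1)[OF v(3), of l]
    by algebra
  then show "(\<lambda>l. u l \<oplus> v l) \<in> ?S" using I[OF Y(4)[OF u(2) v(2)] Z(4)[OF u(3) v(3)]] by simp
qed

lemma (in cring) vector_mem_singles:
  assumes N: "vector_submodule R c N" and z: "z \<in> vectors R c"
    and single: "\<And>l. l < c \<Longrightarrow> (\<lambda>i. if i = l then z l else \<zero>) \<in> N"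
  shows "z \<in> N"
proof -
  have zc: "z l \<in> carrier R" "c \<le> l \<Longrightarrow> z l = \<zero>" for l using z by (auto simp: vectors_def)
  have "(\<lambda>i. if i < k then z i else \<zero>) \<in> N" if "k \<le> c" for k
    using that
  proof (induction k)
    case 0
    then show ?case using vector_submoduleD(3)[OF N] by simp
  next
    case (Suc k)
    have "(\<lambda>i. (if i < k then z i else \<zero>) \<oplus> (if i = k then z k else \<zero>)) \<in> N"
      using Suc single by (intro vector_submoduleD(4)[OF N]) auto
    moreover have "(if i < k then z i else \<zero>) \<oplus> (if i = k then z k else \<zero>) = (if i < Suc k then z i else \<zero>)" for i
      using zc(1) by (auto simp: less_Suc_eq)
    ultimately show ?case by simp
  qed
  moreover have "(\<lambda>i. if i < c then z i else \<zero>) = z" using zc(2) by (auto simp: fun_eq_iff not_less)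
  ultimately show ?thesis by (metis order.refl)
qed

text \<open>Modulo Koszul boundaries, a vector with entries in \<open>\<mm>\<^sup>a\<close> can be normalised so that its
  \<open>k\<close>-th entry involves only monomials in the variables from \<open>x\<^sub>k\<close> on.\<close>

definition normal_vectors :: "('a, 'r) ring_scheme \<Rightarrow> (nat \<Rightarrow> 'a) \<Rightarrow> nat \<Rightarrow> nat \<Rightarrow> (nat \<Rightarrow> 'a) set"
  where "normal_vectors R x c a = {z \<in> vectors R c.
    \<forall>k<c. z k \<in> combinations R (monomial R x c) {\<alpha> \<in> exponents c a. \<forall>i<k. \<alpha> i = 0}}"

lemma (in cring) normal_vectors_submodule:
  assumes x: "\<And>l. l < c \<Longrightarrow> x l \<in> carrier R"
  shows "vector_submodule R c (normal_vectors R x c a)"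
proof -
  have "ideal (combinations R (monomial R x c) {\<alpha> \<in> exponents c a. \<forall>i<k. \<alpha> i = 0}) R" for k
    using x by (intro combinations_ideal) (auto simp: card_exponents)
  note K = ideal_closed[OF this]
  show ?thesis
    unfolding vector_submodule_def normal_vectors_def
    using K(2,3,6) by (auto simp: vectors_def)
qed

text \<open>If the monomial in entry \<open>l\<close> involves an earlier variable, a single Koszul
  boundary moves it to the entry of the first variable that occurs in it.\<close>

lemma (in local_noetherian_ring) vector_normalise:
  assumes x: "\<And>l. l < c \<Longrightarrow> x l \<in> carrier R" and span: "span_ideal R x c = max_ideal R"
    and z: "z \<in> vectors R c" "\<And>l. l < c \<Longrightarrow> z l \<in> max_ideal_power R a"
  shows "\<exists>b \<in> koszul_boundaries R x c. \<exists>y \<in> normal_vectors R x c a. z = (\<lambda>l. b l \<oplus> y l)"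
proof -
  define N where "N = {\<lambda>l. b l \<oplus> y l | b y. b \<in> koszul_boundaries R x c \<and> y \<in> normal_vectors R x c a}"
  have B: "vector_submodule R c (koszul_boundaries R x c)" using koszul_boundaries_submodule x .
  have Y: "vector_submodule R c (normal_vectors R x c a)" using normal_vectors_submodule x .
  have N: "vector_submodule R c N" unfolding N_def by (rule vector_submodule_sum[OF B Y])
  have NI: "(\<lambda>l. b l \<oplus> y l) \<in> N" if "b \<in> koszul_boundaries R x c" "y \<in> normal_vectors R x c a" for b y
    using that unfolding N_def by blast
  have mc: "monomial R x c \<alpha> \<in> carrier R" for \<alpha> using x by simp
  have normal: "(\<lambda>i. if i = k then monomial R x c \<alpha> else \<zero>) \<in> normal_vectors R x c a"
    if "k < c" "\<alpha> \<in> exponents c a" "\<And>i. i < k \<Longrightarrow> \<alpha> i = 0" for k \<alpha>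
  proof -
    have comb: "\<zero> \<in> combinations R (monomial R x c) {\<alpha> \<in> exponents c a. \<forall>i<j. \<alpha> i = 0}" for j
      using mc by (intro ideal_closed(2) combinations_ideal) (auto simp: card_exponents)
    have "monomial R x c \<alpha> \<in> combinations R (monomial R x c) {\<alpha> \<in> exponents c a. \<forall>i<k. \<alpha> i = 0}"
      by (rule combinations_ideal(2)) (use mc that in \<open>auto simp: card_exponents\<close>)
    then show ?thesis using mc that(1) comb by (auto simp: normal_vectors_def vectors_def)
  qed
  have mono: "(\<lambda>i. if i = l then monomial R x c \<alpha> else \<zero>) \<in> N" if l: "l < c" and \<alpha>: "\<alpha> \<in> exponents c a" for l \<alpha>
  proof (cases "\<forall>i<l. \<alpha> i = 0")
    case True
    have "(\<lambda>i. \<zero> \<oplus> (if i = l then monomial R x c \<alpha> else \<zero>)) \<in> N"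
      using vector_submoduleD(3)[OF B] normal[OF l \<alpha>] True by (intro NI) auto
    moreover have "(\<lambda>i. \<zero> \<oplus> (if i = l then monomial R x c \<alpha> else \<zero>)) = (\<lambda>i. if i = l then monomial R x c \<alpha> else \<zero>)"
      using mc by auto
    ultimately show ?thesis by simp
  next
    case False
    \<comment> \<open>The boundary turns \<open>x^\<gamma> x_k e_l\<close> into
      \<open>x^\<gamma> x_l e_k\<close>. As \<open>k\<close> is least, no variable before
      \<open>x_k\<close> occurs in the new monomial, so the move need not be repeated.\<close>
    define k where "k = (LEAST i. \<alpha> i > 0)"
    from False obtain i where i: "i < l" "\<alpha> i > 0" by auto
    have "\<alpha> k > 0" unfolding k_def using i(2) by (rule LeastI)
    moreover have "k \<le> i" unfolding k_def using i(2) by (rule Least_le)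
    ultimately have k: "\<alpha> k > 0" "k < l" using i(1) by auto
    have small: "\<alpha> j = 0" if "j < k" for j using not_less_Least[of j "\<lambda>i. \<alpha> i > 0"] that unfolding k_def by blast
    have kc: "k < c" using k l by simp
    obtain a' where a': "a = Suc a'"
    proof (cases a)
      case 0
      then show ?thesis using \<alpha> k(1) by (simp add: exponents_0)
    qed (use that in auto)
    define \<gamma> where "\<gamma> = \<alpha>(k := \<alpha> k - 1)"
    have \<gamma>: "\<gamma> \<in> exponents c a'" "\<alpha> = \<gamma>(k := Suc (\<gamma> k))"
      unfolding \<gamma>_def using exponents_decr(2,3)[OF \<alpha>[unfolded a'] k(1)] by metis+
    define \<delta> where "\<delta> = \<gamma>(l := Suc (\<gamma> l))"
    have \<delta>: "\<delta> \<in> exponents c a" "\<And>i. i < k \<Longrightarrow> \<delta> i = 0"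
      using exponents_incr[OF \<gamma>(1) l] a' small k(2) by (auto simp: \<delta>_def \<gamma>_def)
    let ?r = "monomial R x c \<gamma>"
    have m\<alpha>: "monomial R x c \<alpha> = ?r \<otimes> x k"
      using monomial_incr[of c x k \<gamma>, OF x kc] \<gamma>(2) by simp
    have m\<delta>: "monomial R x c \<delta> = ?r \<otimes> x l"
      using monomial_incr[of c x l \<gamma>, OF x l] by (simp add: \<delta>_def)
    have "(\<lambda>i. (if i = l then ?r \<otimes> x k else if i = k then \<ominus> (?r \<otimes> x l) else \<zero>)
          \<oplus> (if i = k then monomial R x c \<delta> else \<zero>)) \<in> N"
      using koszul_vector_boundary[of c x l k ?r, OF x l kc _ mc] normal[OF kc \<delta>] k(2) by (intro NI) auto
    moreover have "(if i = l then ?r \<otimes> x k else if i = k then \<ominus> (?r \<otimes> x l) else \<zero>)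
          \<oplus> (if i = k then monomial R x c \<delta> else \<zero>) = (if i = l then monomial R x c \<alpha> else \<zero>)" for i
      using mc x[OF l] x[OF kc] k(2) by (auto simp: m\<alpha> m\<delta> l_neg)
    ultimately show ?thesis by simp
  qed
  have "z \<in> N"
  proof (rule vector_mem_singles[OF N z(1)])
    fix l assume l: "l < c"
    \<comment> \<open>The elements that may stand alone in entry \<open>l\<close> form an ideal, so
      it suffices to treat monomials of degree \<open>a\<close>.\<close>
    let ?K = "{y \<in> carrier R. (\<lambda>i. if i = l then y else \<zero>) \<in> N}"
    have "ideal ?K R"
    proof (rule ideal_by_closure)
      show "\<zero> \<in> ?K" using vector_submoduleD(3)[OF N] by simp
    next
      fix a b assume ab: "a \<in> ?K" "b \<in> ?K"
      then have "(\<lambda>i. (if i = l then a else \<zero>) \<oplus> (if i = l then b else \<zero>)) \<in> N"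
        by (intro vector_submoduleD(4)[OF N]) auto
      moreover have "(\<lambda>i. (if i = l then a else \<zero>) \<oplus> (if i = l then b else \<zero>)) = (\<lambda>i. if i = l then a \<oplus> b else \<zero>)"
        by auto
      ultimately show "a \<oplus> b \<in> ?K" using ab by simp
    next
      fix r a assume ra: "r \<in> carrier R" "a \<in> ?K"
      then have "(\<lambda>i. r \<otimes> (if i = l then a else \<zero>)) \<in> N"
        by (intro vector_submoduleD(5)[OF N]) auto
      moreover have "(\<lambda>i. r \<otimes> (if i = l then a else \<zero>)) = (\<lambda>i. if i = l then r \<otimes> a else \<zero>)"
        using ra by auto
      ultimately show "r \<otimes> a \<in> ?K" using ra by simp
    qed auto
    then have "combinations R (monomial R x c) (exponents c a) \<subseteq> ?K"
      using mono[OF l] mc by (intro combinations_least card_exponents) auto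
    then show "(\<lambda>i. if i = l then z l else \<zero>) \<in> N"
      using z(2)[OF l] max_ideal_power_eq_combinations[of c x, OF x span] by blast
  qed
  then show ?thesis unfolding N_def by blast
qed

text \<open>For normal \<open>y\<close>, the products \<open>x^\<gamma> x_k\<close> in
  \<open>\<Sum> y_k x_k\<close> have pairwise different exponents, since \<open>k\<close> is
  recovered as the first variable that occurs. Nothing can cancel in the relation, so every
  coefficient lies in \<open>\<mm>\<close>.\<close>

lemma (in local_noetherian_ring) normal_relation_deeper:
  assumes x: "\<And>l. l < c \<Longrightarrow> x l \<in> carrier R" and span: "span_ideal R x c = max_ideal R"
    and len: "enat ((n + c) choose n) \<le> module_length R (quotient_module (regular_module R) (max_ideal_power R (n + 1)))"
    and a: "a < n" and y: "y \<in> normal_vectors R x c a" "y \<in> relations R x c" and k: "k < c"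
  shows "y k \<in> max_ideal_power R (Suc a)"
proof -
  let ?m = "monomial R x c"
  define D where "D k = {\<alpha> \<in> exponents c a. \<forall>i<k. \<alpha> i = 0}" for k
  define up where "up k \<gamma> = \<gamma>(k := Suc (\<gamma> k))" for k and \<gamma> :: "nat \<Rightarrow> nat"
  define first where "first \<beta> = (LEAST i. \<beta> i > 0)" for \<beta> :: "nat \<Rightarrow> nat"
  have mc: "?m \<alpha> \<in> carrier R" for \<alpha> using x by simp
  have pow: "max_ideal_power R a = combinations R ?m (exponents c a)"
    using max_ideal_power_eq_combinations[of c x, OF x span] .
  have DE: "D k \<subseteq> exponents c a" for k by (auto simp: D_def)
  have Dfin: "finite (D k)" for k by (rule finite_subset[OF DE card_exponents(1)])
  have "\<forall>k<c. \<exists>s. s \<in> D k \<rightarrow> carrier R \<and> y k = (\<Oplus>\<gamma>\<in>D k. s \<gamma> \<otimes> ?m \<gamma>)"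
    using y(1) unfolding normal_vectors_def combinations_def D_def[symmetric] by blast
  then obtain s where s: "\<And>k. k < c \<Longrightarrow> s k \<in> D k \<rightarrow> carrier R"
    and yk: "\<And>k. k < c \<Longrightarrow> y k = (\<Oplus>\<gamma>\<in>D k. s k \<gamma> \<otimes> ?m \<gamma>)" by metis
  have sc: "s k \<gamma> \<in> carrier R" if "k < c" "\<gamma> \<in> D k" for k \<gamma> using funcset_mem[OF s] that .
  have first: "first (up k \<gamma>) = k" if "\<gamma> \<in> D k" for k \<gamma>
    unfolding first_def
  proof (rule Least_equality)
    show "up k \<gamma> k > 0" by (simp add: up_def)
    show "k \<le> i" if "up k \<gamma> i > 0" for i
      using that \<open>\<gamma> \<in> D k\<close> by (cases "i < k") (auto simp: up_def D_def)
  qed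
  have down: "(up k \<gamma>)(k := up k \<gamma> k - 1) = \<gamma>" for k \<gamma> by (simp add: up_def)
  \<comment> \<open>The coefficient of \<open>x^\<beta>\<close> in \<open>\<Sum> y_k x_k\<close>,
    read off from the only entry that contributes to it.\<close>
  define \<rho> where "\<rho> \<beta> = s (first \<beta>) (\<beta>(first \<beta> := \<beta> (first \<beta>) - 1))" for \<beta>
  have \<rho>_up: "\<rho> (up k \<gamma>) = s k \<gamma>" if "\<gamma> \<in> D k" for k \<gamma>
    unfolding \<rho>_def first[OF that] down ..
  have up_exp: "up k \<gamma> \<in> exponents c (Suc a)" if "\<gamma> \<in> D k" "k < c" for k \<gamma>
    unfolding up_def using exponents_incr[OF subsetD[OF DE that(1)] that(2)] .
  have m_up: "?m (up k \<gamma>) = ?m \<gamma> \<otimes> x k" if "k < c" for k \<gamma>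
    unfolding up_def using monomial_incr[of c x, OF x that] .
  have cover: "\<exists>k<c. \<exists>\<gamma>\<in>D k. \<beta> = up k \<gamma>" if \<beta>: "\<beta> \<in> exponents c (Suc a)" for \<beta>
  proof -
    obtain i where i: "\<beta> i > 0" using exponents_Suc_pos[OF \<beta>] by blast
    have pos: "\<beta> (first \<beta>) > 0" unfolding first_def using i by (rule LeastI)
    have small: "\<beta> j = 0" if "j < first \<beta>" for j
      using not_less_Least[of j "\<lambda>i. \<beta> i > 0"] that unfolding first_def by blast
    note d = exponents_decr[OF \<beta> pos]
    have "\<beta>(first \<beta> := \<beta> (first \<beta>) - 1) \<in> D (first \<beta>)" using d(2) small by (auto simp: D_def)
    then show ?thesis using d(1,3) unfolding up_def by metis
  qed
  have exp_UN: "exponents c (Suc a) = (\<Union>k<c. up k ` D k)"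
    using cover up_exp by (intro equalityI subsetI) (blast, auto)
  have inj: "inj_on (up k) (D k)" for k
  proof (rule inj_onI)
    fix \<gamma> \<gamma>' assume "up k \<gamma> = up k \<gamma>'"
    then show "\<gamma> = \<gamma>'" using down[of k \<gamma>] down[of k \<gamma>'] by metis
  qed
  have summand: "\<rho> \<beta> \<otimes> ?m \<beta> \<in> carrier R" if "\<beta> \<in> up k ` D k" "k < c" for k \<beta>
    using that sc \<rho>_up mc by auto
  have "(\<Oplus>\<beta>\<in>exponents c (Suc a). \<rho> \<beta> \<otimes> ?m \<beta>) = (\<Oplus>k\<in>{..<c}. \<Oplus>\<beta>\<in>up k ` D k. \<rho> \<beta> \<otimes> ?m \<beta>)"
    unfolding exp_UN
  proof (rule add.finprod_UN_disjoint)
    show "pairwise (\<lambda>i j. disjnt (up i ` D i) (up j ` D j)) {..<c}"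
      unfolding pairwise_def disjnt_def
    proof (intro ballI impI equals0I)
      fix i j \<beta> assume "i \<noteq> j" "\<beta> \<in> up i ` D i \<inter> up j ` D j"
      then show False using first by (metis IntE imageE)
    qed
  qed (use Dfin summand in auto)
  also have "\<dots> = (\<Oplus>k\<in>{..<c}. y k \<otimes> x k)"
  proof (rule finsum_cong')
    show "(\<lambda>k. y k \<otimes> x k) \<in> {..<c} \<rightarrow> carrier R"
      using y(2) x by (auto simp: relations_def vectors_def)
    fix k assume "k \<in> {..<c}"
    then have k: "k < c" by simp
    have "(\<Oplus>\<beta>\<in>up k ` D k. \<rho> \<beta> \<otimes> ?m \<beta>) = (\<Oplus>\<gamma>\<in>D k. \<rho> (up k \<gamma>) \<otimes> ?m (up k \<gamma>))"
      using summand k inj by (intro finsum_reindex) auto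
    also have "\<dots> = (\<Oplus>\<gamma>\<in>D k. s k \<gamma> \<otimes> ?m \<gamma> \<otimes> x k)"
      using sc[OF k] mc x[OF k] by (intro finsum_cong') (auto simp: \<rho>_up m_up[OF k] m_assoc)
    also have "\<dots> = y k \<otimes> x k"
      unfolding yk[OF k] using sc[OF k] mc x[OF k] Dfin by (intro finsum_ldistr[symmetric]) auto
    finally show "(\<Oplus>\<beta>\<in>up k ` D k. \<rho> \<beta> \<otimes> ?m \<beta>) = y k \<otimes> x k" .
  qed simp
  also have "\<dots> = \<zero>" using y(2) by (simp add: relations_def lin_def)
  finally have zero: "(\<Oplus>\<beta>\<in>exponents c (Suc a). \<rho> \<beta> \<otimes> ?m \<beta>) = \<zero>" .
  have \<rho>c: "\<rho> \<in> exponents c (Suc a) \<rightarrow> carrier R"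
    unfolding exp_UN using \<rho>_up sc by auto
  \<comment> \<open>Here \<open>a < n\<close> matters: it keeps the degree \<open>a + 1\<close>
    within the range in which the leading coefficients are controlled.\<close>
  have \<rho>m: "\<rho> \<beta> \<in> max_ideal R" if "\<beta> \<in> exponents c (Suc a)" for \<beta>
  proof (rule coefficient_in_max_ideal[of c x n "Suc a", OF x span len _ \<rho>c _ that])
    show "Suc a \<le> n" using a by simp
    show "(\<Oplus>\<alpha>\<in>exponents c (Suc a). \<rho> \<alpha> \<otimes> monomial R x c \<alpha>) \<in> max_ideal_power R (Suc (Suc a))"
      unfolding zero by (rule ideal_closed(2)[OF max_ideal_power_ideal])
  qed
  show ?thesis
    unfolding yk[OF k]
  proof (rule ideal_finsum_closed[OF max_ideal_power_ideal Dfin])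
    fix \<gamma> assume \<gamma>: "\<gamma> \<in> D k"
    have "s k \<gamma> \<in> max_ideal R" using \<rho>m[OF up_exp[OF \<gamma> k]] \<rho>_up[OF \<gamma>] by simp
    moreover have "?m \<gamma> \<in> max_ideal_power R a"
      unfolding pow by (rule combinations_ideal(2)[OF card_exponents(1) mc subsetD[OF DE \<gamma>]])
    ultimately have "?m \<gamma> \<otimes> s k \<gamma> \<in> max_ideal_power R (Suc a)" by (intro max_ideal_power_mult)
    then show "s k \<gamma> \<otimes> ?m \<gamma> \<in> max_ideal_power R (Suc a)" using m_comm sc[OF k \<gamma>] mc by simp
  qed
qed

text \<open>Each round splits off a boundary, so that the remainder is still a relation and still
  not a boundary, and gains one power of \<open>\<mm>\<close>. Control over leading coefficients up
  to degree \<open>n\<close> allows \<open>n\<close> rounds.\<close>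

lemma (in local_noetherian_ring) exists_deep_relation:
  assumes x: "\<And>l. l < c \<Longrightarrow> x l \<in> carrier R" and span: "span_ideal R x c = max_ideal R"
    and len: "enat ((n + c) choose n) \<le> module_length R (quotient_module (regular_module R) (max_ideal_power R (n + 1)))"
    and z: "z \<in> relations R x c" "z \<notin> koszul_boundaries R x c"
  shows "\<exists>z \<in> relations R x c. z \<notin> koszul_boundaries R x c \<and> (\<forall>l. z l \<in> max_ideal_power R n)"
proof -
  have "vector_submodule R c (koszul_boundaries R x c)" using koszul_boundaries_submodule x .
  note B = vector_submoduleD[OF this]
  have "vector_submodule R c (relations R x c)" using relations_submodule x .
  note Z = vector_submoduleD[OF this]
  have "\<exists>z \<in> relations R x c. z \<notin> koszul_boundaries R x c \<and> (\<forall>l. z l \<in> max_ideal_power R a)"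
    if "a \<le> n" for a
    using that
  proof (induction a)
    case 0
    then show ?case using z Z(1) max_ideal_power_0 by auto
  next
    case (Suc a)
    then obtain u where u: "u \<in> relations R x c" "u \<notin> koszul_boundaries R x c" "\<forall>l. u l \<in> max_ideal_power R a"
      by auto
    have uv: "u \<in> vectors R c" using u(1) by (simp add: relations_def)
    obtain b y where b: "b \<in> koszul_boundaries R x c" and y: "y \<in> normal_vectors R x c a"
      and uby: "u = (\<lambda>l. b l \<oplus> y l)"
      using vector_normalise[of c x, OF x span uv] u(3) by blast
    have bZ: "b \<in> relations R x c" using koszul_boundaries_relations[of c x, OF x] b by blast
    have yv: "y \<in> vectors R c" using y by (simp add: normal_vectors_def)
    have "u l \<ominus> b l = y l" for l
    proof -
      have "y l \<in> carrier R" using yv by (simp add: vectors_def)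
      then show ?thesis unfolding uby using B(1)[OF b, of l] by algebra
    qed
    then have yZ: "y \<in> relations R x c" using Z(7)[OF u(1) bZ] by simp
    have "y \<notin> koszul_boundaries R x c" using u(2) B(4)[OF b] uby by blast
    moreover have "y l \<in> max_ideal_power R (Suc a)" for l
    proof (cases "l < c")
      case True
      then show ?thesis using normal_relation_deeper[of c x n a y l, OF x span len _ y yZ] Suc.prems by simp
    next
      case False
      then have "y l = \<zero>" using yv by (simp add: vectors_def)
      then show ?thesis using ideal_closed(2)[OF max_ideal_power_ideal] by simp
    qed
    ultimately show ?case using yZ by blast
  qed
  then show ?thesis by blast
qed

section \<open>Dual bases of projective modules\<close>

lemma module_homsD:
  assumes "f \<in> module_homs R M N"
  shows "x \<in> carrier M \<Longrightarrow> f x \<in> carrier N"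
    "x \<in> carrier M \<Longrightarrow> y \<in> carrier M \<Longrightarrow> f (x \<oplus>\<^bsub>M\<^esub> y) = f x \<oplus>\<^bsub>N\<^esub> f y"
    "a \<in> carrier R \<Longrightarrow> x \<in> carrier M \<Longrightarrow> f (a \<odot>\<^bsub>M\<^esub> x) = a \<odot>\<^bsub>N\<^esub> f x"
  using assms by (auto simp: module_homs_def)

lemma module_homs_zero_neg:
  assumes M: "module R M" and N: "module R N" and f: "f \<in> module_homs R M N"
  shows "f \<zero>\<^bsub>M\<^esub> = \<zero>\<^bsub>N\<^esub>" "x \<in> carrier M \<Longrightarrow> f (\<ominus>\<^bsub>M\<^esub> x) = \<ominus>\<^bsub>N\<^esub> f x"
    "x \<in> carrier M \<Longrightarrow> y \<in> carrier M \<Longrightarrow> f (x \<ominus>\<^bsub>M\<^esub> y) = f x \<ominus>\<^bsub>N\<^esub> f y"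
proof -
  interpret M: module R M by fact
  interpret N: module R N by fact
  note fD = module_homsD[OF f]
  have "f (\<zero>\<^bsub>R\<^esub> \<odot>\<^bsub>M\<^esub> \<zero>\<^bsub>M\<^esub>) = \<zero>\<^bsub>N\<^esub>"
    using fD(1) fD(3)[of "\<zero>\<^bsub>R\<^esub>" "\<zero>\<^bsub>M\<^esub>"] by (simp del: M.smult_r_null)
  then show "f \<zero>\<^bsub>M\<^esub> = \<zero>\<^bsub>N\<^esub>" by simp
  show neg: "f (\<ominus>\<^bsub>M\<^esub> x) = \<ominus>\<^bsub>N\<^esub> f x" if x: "x \<in> carrier M" for x
  proof -
    have "f ((\<ominus>\<^bsub>R\<^esub> \<one>\<^bsub>R\<^esub>) \<odot>\<^bsub>M\<^esub> x) = (\<ominus>\<^bsub>R\<^esub> \<one>\<^bsub>R\<^esub>) \<odot>\<^bsub>N\<^esub> f x" using fD(3) x by simp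
    then show ?thesis using x fD(1) M.smult_l_minus[of "\<one>\<^bsub>R\<^esub>" x] N.smult_l_minus[of "\<one>\<^bsub>R\<^esub>" "f x"] by simp
  qed
  show "x \<in> carrier M \<Longrightarrow> y \<in> carrier M \<Longrightarrow> f (x \<ominus>\<^bsub>M\<^esub> y) = f x \<ominus>\<^bsub>N\<^esub> f y"
    using neg fD by (simp add: a_minus_def)
qed

lemma module_homs_finsum:
  assumes M: "module R M" and N: "module R N" and f: "f \<in> module_homs R M N"
    and "finite S" "\<And>e. e \<in> S \<Longrightarrow> u e \<in> carrier M"
  shows "f (\<Oplus>\<^bsub>M\<^esub>e\<in>S. u e) = (\<Oplus>\<^bsub>N\<^esub>e\<in>S. f (u e))"
  using assms(4,5)
proof (induction S rule: finite_induct)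
  interpret M: module R M by fact
  interpret N: module R N by fact
  case empty
  then show ?case using module_homs_zero_neg(1)[OF M N f] by simp
next
  interpret M: module R M by fact
  interpret N: module R N by fact
  note fD = module_homsD[OF f]
  case (insert e S)
  have "(\<Oplus>\<^bsub>M\<^esub>e\<in>insert e S. u e) = u e \<oplus>\<^bsub>M\<^esub> (\<Oplus>\<^bsub>M\<^esub>e\<in>S. u e)"
    using insert by (intro M.finsum_insert) auto
  moreover have "(\<Oplus>\<^bsub>N\<^esub>e\<in>insert e S. f (u e)) = f (u e) \<oplus>\<^bsub>N\<^esub> (\<Oplus>\<^bsub>N\<^esub>e\<in>S. f (u e))"
    using insert fD(1) by (intro N.finsum_insert) auto
  moreover have "(\<Oplus>\<^bsub>M\<^esub>e\<in>S. u e) \<in> carrier M" using insert by (intro M.finsum_closed) auto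
  ultimately show ?case using insert fD(2) by simp
qed

text \<open>A finitely supported function is encoded by a sequence listing its support and its values,
  and a sequence of resolution elements is again a resolution element because
  \<open>nat \<times> nat \<times> 'a\<close> embeds into \<open>nat \<times> 'a\<close>.\<close>

lemma finite_support_encoding:
  "\<exists>code :: (('a, 'b) resolution_elem \<Rightarrow> 'a) \<Rightarrow> ('a, 'b) resolution_elem. inj_on code {f. finite {q. f q \<noteq> z}}"
proof -
  \<comment> \<open>An enumeration needs a nonempty set, and the zero function has empty support;
    hence the extra point \<open>undefined\<close>. It does no harm, as the value there is listed
    too.\<close>
  define e where "e f = from_nat_into (insert undefined {q. f q \<noteq> z})"
    for f :: "('a, 'b) resolution_elem \<Rightarrow> 'a"
  define s :: "(('a, 'b) resolution_elem \<Rightarrow> 'a) \<Rightarrow> nat \<Rightarrow> ('a, 'b) resolution_elem"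
    where "s f i = (if even i then e f (i div 2) else (\<lambda>_. Inl (f (e f (i div 2)))))" for f i
  \<comment> \<open>\<open>prod_decode\<close> splits the number in an argument into a position of
    the sequence and the number passed on to the element at that position.\<close>
  define code :: "(('a, 'b) resolution_elem \<Rightarrow> 'a) \<Rightarrow> ('a, 'b) resolution_elem"
    where "code f = (\<lambda>(k, a). s f (fst (prod_decode k)) (snd (prod_decode k), a))" for f
  have "inj_on code {f. finite {q. f q \<noteq> z}}"
  proof (rule inj_onI, clarify)
    fix f g :: "('a, 'b) resolution_elem \<Rightarrow> 'a"
    assume fin: "finite {q. f q \<noteq> z}" "finite {q. g q \<noteq> z}" and eq: "code f = code g"
    have range: "range (e h) = insert undefined {q. h q \<noteq> z}" if "finite {q. h q \<noteq> z}" for h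
      unfolding e_def using that by (intro range_from_nat_into) (auto intro: countable_finite)
    have s_eq: "s f i = s g i" for i
    proof
      fix v
      have "code f (prod_encode (i, fst v), snd v) = code g (prod_encode (i, fst v), snd v)"
        using eq by simp
      then show "s f i v = s g i v" by (simp add: code_def)
    qed
    have e_eq: "e f j = e g j" for j using s_eq[of "2 * j"] by (simp add: s_def)
    have v_eq: "f (e f j) = g (e g j)" for j using s_eq[of "2 * j + 1"] by (simp add: s_def fun_eq_iff)
    show "f = g"
    proof
      fix q
      show "f q = g q"
      proof (cases "q \<in> range (e f)")
        case True
        then show ?thesis using e_eq v_eq by auto
      next
        case False
        then have "q \<notin> range (e g)" using e_eq by auto
        then show ?thesis using False range fin by auto
      qed
    qed
  qed
  then show ?thesis by blast
qed

lemma (in module) finsum_support_superset: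
  assumes "finite S" "S \<subseteq> carrier M" "\<And>q. f q \<in> carrier R" "{q. f q \<noteq> \<zero>} \<subseteq> S"
  shows "(\<Oplus>\<^bsub>M\<^esub>q\<in>{q. f q \<noteq> \<zero>}. f q \<odot>\<^bsub>M\<^esub> q) = (\<Oplus>\<^bsub>M\<^esub>q\<in>S. f q \<odot>\<^bsub>M\<^esub> q)"
  by (rule M.add.finprod_mono_neutral_cong_left) (use assms in \<open>auto simp: subset_iff\<close>)

text \<open>\<open>projective_module\<close> tests lifting only against modules with elements of the
  same type, so the free module on the elements of \<open>P\<close> is rebuilt inside that type from
  codes of finitely supported functions. A section of its map onto \<open>P\<close> has the
  functionals \<open>h q\<close> as coordinates.\<close>

lemma projective_dual_basis:
  fixes R :: "('a, 'r) ring_scheme" and P :: "('a, ('a, 'b) resolution_elem) module"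
  assumes P: "projective_module R P"
  obtains h where "\<And>q. h q \<in> module_homs R P (regular_module R)"
    "\<And>p. p \<in> carrier P \<Longrightarrow> finite {q. h q p \<noteq> \<zero>\<^bsub>R\<^esub>}"
    "\<And>p. p \<in> carrier P \<Longrightarrow> {q. h q p \<noteq> \<zero>\<^bsub>R\<^esub>} \<subseteq> carrier P"
    "\<And>p. p \<in> carrier P \<Longrightarrow> p = (\<Oplus>\<^bsub>P\<^esub>q\<in>{q. h q p \<noteq> \<zero>\<^bsub>R\<^esub>}. h q p \<odot>\<^bsub>P\<^esub> q)"
proof -
  interpret P: module R P using P by (simp add: projective_module_def)
  note R_simps = P.R.a_assoc P.R.a_comm P.R.l_distr P.R.r_distr P.R.m_assoc P.R.l_neg
  obtain code :: "(('a, 'b) resolution_elem \<Rightarrow> 'a) \<Rightarrow> ('a, 'b) resolution_elem"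
    where inj_code: "inj_on code {f. finite {q. f q \<noteq> \<zero>\<^bsub>R\<^esub>}}"
    using finite_support_encoding[where z = "\<zero>\<^bsub>R\<^esub>"] by (elim exE)
  define F where "F = {f. (\<forall>q. f q \<in> carrier R) \<and> finite {q. f q \<noteq> \<zero>\<^bsub>R\<^esub>} \<and> {q. f q \<noteq> \<zero>\<^bsub>R\<^esub>} \<subseteq> carrier P}"
  have inj: "inj_on code F" by (rule inj_on_subset[OF inj_code]) (auto simp: F_def)
  define dec where "dec = inv_into F code"
  have dec [simp]: "dec (code f) = f" if "f \<in> F" for f unfolding dec_def using inj that by (rule inv_into_f_f)
  have F0: "(\<lambda>_. \<zero>\<^bsub>R\<^esub>) \<in> F" by (simp add: F_def)
  have Fadd: "(\<lambda>q. f q \<oplus>\<^bsub>R\<^esub> g q) \<in> F" if "f \<in> F" "g \<in> F" for f g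
  proof -
    let ?U = "{q. f q \<noteq> \<zero>\<^bsub>R\<^esub>} \<union> {q. g q \<noteq> \<zero>\<^bsub>R\<^esub>}"
    have sub: "{q. f q \<oplus>\<^bsub>R\<^esub> g q \<noteq> \<zero>\<^bsub>R\<^esub>} \<subseteq> ?U" by auto
    have U: "finite ?U" "?U \<subseteq> carrier P" using that by (auto simp: F_def)
    show ?thesis
      unfolding F_def using finite_subset[OF sub U(1)] subset_trans[OF sub U(2)] that by (simp add: F_def)
  qed
  have Fmult: "(\<lambda>q. a \<otimes>\<^bsub>R\<^esub> f q) \<in> F" if "f \<in> F" "a \<in> carrier R" for f a
  proof -
    let ?U = "{q. f q \<noteq> \<zero>\<^bsub>R\<^esub>}"
    have sub: "{q. a \<otimes>\<^bsub>R\<^esub> f q \<noteq> \<zero>\<^bsub>R\<^esub>} \<subseteq> ?U" using that(2) by auto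
    have U: "finite ?U" "?U \<subseteq> carrier P" using that by (auto simp: F_def)
    show ?thesis
      unfolding F_def using finite_subset[OF sub U(1)] subset_trans[OF sub U(2)] that by (simp add: F_def)
  qed
  have Fc: "f q \<in> carrier R" if "f \<in> F" for f q using that by (simp add: F_def)
  define N :: "('a, ('a, 'b) resolution_elem) module" where
    "N = \<lparr>carrier = code ` F, monoid.mult = (\<lambda>_ _. undefined), one = undefined,
      ring.zero = code (\<lambda>_. \<zero>\<^bsub>R\<^esub>), add = (\<lambda>X Y. code (\<lambda>q. dec X q \<oplus>\<^bsub>R\<^esub> dec Y q)),
      smult = (\<lambda>a X. code (\<lambda>q. a \<otimes>\<^bsub>R\<^esub> dec X q))\<rparr>"
  have Nsimps [simp]: "carrier N = code ` F" "\<zero>\<^bsub>N\<^esub> = code (\<lambda>_. \<zero>\<^bsub>R\<^esub>)"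
    "f \<in> F \<Longrightarrow> g \<in> F \<Longrightarrow> code f \<oplus>\<^bsub>N\<^esub> code g = code (\<lambda>q. f q \<oplus>\<^bsub>R\<^esub> g q)"
    "f \<in> F \<Longrightarrow> a \<odot>\<^bsub>N\<^esub> code f = code (\<lambda>q. a \<otimes>\<^bsub>R\<^esub> f q)" for f g a
    by (simp_all add: N_def)
  have N: "module R N"
  proof (rule moduleI)
    show "cring R" by (rule P.R.cring_axioms)
    show "abelian_group N"
    proof (rule abelian_groupI)
      fix X assume "X \<in> carrier N"
      then obtain f where f: "f \<in> F" "X = code f" by auto
      have "(\<lambda>q. \<ominus>\<^bsub>R\<^esub> \<one>\<^bsub>R\<^esub> \<otimes>\<^bsub>R\<^esub> f q) \<in> F" using Fmult f by simp
      moreover have "(\<ominus>\<^bsub>R\<^esub> \<one>\<^bsub>R\<^esub> \<otimes>\<^bsub>R\<^esub> f q) \<oplus>\<^bsub>R\<^esub> f q = \<zero>\<^bsub>R\<^esub>" for q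
        using Fc[OF f(1), of q] by (simp add: P.R.l_minus P.R.l_neg)
      ultimately show "\<exists>Y\<in>carrier N. Y \<oplus>\<^bsub>N\<^esub> X = \<zero>\<^bsub>N\<^esub>" using f
        by (intro bexI[of _ "code (\<lambda>q. \<ominus>\<^bsub>R\<^esub> \<one>\<^bsub>R\<^esub> \<otimes>\<^bsub>R\<^esub> f q)"]) auto
    qed (auto simp: F0 Fadd Fc R_simps P.R.a_lcomm)
  qed (auto simp: Fadd Fmult Fc R_simps)
  define ev where "ev f = (\<Oplus>\<^bsub>P\<^esub>q\<in>{q. f q \<noteq> \<zero>\<^bsub>R\<^esub>}. f q \<odot>\<^bsub>P\<^esub> q)" for f
  have ev: "ev f = (\<Oplus>\<^bsub>P\<^esub>q\<in>S. f q \<odot>\<^bsub>P\<^esub> q)"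
    if "f \<in> F" "finite S" "S \<subseteq> carrier P" "{q. f q \<noteq> \<zero>\<^bsub>R\<^esub>} \<subseteq> S" for f S
    unfolding ev_def using that by (intro P.finsum_support_superset) (auto simp: Fc)
  define g where "g X = ev (dec X)" for X
  have g: "g \<in> module_homs R N P"
    unfolding module_homs_def
  proof (intro CollectI conjI ballI Pi_I)
    fix X assume "X \<in> carrier N"
    then obtain f where f: "f \<in> F" "X = code f" by auto
    let ?S = "{q. f q \<noteq> \<zero>\<^bsub>R\<^esub>}"
    have S: "finite ?S" "?S \<subseteq> carrier P" using f(1) by (auto simp: F_def)
    have fq: "f q \<odot>\<^bsub>P\<^esub> q \<in> carrier P" if "q \<in> ?S" for q using S(2) that Fc[OF f(1)] by blast
    show "g X \<in> carrier P" unfolding g_def f(2) dec[OF f(1)] ev_def using fq by (intro P.finsum_closed) auto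
    show "g (a \<odot>\<^bsub>N\<^esub> X) = a \<odot>\<^bsub>P\<^esub> g X" if a: "a \<in> carrier R" for a
    proof -
      have "g (a \<odot>\<^bsub>N\<^esub> X) = ev (\<lambda>q. a \<otimes>\<^bsub>R\<^esub> f q)" using f a Fmult by (simp add: g_def)
      also have "\<dots> = (\<Oplus>\<^bsub>P\<^esub>q\<in>?S. (a \<otimes>\<^bsub>R\<^esub> f q) \<odot>\<^bsub>P\<^esub> q)"
        using Fmult[OF f(1) a] S a by (intro ev) auto
      also have "\<dots> = (\<Oplus>\<^bsub>P\<^esub>q\<in>?S. a \<odot>\<^bsub>P\<^esub> (f q \<odot>\<^bsub>P\<^esub> q))"
        using S(2) a Fc[OF f(1)] by (intro P.M.finsum_cong') (auto simp: P.smult_assoc1 subset_iff)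
      also have "\<dots> = a \<odot>\<^bsub>P\<^esub> ev f"
        unfolding ev_def using S(1) a fq by (intro P.finsum_smult_ldistr[symmetric]) auto
      finally show ?thesis using f by (simp add: g_def)
    qed
    fix Y assume "Y \<in> carrier N"
    then obtain f' where f': "f' \<in> F" "Y = code f'" by auto
    let ?T = "?S \<union> {q. f' q \<noteq> \<zero>\<^bsub>R\<^esub>}"
    have T: "finite ?T" "?T \<subseteq> carrier P" using f(1) f'(1) by (auto simp: F_def)
    have "g (X \<oplus>\<^bsub>N\<^esub> Y) = ev (\<lambda>q. f q \<oplus>\<^bsub>R\<^esub> f' q)" using f f' Fadd by (simp add: g_def)
    also have "\<dots> = (\<Oplus>\<^bsub>P\<^esub>q\<in>?T. (f q \<oplus>\<^bsub>R\<^esub> f' q) \<odot>\<^bsub>P\<^esub> q)"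
      using Fadd[OF f(1) f'(1)] T by (intro ev) auto
    also have "\<dots> = (\<Oplus>\<^bsub>P\<^esub>q\<in>?T. f q \<odot>\<^bsub>P\<^esub> q \<oplus>\<^bsub>P\<^esub> f' q \<odot>\<^bsub>P\<^esub> q)"
      using T(2) Fc[OF f(1)] Fc[OF f'(1)] by (intro P.M.finsum_cong') (auto simp: P.smult_l_distr subset_iff)
    also have "\<dots> = (\<Oplus>\<^bsub>P\<^esub>q\<in>?T. f q \<odot>\<^bsub>P\<^esub> q) \<oplus>\<^bsub>P\<^esub> (\<Oplus>\<^bsub>P\<^esub>q\<in>?T. f' q \<odot>\<^bsub>P\<^esub> q)"
      using T(2) Fc[OF f(1)] Fc[OF f'(1)] by (intro P.M.finsum_addf) (auto simp: subset_iff)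
    also have "\<dots> = g X \<oplus>\<^bsub>P\<^esub> g Y"
      using ev[OF f(1) T] ev[OF f'(1) T] f f' by (simp add: g_def)
    finally show "g (X \<oplus>\<^bsub>N\<^esub> Y) = g X \<oplus>\<^bsub>P\<^esub> g Y" .
  qed
  have surj: "g ` carrier N = carrier P"
  proof (intro equalityI subsetI)
    show "p \<in> carrier P" if "p \<in> g ` carrier N" for p using that module_homsD(1)[OF g] by blast
    fix p assume p: "p \<in> carrier P"
    define f where "f q = (if q = p then \<one>\<^bsub>R\<^esub> else \<zero>\<^bsub>R\<^esub>)" for q
    have supp: "{q. f q \<noteq> \<zero>\<^bsub>R\<^esub>} \<subseteq> {p}" by (auto simp: f_def)
    then have f: "f \<in> F" using p finite_subset[OF supp] by (auto simp: F_def f_def)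
    have "f p = \<one>\<^bsub>R\<^esub>" by (simp add: f_def)
    then have "ev f = p" using ev[OF f _ _ supp] p by simp
    then have "g (code f) = p" using f by (simp add: g_def)
    then show "p \<in> g ` carrier N" using f by auto
  qed
  have "(\<lambda>p. p) \<in> module_homs R P P" by (simp add: module_homs_def)
  then obtain h where h: "h \<in> module_homs R P N" and split: "\<And>p. p \<in> carrier P \<Longrightarrow> g (h p) = p"
    using conjunct2[OF P[unfolded projective_module_def], rule_format, of g N P "\<lambda>p. p"] g N surj P.module_axioms
    by auto
  have hF: "dec (h p) \<in> F" "code (dec (h p)) = h p" if "p \<in> carrier P" for p
    using module_homsD(1)[OF h that] by auto
  show ?thesis
  proof (rule that[of "\<lambda>q p. dec (h p) q"])
    fix q
    show "(\<lambda>p. dec (h p) q) \<in> module_homs R P (regular_module R)"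
      unfolding module_homs_def
    proof (intro CollectI conjI ballI Pi_I)
      fix p assume p: "p \<in> carrier P"
      show "dec (h p) q \<in> carrier (regular_module R)" using Fc[OF hF(1)[OF p]] by (simp add: regular_module_def)
      show "dec (h (a \<odot>\<^bsub>P\<^esub> p)) q = a \<odot>\<^bsub>regular_module R\<^esub> dec (h p) q" if a: "a \<in> carrier R" for a
        using module_homsD(3)[OF h a p] Nsimps(4)[OF hF(1)[OF p], of a] hF(2)[OF p] Fmult[OF hF(1)[OF p] a]
        by (simp add: regular_module_def)
      fix p' assume p': "p' \<in> carrier P"
      show "dec (h (p \<oplus>\<^bsub>P\<^esub> p')) q = dec (h p) q \<oplus>\<^bsub>regular_module R\<^esub> dec (h p') q"
        using module_homsD(2)[OF h p p'] Nsimps(3)[OF hF(1)[OF p] hF(1)[OF p']] hF(2)[OF p] hF(2)[OF p']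
          Fadd[OF hF(1)[OF p] hF(1)[OF p']]
        by (simp add: regular_module_def)
    qed
  next
    fix p assume p: "p \<in> carrier P"
    show "finite {q. dec (h p) q \<noteq> \<zero>\<^bsub>R\<^esub>}" "{q. dec (h p) q \<noteq> \<zero>\<^bsub>R\<^esub>} \<subseteq> carrier P"
      using hF(1)[OF p] by (auto simp: F_def)
    show "p = (\<Oplus>\<^bsub>P\<^esub>q\<in>{q. dec (h p) q \<noteq> \<zero>\<^bsub>R\<^esub>}. dec (h p) q \<odot>\<^bsub>P\<^esub> q)"
      using split[OF p] unfolding g_def ev_def by simp
  qed
qed

text \<open>The image of \<open>T \<otimes> Q\<close> in \<open>Q\<^sup>c\<close>; only the entries below \<open>c\<close> matter.\<close>

inductive_set tensor_image ::
  "nat \<Rightarrow> (nat \<Rightarrow> 'a) set \<Rightarrow> ('a, 'u, 's) module_scheme \<Rightarrow> (nat \<Rightarrow> 'u) set"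
  for c T Q where
    zero: "(\<And>l. l < c \<Longrightarrow> q l = \<zero>\<^bsub>Q\<^esub>) \<Longrightarrow> q \<in> tensor_image c T Q"
  | add: "q \<in> tensor_image c T Q \<Longrightarrow> t \<in> T \<Longrightarrow> p \<in> carrier Q \<Longrightarrow>
      (\<And>l. l < c \<Longrightarrow> q' l = t l \<odot>\<^bsub>Q\<^esub> p \<oplus>\<^bsub>Q\<^esub> q l) \<Longrightarrow> q' \<in> tensor_image c T Q"

context module
begin

context
  fixes c :: nat and T :: "(nat \<Rightarrow> 'a) set"
  assumes T: "vector_submodule R c T"
begin

lemma tensor_image_closed: "q \<in> tensor_image c T M \<Longrightarrow> l < c \<Longrightarrow> q l \<in> carrier M"
proof (induction arbitrary: l rule: tensor_image.induct)
  case (add q t p q')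
  then show ?case using R.vector_submoduleD(1)[OF T add(2)] by simp
qed simp

lemma tensor_image_cong:
  assumes "q \<in> tensor_image c T M" "\<And>l. l < c \<Longrightarrow> q' l = q l"
  shows "q' \<in> tensor_image c T M"
  using assms(1)
proof cases
  case zero
  then show ?thesis using assms(2) by (intro tensor_image.zero) simp
next
  case (add q t p)
  then show ?thesis using assms(2) by (intro tensor_image.add[OF add(1-3)]) simp
qed

lemma tensor_image_single:
  assumes "t \<in> T" "p \<in> carrier M"
  shows "(\<lambda>l. t l \<odot>\<^bsub>M\<^esub> p) \<in> tensor_image c T M"
proof (rule tensor_image.add[OF _ assms])
  show "(\<lambda>_. \<zero>\<^bsub>M\<^esub>) \<in> tensor_image c T M" by (rule tensor_image.zero) simp
  show "t l \<odot>\<^bsub>M\<^esub> p = t l \<odot>\<^bsub>M\<^esub> p \<oplus>\<^bsub>M\<^esub> \<zero>\<^bsub>M\<^esub>" for l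
    using R.vector_submoduleD(1)[OF T assms(1)] assms(2) by simp
qed

lemma tensor_image_add:
  assumes "q \<in> tensor_image c T M" and u: "u \<in> tensor_image c T M"
  shows "(\<lambda>l. q l \<oplus>\<^bsub>M\<^esub> u l) \<in> tensor_image c T M"
  using assms(1)
proof (induction rule: tensor_image.induct)
  case (zero q)
  then show ?case using tensor_image_closed[OF u] by (intro tensor_image_cong[OF u]) simp
next
  case (add q t p q')
  show ?case
  proof (rule tensor_image.add[OF add(5,2,3)])
    fix l assume l: "l < c"
    show "q' l \<oplus>\<^bsub>M\<^esub> u l = t l \<odot>\<^bsub>M\<^esub> p \<oplus>\<^bsub>M\<^esub> (q l \<oplus>\<^bsub>M\<^esub> u l)"
      using add(4)[OF l] tensor_image_closed[OF u l] tensor_image_closed[OF add(1) l]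
        R.vector_submoduleD(1)[OF T add(2)] add(3)
      by (simp add: M.a_assoc)
  qed
qed

lemma tensor_image_smult:
  assumes "q \<in> tensor_image c T M" and a: "a \<in> carrier R"
  shows "(\<lambda>l. a \<odot>\<^bsub>M\<^esub> q l) \<in> tensor_image c T M"
  using assms(1)
proof (induction rule: tensor_image.induct)
  case (zero q)
  then show ?case using a by (intro tensor_image.zero) simp
next
  case (add q t p q')
  show ?case
  proof (rule tensor_image.add[OF add(5,2)])
    show "a \<odot>\<^bsub>M\<^esub> p \<in> carrier M" using a add(3) by simp
    fix l assume l: "l < c"
    have tl: "t l \<in> carrier R" using R.vector_submoduleD(1)[OF T add(2)] .
    have "a \<odot>\<^bsub>M\<^esub> (t l \<odot>\<^bsub>M\<^esub> p) = t l \<odot>\<^bsub>M\<^esub> (a \<odot>\<^bsub>M\<^esub> p)"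
      using a tl add(3) by (simp add: R.m_comm flip: smult_assoc1)
    then show "a \<odot>\<^bsub>M\<^esub> q' l = t l \<odot>\<^bsub>M\<^esub> (a \<odot>\<^bsub>M\<^esub> p) \<oplus>\<^bsub>M\<^esub> a \<odot>\<^bsub>M\<^esub> q l"
      using add(4)[OF l] tensor_image_closed[OF add(1) l] tl add(3) a by (simp add: smult_r_distr)
  qed
qed

lemma tensor_image_minus:
  assumes "q \<in> tensor_image c T M" "u \<in> tensor_image c T M"
  shows "(\<lambda>l. q l \<ominus>\<^bsub>M\<^esub> u l) \<in> tensor_image c T M"
proof (rule tensor_image_cong[OF tensor_image_add[OF assms(1) tensor_image_smult[OF assms(2), of "\<ominus> \<one>"]]])
  show "q l \<ominus>\<^bsub>M\<^esub> u l = q l \<oplus>\<^bsub>M\<^esub> (\<ominus> \<one>) \<odot>\<^bsub>M\<^esub> u l" if "l < c" for l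
    using tensor_image_closed[OF assms(2) that] smult_l_minus[of \<one> "u l"] by (simp add: a_minus_def)
qed simp

lemma tensor_image_finsum:
  assumes "finite S" "\<And>e. e \<in> S \<Longrightarrow> f e \<in> tensor_image c T M"
  shows "(\<lambda>l. \<Oplus>\<^bsub>M\<^esub>e\<in>S. f e l) \<in> tensor_image c T M"
  using assms
proof (induction S rule: finite_induct)
  case empty
  show ?case by (rule tensor_image.zero) simp
next
  case (insert e S)
  have "(\<lambda>l. f e l \<oplus>\<^bsub>M\<^esub> (\<Oplus>\<^bsub>M\<^esub>e\<in>S. f e l)) \<in> tensor_image c T M"
    using insert by (intro tensor_image_add) auto
  then show ?case
  proof (rule tensor_image_cong)
    fix l assume "l < c"
    then show "(\<Oplus>\<^bsub>M\<^esub>e\<in>insert e S. f e l) = f e l \<oplus>\<^bsub>M\<^esub> (\<Oplus>\<^bsub>M\<^esub>e\<in>S. f e l)"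
      using insert tensor_image_closed by (intro M.finsum_insert) auto
  qed
qed

text \<open>A functional on the module induces a map from \<open>T \<otimes> M\<close> to
  \<open>T\<close>; this is how statements about a projective module are brought back to the
  ring.\<close>

lemma tensor_image_functional:
  assumes "q \<in> tensor_image c T M" and h: "h \<in> module_homs R M (regular_module R)"
  shows "\<exists>t\<in>T. \<forall>l<c. h (q l) = t l"
  using assms(1)
proof (induction rule: tensor_image.induct)
  have hD: "v \<in> carrier M \<Longrightarrow> h v \<in> carrier R" "v \<in> carrier M \<Longrightarrow> v' \<in> carrier M \<Longrightarrow> h (v \<oplus>\<^bsub>M\<^esub> v') = h v \<oplus> h v'"
    "a \<in> carrier R \<Longrightarrow> v \<in> carrier M \<Longrightarrow> h (a \<odot>\<^bsub>M\<^esub> v) = a \<otimes> h v" for v v' a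
    using module_homsD[OF h] by (simp_all add: regular_module_def)
  {
    case (zero q)
    have "h (\<zero> \<odot>\<^bsub>M\<^esub> \<zero>\<^bsub>M\<^esub>) = \<zero>" using hD(1) hD(3)[of \<zero> "\<zero>\<^bsub>M\<^esub>"] by (simp del: smult_r_null)
    then have "h \<zero>\<^bsub>M\<^esub> = \<zero>" by simp
    then show ?case using zero R.vector_submoduleD(3)[OF T] by (intro bexI[of _ "\<lambda>_. \<zero>"]) auto
  next
    case (add q t p q')
    obtain t' where t': "t' \<in> T" "\<forall>l<c. h (q l) = t' l" using add(5) by blast
    have tl: "t l \<in> carrier R" for l using R.vector_submoduleD(1)[OF T add(2)] .
    have "(\<lambda>l. h p \<otimes> t l \<oplus> t' l) \<in> T"
      using R.vector_submoduleD(4)[OF T R.vector_submoduleD(5)[OF T hD(1)[OF add(3)] add(2)] t'(1)] .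
    moreover have "h (q' l) = h p \<otimes> t l \<oplus> t' l" if "l < c" for l
      using add(4)[OF that] t'(2) that hD tl add(3) tensor_image_closed[OF add(1) that]
      by (simp add: R.m_comm)
    ultimately show ?case by (intro bexI[of _ "\<lambda>l. h p \<otimes> t l \<oplus> t' l"]) auto
  }
qed

end

lemma finsum_smult_rdistr:
  assumes "finite A" "\<And>i. i \<in> A \<Longrightarrow> f i \<in> carrier R" "v \<in> carrier M"
  shows "(\<Oplus>i\<in>A. f i) \<odot>\<^bsub>M\<^esub> v = (\<Oplus>\<^bsub>M\<^esub>i\<in>A. f i \<odot>\<^bsub>M\<^esub> v)"
  using assms
proof (induction A rule: finite_induct)
  case empty
  then show ?case by simp
next
  case (insert i A)
  have "(\<Oplus>i\<in>insert i A. f i) = f i \<oplus> (\<Oplus>i\<in>A. f i)"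
    using insert by (intro R.finsum_insert) auto
  moreover have "(\<Oplus>\<^bsub>M\<^esub>i\<in>insert i A. f i \<odot>\<^bsub>M\<^esub> v) = f i \<odot>\<^bsub>M\<^esub> v \<oplus>\<^bsub>M\<^esub> (\<Oplus>\<^bsub>M\<^esub>i\<in>A. f i \<odot>\<^bsub>M\<^esub> v)"
    using insert by (intro M.finsum_insert) auto
  moreover have "(\<Oplus>i\<in>A. f i) \<in> carrier R" using insert by (intro R.finsum_closed) auto
  ultimately show ?case using insert by (simp add: smult_l_distr)
qed

text \<open>An alternating matrix is a sum of elementary ones, and each of these contributes a
  Koszul boundary tensored with one entry.\<close>

lemma tensor_image_koszul:
  assumes T: "vector_submodule R c T" "koszul_boundaries R x c \<subseteq> T"
    and x: "\<And>l. l < c \<Longrightarrow> x l \<in> carrier R"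
    and \<beta>: "\<And>l k. \<beta> l k \<in> carrier M" "\<And>l k. \<beta> l k = \<ominus>\<^bsub>M\<^esub> \<beta> k l" "\<And>l. \<beta> l l = \<zero>\<^bsub>M\<^esub>"
  shows "(\<lambda>l. \<Oplus>\<^bsub>M\<^esub>k\<in>{..<c}. x k \<odot>\<^bsub>M\<^esub> \<beta> l k) \<in> tensor_image c T M"
proof -
  have xb: "x k \<odot>\<^bsub>M\<^esub> \<beta> l j \<in> carrier M" if "k < c" for k l j using x[OF that] \<beta>(1) by simp
  have "(\<lambda>l. if l < n then \<Oplus>\<^bsub>M\<^esub>k\<in>{..<n}. x k \<odot>\<^bsub>M\<^esub> \<beta> l k else \<zero>\<^bsub>M\<^esub>) \<in> tensor_image c T M" if "n \<le> c" for n
    using that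
  proof (induction n)
    case 0
    show ?case by (rule tensor_image.zero) simp
  next
    case (Suc n)
    have n: "n < c" using Suc.prems by simp
    \<comment> \<open>What the entries at \<open>(n, k)\<close> and \<open>(k, n)\<close> contribute
      when the matrix grows by row and column \<open>n\<close>: the boundary of a basis element of
      \<open>K_2\<close>, tensored with \<open>\<beta> n k\<close>.\<close>
    define u where "u k l = (if l = n then x k \<odot>\<^bsub>M\<^esub> \<beta> n k else if l = k then x n \<odot>\<^bsub>M\<^esub> \<beta> k n else \<zero>\<^bsub>M\<^esub>)" for k l
    have u: "u k \<in> tensor_image c T M" if k: "k < n" for k
    proof -
      let ?v = "\<lambda>l. if l = n then \<one> \<otimes> x k else if l = k then \<ominus> (\<one> \<otimes> x n) else \<zero>"
      have kc: "k < c" using k n by simp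
      have "?v \<in> koszul_boundaries R x c"
        using R.koszul_vector_boundary[of c x n k \<one>] x n kc k by simp
      then have "(\<lambda>l. ?v l \<odot>\<^bsub>M\<^esub> \<beta> n k) \<in> tensor_image c T M"
        using T(2) \<beta>(1) by (intro tensor_image_single[OF T(1)]) auto
      then show ?thesis
      proof (rule tensor_image_cong[OF T(1)])
        fix l
        have "x n \<odot>\<^bsub>M\<^esub> \<beta> k n = \<ominus>\<^bsub>M\<^esub> (x n \<odot>\<^bsub>M\<^esub> \<beta> n k)"
          using \<beta>(2)[of k n] smult_r_minus[OF x[OF n] \<beta>(1)[of n k]] by simp
        then show "u k l = ?v l \<odot>\<^bsub>M\<^esub> \<beta> n k"
          using x[OF n] x[OF kc] \<beta>(1)[of n k] smult_l_minus[OF x[OF n] \<beta>(1)[of n k]] k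
          by (simp add: u_def)
      qed
    qed
    have uc: "u k l \<in> carrier M" if "k < n" for k l
      using xb[of k n k] xb[OF n, of k n] that n by (simp add: u_def)
    have "(\<lambda>l. (if l < n then \<Oplus>\<^bsub>M\<^esub>k\<in>{..<n}. x k \<odot>\<^bsub>M\<^esub> \<beta> l k else \<zero>\<^bsub>M\<^esub>) \<oplus>\<^bsub>M\<^esub> (\<Oplus>\<^bsub>M\<^esub>k\<in>{..<n}. u k l))
        \<in> tensor_image c T M"
      using Suc u by (intro tensor_image_add[OF T(1)] tensor_image_finsum[OF T(1)]) auto
    then show ?case
    proof (rule tensor_image_cong[OF T(1)])
      fix l assume "l < c"
      have split: "(\<Oplus>\<^bsub>M\<^esub>k\<in>{..<Suc n}. x k \<odot>\<^bsub>M\<^esub> \<beta> l k) = (\<Oplus>\<^bsub>M\<^esub>k\<in>{..<n}. x k \<odot>\<^bsub>M\<^esub> \<beta> l k) \<oplus>\<^bsub>M\<^esub> x n \<odot>\<^bsub>M\<^esub> \<beta> l n"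
        using xb n by (intro M.finsum_lessThan_Suc) auto
      have sc: "(\<Oplus>\<^bsub>M\<^esub>k\<in>{..<n}. x k \<odot>\<^bsub>M\<^esub> \<beta> l k) \<in> carrier M" using xb n by (intro M.finsum_closed) auto
      consider "l < n" | "l = n" | "l > n" by linarith
      then show "(if l < Suc n then \<Oplus>\<^bsub>M\<^esub>k\<in>{..<Suc n}. x k \<odot>\<^bsub>M\<^esub> \<beta> l k else \<zero>\<^bsub>M\<^esub>)
        = (if l < n then \<Oplus>\<^bsub>M\<^esub>k\<in>{..<n}. x k \<odot>\<^bsub>M\<^esub> \<beta> l k else \<zero>\<^bsub>M\<^esub>) \<oplus>\<^bsub>M\<^esub> (\<Oplus>\<^bsub>M\<^esub>k\<in>{..<n}. u k l)"
      proof cases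
        case 1
        have "(\<Oplus>\<^bsub>M\<^esub>k\<in>{..<n}. u k l) = u l l"
          using 1 xb[OF n] by (intro M.finsum_single) (auto simp: u_def)
        then show ?thesis using 1 split by (simp add: u_def)
      next
        case 2
        have "(\<Oplus>\<^bsub>M\<^esub>k\<in>{..<n}. u k l) = (\<Oplus>\<^bsub>M\<^esub>k\<in>{..<n}. x k \<odot>\<^bsub>M\<^esub> \<beta> l k)"
          using 2 xb n by (intro M.finsum_cong') (auto simp: u_def)
        then show ?thesis using 2 split sc \<beta>(3)[of n] x[OF n] by simp
      next
        case 3
        have "(\<Oplus>\<^bsub>M\<^esub>k\<in>{..<n}. u k l) = (\<Oplus>\<^bsub>M\<^esub>k\<in>{..<n}. \<zero>\<^bsub>M\<^esub>)"
          using 3 by (intro M.finsum_cong') (auto simp: u_def)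
        then show ?thesis using 3 by simp
      qed
    qed
  qed
  from this[OF order.refl] show ?thesis by (rule tensor_image_cong[OF T(1)]) simp
qed

end

lemma tensor_image_hom:
  assumes "module R M" "module R N" and f: "f \<in> module_homs R M N"
    and T: "vector_submodule R c T" and "q \<in> tensor_image c T M"
  shows "(\<lambda>l. f (q l)) \<in> tensor_image c T N"
  using assms(5)
proof (induction rule: tensor_image.induct)
  case (zero q)
  then show ?case using module_homs_zero_neg(1)[OF assms(1-3)] by (intro tensor_image.zero) simp
next
  interpret M: module R M by fact
  case (add q t p q')
  show ?case
  proof (rule tensor_image.add[OF add(5,2)])
    show "f p \<in> carrier N" using module_homsD(1)[OF f add(3)] .
    fix l assume l: "l < c"
    have "t l \<in> carrier R" using M.R.vector_submoduleD(1)[OF T add(2)] .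
    then show "f (q' l) = t l \<odot>\<^bsub>N\<^esub> f p \<oplus>\<^bsub>N\<^esub> f (q l)"
      using add(4)[OF l] module_homsD(2,3)[OF f] add(3) M.tensor_image_closed[OF T add(1) l] by simp
  qed
qed

text \<open>The submodule \<open>I Q\<close> for the ideal \<open>I\<close> generated by the first
  \<open>c\<close> elements, given as the image of \<open>Q^c\<close> so that preimages under the
  map \<open>x\<close> of the periodic complex are at hand.\<close>

definition linear_image :: "(nat \<Rightarrow> 'a) \<Rightarrow> nat \<Rightarrow> ('a, 'u, 's) module_scheme \<Rightarrow> 'u set"
  where "linear_image x c Q = {(\<Oplus>\<^bsub>Q\<^esub>l\<in>{..<c}. x l \<odot>\<^bsub>Q\<^esub> v l) | v. \<forall>l. v l \<in> carrier Q}"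

context module
begin

lemma linear_image_closed:
  assumes x: "\<And>l. l < c \<Longrightarrow> x l \<in> carrier R"
  shows "linear_image x c M \<subseteq> carrier M" "\<zero>\<^bsub>M\<^esub> \<in> linear_image x c M"
    "u \<in> linear_image x c M \<Longrightarrow> v \<in> linear_image x c M \<Longrightarrow> u \<oplus>\<^bsub>M\<^esub> v \<in> linear_image x c M"
    "a \<in> span_ideal R x c \<Longrightarrow> v' \<in> carrier M \<Longrightarrow> a \<odot>\<^bsub>M\<^esub> v' \<in> linear_image x c M"
proof -
  have I: "(\<Oplus>\<^bsub>M\<^esub>l\<in>{..<c}. x l \<odot>\<^bsub>M\<^esub> v l) \<in> linear_image x c M" if "\<And>l. v l \<in> carrier M" for v
    using that unfolding linear_image_def by blast
  show "linear_image x c M \<subseteq> carrier M"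
    unfolding linear_image_def using x by (auto intro!: M.finsum_closed)
  have "(\<Oplus>\<^bsub>M\<^esub>l\<in>{..<c}. x l \<odot>\<^bsub>M\<^esub> \<zero>\<^bsub>M\<^esub>) = (\<Oplus>\<^bsub>M\<^esub>l\<in>{..<c}. \<zero>\<^bsub>M\<^esub>)"
    using x by (intro M.finsum_cong') auto
  then show "\<zero>\<^bsub>M\<^esub> \<in> linear_image x c M" using I[of "\<lambda>_. \<zero>\<^bsub>M\<^esub>"] by simp
  show "u \<oplus>\<^bsub>M\<^esub> v \<in> linear_image x c M" if uv: "u \<in> linear_image x c M" "v \<in> linear_image x c M" for u v
  proof -
    obtain p where p: "\<forall>l. p l \<in> carrier M" "u = (\<Oplus>\<^bsub>M\<^esub>l\<in>{..<c}. x l \<odot>\<^bsub>M\<^esub> p l)"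
      using uv(1) unfolding linear_image_def by blast
    obtain q where q: "\<forall>l. q l \<in> carrier M" "v = (\<Oplus>\<^bsub>M\<^esub>l\<in>{..<c}. x l \<odot>\<^bsub>M\<^esub> q l)"
      using uv(2) unfolding linear_image_def by blast
    note * = p(1) q(1) p(2) q(2)
    have "u \<oplus>\<^bsub>M\<^esub> v = (\<Oplus>\<^bsub>M\<^esub>l\<in>{..<c}. x l \<odot>\<^bsub>M\<^esub> p l \<oplus>\<^bsub>M\<^esub> x l \<odot>\<^bsub>M\<^esub> q l)"
      unfolding *(3,4) using *(1,2) x by (intro M.finsum_addf[symmetric]) auto
    also have "\<dots> = (\<Oplus>\<^bsub>M\<^esub>l\<in>{..<c}. x l \<odot>\<^bsub>M\<^esub> (p l \<oplus>\<^bsub>M\<^esub> q l))"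
      using *(1,2) x by (intro M.finsum_cong') (auto simp: smult_r_distr)
    finally show ?thesis using I[of "\<lambda>l. p l \<oplus>\<^bsub>M\<^esub> q l"] *(1,2) by simp
  qed
  show "a \<odot>\<^bsub>M\<^esub> v' \<in> linear_image x c M" if a: "a \<in> span_ideal R x c" and v': "v' \<in> carrier M" for a v'
  proof -
    have "span_ideal R x c = lin R x c ` vectors R c" using R.span_ideal_eq_lin x .
    then obtain y where y: "y \<in> vectors R c" "a = lin R x c y" using a by blast
    have yc: "y l \<in> carrier R" for l using y(1) by (simp add: vectors_def)
    have "a \<odot>\<^bsub>M\<^esub> v' = (\<Oplus>\<^bsub>M\<^esub>l\<in>{..<c}. (y l \<otimes> x l) \<odot>\<^bsub>M\<^esub> v')"
      unfolding y(2) lin_def using yc x v' by (intro finsum_smult_rdistr) auto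
    also have "\<dots> = (\<Oplus>\<^bsub>M\<^esub>l\<in>{..<c}. x l \<odot>\<^bsub>M\<^esub> (y l \<odot>\<^bsub>M\<^esub> v'))"
      using yc x v' by (intro M.finsum_cong') (auto simp: R.m_comm simp flip: smult_assoc1)
    finally show ?thesis using I[of "\<lambda>l. y l \<odot>\<^bsub>M\<^esub> v'"] yc v' by simp
  qed
qed

lemma linear_image_finsum:
  assumes x: "\<And>l. l < c \<Longrightarrow> x l \<in> carrier R"
    and "finite S" "\<And>e. e \<in> S \<Longrightarrow> f e \<in> linear_image x c M"
  shows "(\<Oplus>\<^bsub>M\<^esub>e\<in>S. f e) \<in> linear_image x c M"
  using assms(2,3)
proof (induction S rule: finite_induct)
  case empty
  have "\<zero>\<^bsub>M\<^esub> \<in> linear_image x c M" by (rule linear_image_closed(2)) (rule x)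
  then show ?case by simp
next
  case (insert e S)
  have sub: "linear_image x c M \<subseteq> carrier M" by (rule linear_image_closed(1)) (rule x)
  have "(\<Oplus>\<^bsub>M\<^esub>e\<in>insert e S. f e) = f e \<oplus>\<^bsub>M\<^esub> (\<Oplus>\<^bsub>M\<^esub>e\<in>S. f e)"
    using insert sub by (intro M.finsum_insert) auto
  also have "\<dots> \<in> linear_image x c M"
    by (rule linear_image_closed(3)[OF x]) (use insert in auto)
  finally show ?case .
qed

end

text \<open>Tensoring with \<open>P\<close> preserves the exactness of the periodic complex
  \<open>\<dots> \<rightarrow> R\<^sup>c/T \<rightarrow> R \<rightarrow> R\<^sup>c/T \<rightarrow> R\<close>, whose maps are given by \<open>x\<close> and by the class of \<open>z\<close>.
  Projectivity of \<open>P\<close> enters as flatness, through a dual basis.\<close>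

lemma projective_exact_even:
  fixes R :: "('a, 'r) ring_scheme" and P :: "('a, ('a, 'b) resolution_elem) module"
  assumes P: "projective_module R P" and T: "vector_submodule R c T"
    and x: "\<And>l. l < c \<Longrightarrow> x l \<in> carrier R" and z: "z \<in> vectors R c"
    and Tz: "\<And>a. a \<in> carrier R \<Longrightarrow> (\<lambda>l. a \<otimes>\<^bsub>R\<^esub> z l) \<in> T \<Longrightarrow> a \<in> span_ideal R x c"
    and q: "q \<in> carrier P" "(\<lambda>l. z l \<odot>\<^bsub>P\<^esub> q) \<in> tensor_image c T P"
  shows "q \<in> linear_image x c P"
proof -
  interpret P: module R P using P by (simp add: projective_module_def)
  obtain h where h: "\<And>q. h q \<in> module_homs R P (regular_module R)"
    and fin: "\<And>q. q \<in> carrier P \<Longrightarrow> finite {e. h e q \<noteq> \<zero>\<^bsub>R\<^esub>}"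
      "\<And>q. q \<in> carrier P \<Longrightarrow> {e. h e q \<noteq> \<zero>\<^bsub>R\<^esub>} \<subseteq> carrier P"
    and basis: "\<And>q. q \<in> carrier P \<Longrightarrow> q = (\<Oplus>\<^bsub>P\<^esub>e\<in>{e. h e q \<noteq> \<zero>\<^bsub>R\<^esub>}. h e q \<odot>\<^bsub>P\<^esub> e)"
    by (rule projective_dual_basis[OF P]) (rule that)
  have zc: "z l \<in> carrier R" "c \<le> l \<Longrightarrow> z l = \<zero>\<^bsub>R\<^esub>" for l using z by (auto simp: vectors_def)
  have hq: "h e q \<in> carrier R" for e using module_homsD(1)[OF h q(1)] by (simp add: regular_module_def)
  \<comment> \<open>Over the ring itself the claim is the assumption \<open>Tz\<close>. It applies
    to every coordinate of \<open>q\<close>, and the dual basis puts \<open>q\<close> together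
    again.\<close>
  have "h e q \<in> span_ideal R x c" for e
  proof (rule Tz[OF hq])
    obtain t where t: "t \<in> T" "\<forall>l<c. h e (z l \<odot>\<^bsub>P\<^esub> q) = t l"
      using P.tensor_image_functional[OF T q(2) h] by blast
    have "h e q \<otimes>\<^bsub>R\<^esub> z l = t l" for l
    proof (cases "l < c")
      case True
      have "h e (z l \<odot>\<^bsub>P\<^esub> q) = z l \<otimes>\<^bsub>R\<^esub> h e q"
        using module_homsD(3)[OF h zc(1) q(1)] by (simp add: regular_module_def)
      then show ?thesis using t(2) True P.R.m_comm[OF hq zc(1)] by simp
    next
      case False
      then show ?thesis using zc(2)[of l] hq P.R.vector_submoduleD(2)[OF T t(1), of l] by simp
    qed
    then show "(\<lambda>l. h e q \<otimes>\<^bsub>R\<^esub> z l) \<in> T" using t(1) by simp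
  qed
  then have "(\<Oplus>\<^bsub>P\<^esub>e\<in>{e. h e q \<noteq> \<zero>\<^bsub>R\<^esub>}. h e q \<odot>\<^bsub>P\<^esub> e) \<in> linear_image x c P"
    using fin[OF q(1)] x by (intro P.linear_image_finsum P.linear_image_closed(4)) auto
  then show ?thesis using basis[OF q(1)] by simp
qed

lemma projective_exact_odd:
  fixes R :: "('a, 'r) ring_scheme" and P :: "('a, ('a, 'b) resolution_elem) module"
  assumes P: "projective_module R P" and T: "vector_submodule R c T"
    and x: "\<And>l. l < c \<Longrightarrow> x l \<in> carrier R" and z: "z \<in> vectors R c"
    and ZT: "\<And>q. q \<in> relations R x c \<Longrightarrow> \<exists>r \<in> carrier R. (\<lambda>l. q l \<ominus>\<^bsub>R\<^esub> r \<otimes>\<^bsub>R\<^esub> z l) \<in> T"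
    and p: "\<And>l. p l \<in> carrier P" "(\<Oplus>\<^bsub>P\<^esub>l\<in>{..<c}. x l \<odot>\<^bsub>P\<^esub> p l) = \<zero>\<^bsub>P\<^esub>"
  shows "\<exists>r \<in> carrier P. (\<lambda>l. p l \<ominus>\<^bsub>P\<^esub> z l \<odot>\<^bsub>P\<^esub> r) \<in> tensor_image c T P"
proof -
  interpret P: module R P using P by (simp add: projective_module_def)
  obtain h where h: "\<And>q. h q \<in> module_homs R P (regular_module R)"
    and fin: "\<And>q. q \<in> carrier P \<Longrightarrow> finite {e. h e q \<noteq> \<zero>\<^bsub>R\<^esub>}"
      "\<And>q. q \<in> carrier P \<Longrightarrow> {e. h e q \<noteq> \<zero>\<^bsub>R\<^esub>} \<subseteq> carrier P"
    and basis: "\<And>q. q \<in> carrier P \<Longrightarrow> q = (\<Oplus>\<^bsub>P\<^esub>e\<in>{e. h e q \<noteq> \<zero>\<^bsub>R\<^esub>}. h e q \<odot>\<^bsub>P\<^esub> e)"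
    by (rule projective_dual_basis[OF P]) (rule that)
  have zc: "z l \<in> carrier R" for l using z by (auto simp: vectors_def)
  have hD: "q \<in> carrier P \<Longrightarrow> h e q \<in> carrier R" "q \<in> carrier P \<Longrightarrow> q' \<in> carrier P \<Longrightarrow> h e (q \<oplus>\<^bsub>P\<^esub> q') = h e q \<oplus>\<^bsub>R\<^esub> h e q'"
    "a \<in> carrier R \<Longrightarrow> q \<in> carrier P \<Longrightarrow> h e (a \<odot>\<^bsub>P\<^esub> q) = a \<otimes>\<^bsub>R\<^esub> h e q" for e q q' a
    using module_homsD[OF h[of e]] by (simp_all add: regular_module_def)
  have h0: "h e \<zero>\<^bsub>P\<^esub> = \<zero>\<^bsub>R\<^esub>" for e
    using hD(1)[of "\<zero>\<^bsub>P\<^esub>" e] hD(3)[of "\<zero>\<^bsub>R\<^esub>" "\<zero>\<^bsub>P\<^esub>" e] by simp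
  have hsum: "h e (\<Oplus>\<^bsub>P\<^esub>l\<in>{..<n}. x l \<odot>\<^bsub>P\<^esub> p l) = (\<Oplus>\<^bsub>R\<^esub>l\<in>{..<n}. h e (p l) \<otimes>\<^bsub>R\<^esub> x l)" if "n \<le> c" for e n
    using that
  proof (induction n)
    case 0
    then show ?case using h0 by simp
  next
    case (Suc n)
    have xc: "x l \<in> carrier R" if "l \<le> n" for l using x that Suc.prems by simp
    have "(\<Oplus>\<^bsub>P\<^esub>l\<in>{..<Suc n}. x l \<odot>\<^bsub>P\<^esub> p l) = (\<Oplus>\<^bsub>P\<^esub>l\<in>{..<n}. x l \<odot>\<^bsub>P\<^esub> p l) \<oplus>\<^bsub>P\<^esub> x n \<odot>\<^bsub>P\<^esub> p n"
      using xc p(1) by (intro P.M.finsum_lessThan_Suc) auto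
    moreover have "(\<Oplus>\<^bsub>R\<^esub>l\<in>{..<Suc n}. h e (p l) \<otimes>\<^bsub>R\<^esub> x l) = (\<Oplus>\<^bsub>R\<^esub>l\<in>{..<n}. h e (p l) \<otimes>\<^bsub>R\<^esub> x l) \<oplus>\<^bsub>R\<^esub> h e (p n) \<otimes>\<^bsub>R\<^esub> x n"
      using xc p(1) hD(1) by (intro P.R.finsum_lessThan_Suc) auto
    moreover have "(\<Oplus>\<^bsub>P\<^esub>l\<in>{..<n}. x l \<odot>\<^bsub>P\<^esub> p l) \<in> carrier P" using xc p(1) by (intro P.M.finsum_closed) auto
    ultimately show ?case using Suc xc[of n] p(1)[of n] hD by (simp add: P.R.m_comm)
  qed
  define S where "S = (\<Union>l\<in>{..<c}. {e. h e (p l) \<noteq> \<zero>\<^bsub>R\<^esub>})"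
  have S: "finite S" "S \<subseteq> carrier P" using fin p(1) by (auto simp: S_def)
  \<comment> \<open>For fixed \<open>e\<close> the coordinates of the entries of \<open>p\<close>
    form a relation over the ring, which modulo \<open>T\<close> is a multiple \<open>r e\<close> of
    \<open>z\<close>. These \<open>r e\<close> are the coefficients of the element sought.\<close>
  define \<zeta> where "\<zeta> e l = (if l < c then h e (p l) else \<zero>\<^bsub>R\<^esub>)" for e l
  have \<zeta>c: "\<zeta> e l \<in> carrier R" for e l using hD(1) p(1) by (simp add: \<zeta>_def)
  have "\<zeta> e \<in> relations R x c" for e
  proof -
    have "lin R x c (\<zeta> e) = (\<Oplus>\<^bsub>R\<^esub>l\<in>{..<c}. h e (p l) \<otimes>\<^bsub>R\<^esub> x l)"
      unfolding lin_def using hD(1) p(1) x by (intro P.R.finsum_cong') (auto simp: \<zeta>_def)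
    also have "\<dots> = \<zero>\<^bsub>R\<^esub>" using hsum[of c e] p(2) h0 by simp
    finally show ?thesis using \<zeta>c by (simp add: relations_def vectors_def) (simp add: \<zeta>_def)
  qed
  then have "\<forall>e. \<exists>r. r \<in> carrier R \<and> (\<lambda>l. \<zeta> e l \<ominus>\<^bsub>R\<^esub> r \<otimes>\<^bsub>R\<^esub> z l) \<in> T" using ZT by blast
  then obtain r where r: "\<And>e. r e \<in> carrier R" "\<And>e. (\<lambda>l. \<zeta> e l \<ominus>\<^bsub>R\<^esub> r e \<otimes>\<^bsub>R\<^esub> z l) \<in> T" by metis
  define r' where "r' = (\<Oplus>\<^bsub>P\<^esub>e\<in>S. r e \<odot>\<^bsub>P\<^esub> e)"
  have re: "r e \<odot>\<^bsub>P\<^esub> e \<in> carrier P" if "e \<in> S" for e using r(1) S(2) that by blast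
  have r': "r' \<in> carrier P" unfolding r'_def using re by (intro P.M.finsum_closed) auto
  have "(\<lambda>l. \<Oplus>\<^bsub>P\<^esub>e\<in>S. (\<zeta> e l \<ominus>\<^bsub>R\<^esub> r e \<otimes>\<^bsub>R\<^esub> z l) \<odot>\<^bsub>P\<^esub> e) \<in> tensor_image c T P"
    using S r(2) by (intro P.tensor_image_finsum[OF T] P.tensor_image_single[OF T]) auto
  then have "(\<lambda>l. p l \<ominus>\<^bsub>P\<^esub> z l \<odot>\<^bsub>P\<^esub> r') \<in> tensor_image c T P"
  proof (rule P.tensor_image_cong[OF T])
    fix l assume l: "l < c"
    have e1: "p l = (\<Oplus>\<^bsub>P\<^esub>e\<in>S. \<zeta> e l \<odot>\<^bsub>P\<^esub> e)"
    proof -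
      have "p l = (\<Oplus>\<^bsub>P\<^esub>e\<in>{e. h e (p l) \<noteq> \<zero>\<^bsub>R\<^esub>}. h e (p l) \<odot>\<^bsub>P\<^esub> e)" using basis[OF p(1)] .
      also have "\<dots> = (\<Oplus>\<^bsub>P\<^esub>e\<in>S. h e (p l) \<odot>\<^bsub>P\<^esub> e)"
        using S hD(1) p(1) l by (intro P.finsum_support_superset) (auto simp: S_def)
      finally show ?thesis using l by (simp add: \<zeta>_def)
    qed
    have e2: "z l \<odot>\<^bsub>P\<^esub> r' = (\<Oplus>\<^bsub>P\<^esub>e\<in>S. z l \<odot>\<^bsub>P\<^esub> (r e \<odot>\<^bsub>P\<^esub> e))"
      unfolding r'_def using S re zc by (intro P.finsum_smult_ldistr) auto
    have "p l \<ominus>\<^bsub>P\<^esub> z l \<odot>\<^bsub>P\<^esub> r' = (\<Oplus>\<^bsub>P\<^esub>e\<in>S. \<zeta> e l \<odot>\<^bsub>P\<^esub> e) \<oplus>\<^bsub>P\<^esub> (\<Oplus>\<^bsub>P\<^esub>e\<in>S. \<ominus>\<^bsub>P\<^esub> (z l \<odot>\<^bsub>P\<^esub> (r e \<odot>\<^bsub>P\<^esub> e)))"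
      unfolding a_minus_def e2 by (subst e1, subst P.M.finsum_neg) (use re zc in auto)
    also have "\<dots> = (\<Oplus>\<^bsub>P\<^esub>e\<in>S. \<zeta> e l \<odot>\<^bsub>P\<^esub> e \<oplus>\<^bsub>P\<^esub> \<ominus>\<^bsub>P\<^esub> (z l \<odot>\<^bsub>P\<^esub> (r e \<odot>\<^bsub>P\<^esub> e)))"
      using S \<zeta>c re zc by (intro P.M.finsum_addf[symmetric]) auto
    also have "\<dots> = (\<Oplus>\<^bsub>P\<^esub>e\<in>S. (\<zeta> e l \<ominus>\<^bsub>R\<^esub> r e \<otimes>\<^bsub>R\<^esub> z l) \<odot>\<^bsub>P\<^esub> e)"
    proof (rule P.M.finsum_cong')
      fix e assume "e \<in> S"
      then have e: "e \<in> carrier P" using S(2) by blast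
      show "\<zeta> e l \<odot>\<^bsub>P\<^esub> e \<oplus>\<^bsub>P\<^esub> \<ominus>\<^bsub>P\<^esub> (z l \<odot>\<^bsub>P\<^esub> (r e \<odot>\<^bsub>P\<^esub> e)) = (\<zeta> e l \<ominus>\<^bsub>R\<^esub> r e \<otimes>\<^bsub>R\<^esub> z l) \<odot>\<^bsub>P\<^esub> e"
        using \<zeta>c zc r(1) e
        by (simp add: a_minus_def P.smult_l_distr P.smult_l_minus P.R.m_comm flip: P.smult_assoc1)
    qed (use S \<zeta>c zc r(1) in auto)
    finally show "p l \<ominus>\<^bsub>P\<^esub> z l \<odot>\<^bsub>P\<^esub> r' = (\<Oplus>\<^bsub>P\<^esub>e\<in>S. (\<zeta> e l \<ominus>\<^bsub>R\<^esub> r e \<otimes>\<^bsub>R\<^esub> z l) \<odot>\<^bsub>P\<^esub> e)" .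
  qed
  then show ?thesis using r' by blast
qed

section \<open>Nakayama's lemma for finitely generated modules\<close>

lemma (in module) submodule_zero: "submodule N R M \<Longrightarrow> \<zero>\<^bsub>M\<^esub> \<in> N"
  using subgroup.one_closed[OF submodule.axioms(1)] by fastforce

lemma (in module) generated_submodule_is_submodule:
  assumes "S \<subseteq> carrier M"
  shows "submodule (generated_submodule R M S) R M"
proof -
  let ?F = "{N. submodule N R M \<and> S \<subseteq> N}"
  have top: "carrier M \<in> ?F" using carrier_is_submodule assms by auto
  have "submodule (\<Inter>?F) R M"
  proof (rule submoduleI)
    show "\<Inter>?F \<subseteq> carrier M" using top by blast
    show "\<zero>\<^bsub>M\<^esub> \<in> \<Inter>?F" using submodule_zero by simp
    show "\<ominus>\<^bsub>M\<^esub> a \<in> \<Inter>?F" if "a \<in> \<Inter>?F" for a using that submoduleE(3) by simp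
    show "a \<oplus>\<^bsub>M\<^esub> b \<in> \<Inter>?F" if "a \<in> \<Inter>?F" "b \<in> \<Inter>?F" for a b using that submoduleE(5) by simp
    show "a \<odot>\<^bsub>M\<^esub> v \<in> \<Inter>?F" if "a \<in> carrier R" "v \<in> \<Inter>?F" for a v using that submoduleE(4) by simp
  qed
  then show ?thesis by (simp add: generated_submodule_def hull_def)
qed

text \<open>Induction on the number of generators: the assumption expresses a generator
  \<open>s\<close> through itself, with a coefficient in \<open>\<mm>\<close>, and through the other
  generators, so \<open>s\<close> is redundant.\<close>

lemma (in local_noetherian_ring) module_nakayama:
  assumes M: "module R M" and fg: "finitely_generated_module R M"
    and x: "\<And>l. l < c \<Longrightarrow> x l \<in> max_ideal R" and sub: "carrier M \<subseteq> linear_image x c M"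
  shows "carrier M = {\<zero>\<^bsub>M\<^esub>}"
proof -
  interpret M: module R M by fact
  have trivial: "carrier M = {\<zero>\<^bsub>M\<^esub>}"
    if "finite S" "S \<subseteq> carrier M" "generated_submodule R M S = carrier M" for S
    using that
  proof (induction "card S" arbitrary: S rule: less_induct)
    case less
    show ?case
    proof (cases "S = {}")
      case True
      have "submodule {\<zero>\<^bsub>M\<^esub>} R M" by (rule M.submoduleI) auto
      then have "carrier M \<subseteq> {\<zero>\<^bsub>M\<^esub>}"
        using less.prems(3) True unfolding generated_submodule_def
        by (metis empty_subsetI hull_minimal)
      then show ?thesis using M.M.zero_closed by blast
    next
      case False
      then obtain s where s: "s \<in> S" by blast
      have sc: "s \<in> carrier M" using s less.prems(2) by blast
      let ?S = "S - {s}"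
      define N where "N = generated_submodule R M ?S"
      have N: "submodule N R M" unfolding N_def using less.prems(2) by (intro M.generated_submodule_is_submodule) auto
      note Nc = M.submoduleE[OF N]
      have N0: "\<zero>\<^bsub>M\<^esub> \<in> N" by (rule M.submodule_zero[OF N])
      have SN: "?S \<subseteq> N" unfolding N_def generated_submodule_def by (rule hull_subset)
      \<comment> \<open>\<open>I s + N\<close>, used for the whole ring, where it is all of
        \<open>M\<close>, and for \<open>\<mm>\<close>, where it contains every
        \<open>x_l v\<close>.\<close>
      define K where "K I = {b \<odot>\<^bsub>M\<^esub> s \<oplus>\<^bsub>M\<^esub> n | b n. b \<in> I \<and> n \<in> N}" for I
      have KI: "b \<odot>\<^bsub>M\<^esub> s \<oplus>\<^bsub>M\<^esub> n \<in> K I" if "b \<in> I" "n \<in> N" for b n I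
        using that unfolding K_def by blast
      have K: "submodule (K I) R M" if I: "ideal I R" for I
      proof (rule M.submoduleI)
        note Ic = ideal_closed[OF I]
        show "K I \<subseteq> carrier M" unfolding K_def using Ic(1) Nc(1) sc by auto
        have "\<zero> \<odot>\<^bsub>M\<^esub> s \<oplus>\<^bsub>M\<^esub> \<zero>\<^bsub>M\<^esub> = \<zero>\<^bsub>M\<^esub>" using sc by simp
        then show "\<zero>\<^bsub>M\<^esub> \<in> K I" using KI[OF Ic(2) N0] by simp
        fix u assume "u \<in> K I"
        then obtain b n where u: "u = b \<odot>\<^bsub>M\<^esub> s \<oplus>\<^bsub>M\<^esub> n" "b \<in> I" "n \<in> N" unfolding K_def by blast
        have c: "b \<in> carrier R" "n \<in> carrier M" using u Ic(1) Nc(1) by auto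
        show smult: "a \<odot>\<^bsub>M\<^esub> u \<in> K I" if a: "a \<in> carrier R" for a
        proof -
          have "a \<odot>\<^bsub>M\<^esub> u = (a \<otimes> b) \<odot>\<^bsub>M\<^esub> s \<oplus>\<^bsub>M\<^esub> a \<odot>\<^bsub>M\<^esub> n"
            unfolding u(1) using a c sc by (simp add: M.smult_r_distr M.smult_assoc1)
          then show ?thesis using KI[OF Ic(6)[OF a u(2)] Nc(4)[OF a u(3)]] by simp
        qed
        have "\<ominus>\<^bsub>M\<^esub> u = (\<ominus> \<one>) \<odot>\<^bsub>M\<^esub> u"
          unfolding u(1) using c sc M.smult_l_minus[of \<one> "b \<odot>\<^bsub>M\<^esub> s \<oplus>\<^bsub>M\<^esub> n"] by simp
        then show "\<ominus>\<^bsub>M\<^esub> u \<in> K I" using smult[of "\<ominus> \<one>"] by simp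
        fix v assume "v \<in> K I"
        then obtain b' n' where v: "v = b' \<odot>\<^bsub>M\<^esub> s \<oplus>\<^bsub>M\<^esub> n'" "b' \<in> I" "n' \<in> N" unfolding K_def by blast
        have c': "b' \<in> carrier R" "n' \<in> carrier M" using v Ic(1) Nc(1) by auto
        have "u \<oplus>\<^bsub>M\<^esub> v = (b \<oplus> b') \<odot>\<^bsub>M\<^esub> s \<oplus>\<^bsub>M\<^esub> (n \<oplus>\<^bsub>M\<^esub> n')"
          unfolding u(1) v(1) using c c' sc by (simp add: M.smult_l_distr M.M.a_ac)
        then show "u \<oplus>\<^bsub>M\<^esub> v \<in> K I" using KI[OF Ic(3)[OF u(2) v(2)] Nc(5)[OF u(3) v(3)]] by simp
      qed
      have "S \<subseteq> K (carrier R)"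
      proof
        fix t assume t: "t \<in> S"
        show "t \<in> K (carrier R)"
        proof (cases "t = s")
          case True
          then show ?thesis using KI[OF one_closed N0] sc by simp
        next
          case False
          then have "t \<in> N" using t SN by blast
          then show ?thesis using KI[OF zero_closed \<open>t \<in> N\<close>] sc Nc(1) by auto
        qed
      qed
      then have MK: "carrier M \<subseteq> K (carrier R)"
        using hull_minimal[of S "K (carrier R)" "\<lambda>N. submodule N R M"] K[OF oneideal] less.prems(3)
        unfolding generated_submodule_def by blast
      let ?K = "K (max_ideal R)"
      note Kc = M.submoduleE[OF K[OF ideal_max_ideal]]
      have xK: "x l \<odot>\<^bsub>M\<^esub> v \<in> ?K" if l: "l < c" and v: "v \<in> carrier M" for l v
      proof -
        obtain b n where bn: "v = b \<odot>\<^bsub>M\<^esub> s \<oplus>\<^bsub>M\<^esub> n" "b \<in> carrier R" "n \<in> N"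
          using MK v unfolding K_def by blast
        have xl: "x l \<in> carrier R" using x[OF l] by simp
        have "x l \<odot>\<^bsub>M\<^esub> v = (x l \<otimes> b) \<odot>\<^bsub>M\<^esub> s \<oplus>\<^bsub>M\<^esub> x l \<odot>\<^bsub>M\<^esub> n"
          unfolding bn(1) using bn(2,3) xl sc Nc(1) by (simp add: M.smult_r_distr M.smult_assoc1 subset_iff)
        then show ?thesis
          using KI[OF ideal_closed(7)[OF ideal_max_ideal bn(2) x[OF l]] Nc(4)[OF xl bn(3)]] by simp
      qed
      have "(\<Oplus>\<^bsub>M\<^esub>l\<in>{..<k}. x l \<odot>\<^bsub>M\<^esub> v l) \<in> ?K" if "k \<le> c" "\<And>l. v l \<in> carrier M" for k v
        using that(1)
      proof (induction k)
        case 0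
        show ?case using M.submodule_zero[OF K[OF ideal_max_ideal]] by simp
      next
        case (Suc k)
        have "(\<Oplus>\<^bsub>M\<^esub>l\<in>{..<Suc k}. x l \<odot>\<^bsub>M\<^esub> v l) = (\<Oplus>\<^bsub>M\<^esub>l\<in>{..<k}. x l \<odot>\<^bsub>M\<^esub> v l) \<oplus>\<^bsub>M\<^esub> x k \<odot>\<^bsub>M\<^esub> v k"
          using x that(2) Suc.prems by (intro M.M.finsum_lessThan_Suc) auto
        then show ?case using Suc xK that(2) Kc(5) by simp
      qed
      then have "linear_image x c M \<subseteq> ?K" unfolding linear_image_def by blast
      then have "s \<in> ?K" using sub sc by blast
      then obtain a n where an: "a \<in> max_ideal R" "n \<in> N" "s = a \<odot>\<^bsub>M\<^esub> s \<oplus>\<^bsub>M\<^esub> n" unfolding K_def by blast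
      have ac: "a \<in> carrier R" and nc: "n \<in> carrier M" using an Nc(1) by auto
      have "\<one> \<ominus> a \<in> carrier R - max_ideal R"
        using primeideal.complement(3)[OF prime_max_ideal _ an(1)] one_notin_max_ideal by blast
      then have U: "\<one> \<ominus> a \<in> Units R" using Units_of_not_max_ideal by blast
      have "(\<one> \<ominus> a) \<odot>\<^bsub>M\<^esub> s = s \<ominus>\<^bsub>M\<^esub> a \<odot>\<^bsub>M\<^esub> s"
        using ac sc by (simp add: a_minus_def M.smult_l_distr M.smult_l_minus)
      also have "\<dots> = (a \<odot>\<^bsub>M\<^esub> s \<oplus>\<^bsub>M\<^esub> n) \<ominus>\<^bsub>M\<^esub> a \<odot>\<^bsub>M\<^esub> s" using an(3) by simp
      also have "\<dots> = n" using ac sc nc by (simp add: a_minus_def M.M.a_ac M.M.r_neg M.M.r_neg1 M.M.r_neg2)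
      finally have "inv (\<one> \<ominus> a) \<odot>\<^bsub>M\<^esub> ((\<one> \<ominus> a) \<odot>\<^bsub>M\<^esub> s) \<in> N" using Nc(4) an(2) U by simp
      moreover have "inv (\<one> \<ominus> a) \<odot>\<^bsub>M\<^esub> ((\<one> \<ominus> a) \<odot>\<^bsub>M\<^esub> s) = s"
        using U ac sc by (simp flip: M.smult_assoc1)
      ultimately have "s \<in> N" by simp
      then have "S \<subseteq> N" using SN by blast
      then have "carrier M \<subseteq> N"
        using hull_minimal[of S N "\<lambda>N. submodule N R M"] N less.prems(3)
        unfolding generated_submodule_def by blast
      then have "generated_submodule R M ?S = carrier M" using Nc(1) unfolding N_def by blast
      moreover have "card ?S < card S" using s less.prems(1) by (intro psubset_card_mono) auto
      ultimately show ?thesis using less.hyps[of ?S] less.prems(1,2) by auto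
    qed
  qed
  then show ?thesis using fg unfolding finitely_generated_module_def by blast
qed

section \<open>Tate's complex\<close>

text \<open>Seen from the coefficient at \<open>e_s\<close>, the Koszul part of Tate's differential
  fetches from \<open>s\<close> with an index added, and multiplication by \<open>z\<close> from
  \<open>s\<close> with an index removed. Toggling covers both.\<close>

definition toggle :: "nat set \<Rightarrow> nat \<Rightarrow> nat set"
  where "toggle s l = (if l \<in> s then s - {l} else insert l s)"

lemma toggle_simps:
  "toggle (toggle s l) l = s" "l \<noteq> m \<Longrightarrow> m \<in> toggle s l \<longleftrightarrow> m \<in> s" "l \<in> toggle s l \<longleftrightarrow> l \<notin> s"
  "toggle (toggle s l) m = toggle (toggle s m) l"
  by (auto simp: toggle_def)

lemma even_card_toggle:
  assumes "l < m"
  shows "even (card {i \<in> toggle s l. i < m}) \<longleftrightarrow> odd (card {i \<in> s. i < m})"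
proof (cases "l \<in> s")
  case True
  have "{i \<in> s. i < m} = insert l {i \<in> toggle s l. i < m}" using assms True by (auto simp: toggle_def)
  then have "card {i \<in> s. i < m} = Suc (card {i \<in> toggle s l. i < m})"
    using True by (simp add: toggle_def)
  then show ?thesis by simp
next
  case False
  have "{i \<in> toggle s l. i < m} = insert l {i \<in> s. i < m}" using assms False by (auto simp: toggle_def)
  then have "card {i \<in> toggle s l. i < m} = Suc (card {i \<in> s. i < m})" using False by simp
  then show ?thesis by simp
qed

lemma below_toggle: "m \<le> l \<Longrightarrow> {i \<in> toggle s l. i < m} = {i \<in> s. i < m}"
  by (auto simp: toggle_def)

text \<open>Tate's complex \<open>K\<langle>y\<rangle>\<close> with coefficients in \<open>Q\<close>: the Koszul complex \<open>K\<close> of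
  \<open>x\<^sub>0, \<dots>, x\<^sub>c\<^sub>-\<^sub>1\<close> with a divided power variable \<open>y\<close> of degree \<open>2\<close> and \<open>dy = z\<close>. A chain \<open>w\<close>
  has the coefficient \<open>w s j\<close> at the basis element \<open>e\<^sub>s y\<^bsup>(j)\<^esup>\<close>; the degree \<open>card s + 2 * j\<close> is
  left implicit.\<close>

definition tate_coeff :: "('a, 'r) ring_scheme \<Rightarrow> (nat \<Rightarrow> 'a) \<Rightarrow> (nat \<Rightarrow> 'a) \<Rightarrow> nat set \<Rightarrow> nat \<Rightarrow> 'a"
  where "tate_coeff R x z s l = (if even (card {i \<in> s. i < l}) then \<one>\<^bsub>R\<^esub> else \<ominus>\<^bsub>R\<^esub> \<one>\<^bsub>R\<^esub>) \<otimes>\<^bsub>R\<^esub>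
    (if l \<in> s then z l else x l)"

definition tate :: "('a, 'r) ring_scheme \<Rightarrow> (nat \<Rightarrow> 'a) \<Rightarrow> (nat \<Rightarrow> 'a) \<Rightarrow> nat \<Rightarrow>
    ('a, 'u, 's) module_scheme \<Rightarrow> (nat set \<Rightarrow> nat \<Rightarrow> 'u) \<Rightarrow> nat set \<Rightarrow> nat \<Rightarrow> 'u"
  where "tate R x z c Q w s j =
    (\<Oplus>\<^bsub>Q\<^esub>l\<in>{..<c}. tate_coeff R x z s l \<odot>\<^bsub>Q\<^esub> w (toggle s l) (if l \<in> s then Suc j else j))"

context cring
begin

lemma tate_coeff_closed [simp]:
  "x l \<in> carrier R \<Longrightarrow> z l \<in> carrier R \<Longrightarrow> tate_coeff R x z s l \<in> carrier R"
  by (simp add: tate_coeff_def)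

lemma tate_coeff_square:
  assumes "x l \<in> carrier R" "z l \<in> carrier R"
  shows "tate_coeff R x z s l \<otimes> tate_coeff R x z (toggle s l) l = z l \<otimes> x l"
  using assms by (simp add: tate_coeff_def below_toggle toggle_simps l_minus r_minus m_comm)

text \<open>Toggling the smaller index changes the sign at the larger one, but not
  conversely.\<close>

lemma tate_coeff_anticommute_less:
  assumes "x l \<in> carrier R" "z l \<in> carrier R" "x m \<in> carrier R" "z m \<in> carrier R" "l < m"
  shows "tate_coeff R x z s l \<otimes> tate_coeff R x z (toggle s l) m
    = \<ominus> (tate_coeff R x z s m \<otimes> tate_coeff R x z (toggle s m) l)"
proof -
  have "(if even (card {i \<in> toggle s l. i < m}) then \<one> else \<ominus> \<one>) = \<ominus> (if even (card {i \<in> s. i < m}) then \<one> else \<ominus> \<one>)"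
    using even_card_toggle[OF assms(5)] by auto
  moreover have "(\<sigma> \<otimes> p) \<otimes> ((\<ominus> \<tau>) \<otimes> q) = \<ominus> ((\<tau> \<otimes> q) \<otimes> (\<sigma> \<otimes> p))"
    if "\<sigma> \<in> carrier R" "\<tau> \<in> carrier R" "p \<in> carrier R" "q \<in> carrier R" for \<sigma> \<tau> p q
    using that by algebra
  ultimately show ?thesis
    using assms by (simp add: tate_coeff_def below_toggle[of l m] toggle_simps)
qed

lemma tate_coeff_anticommute:
  assumes "x l \<in> carrier R" "z l \<in> carrier R" "x m \<in> carrier R" "z m \<in> carrier R" "l \<noteq> m"
  shows "tate_coeff R x z s l \<otimes> tate_coeff R x z (toggle s l) m
    = \<ominus> (tate_coeff R x z s m \<otimes> tate_coeff R x z (toggle s m) l)"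
proof (cases "l < m")
  case True
  then show ?thesis using tate_coeff_anticommute_less assms by blast
next
  case False
  then have "m < l" using assms(5) by simp
  from tate_coeff_anticommute_less[OF assms(3,4,1,2) this] show ?thesis using assms by simp
qed

end

context module
begin

lemma tate_closed:
  assumes "\<And>l. l < c \<Longrightarrow> x l \<in> carrier R" "\<And>l. z l \<in> carrier R" "\<And>s j. w s j \<in> carrier M"
  shows "tate R x z c M w s j \<in> carrier M"
  unfolding tate_def using assms by (intro M.finsum_closed) auto

text \<open>Mixed terms cancel by anticommutation. Toggling the same index twice leaves
  \<open>z_l x_l\<close>, and these add up to zero because \<open>z\<close> is a relation.\<close>

lemma tate_tate:
  assumes x: "\<And>l. l < c \<Longrightarrow> x l \<in> carrier R" and z: "z \<in> relations R x c" and w: "\<And>s j. w s j \<in> carrier M"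
  shows "tate R x z c M (tate R x z c M w) s j = \<zero>\<^bsub>M\<^esub>"
proof -
  have zc: "z l \<in> carrier R" for l using z by (simp add: relations_def vectors_def)
  let ?C = "\<lambda>s l. tate_coeff R x z s l"
  let ?j = "\<lambda>s l j. if l \<in> s then Suc j else j"
  define f where "f l m = (?C s l \<otimes> ?C (toggle s l) m) \<odot>\<^bsub>M\<^esub>
    w (toggle (toggle s l) m) (?j (toggle s l) m (?j s l j))" for l m
  have "tate R x z c M (tate R x z c M w) s j = (\<Oplus>\<^bsub>M\<^esub>l\<in>{..<c}. \<Oplus>\<^bsub>M\<^esub>m\<in>{..<c}. f l m)"
    unfolding tate_def[of R x z c M "tate R x z c M w"]
  proof (rule M.finsum_cong')
    fix l assume l: "l \<in> {..<c}"
    have "?C s l \<odot>\<^bsub>M\<^esub> tate R x z c M w (toggle s l) (?j s l j)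
      = (\<Oplus>\<^bsub>M\<^esub>m\<in>{..<c}. ?C s l \<odot>\<^bsub>M\<^esub> (?C (toggle s l) m \<odot>\<^bsub>M\<^esub> w (toggle (toggle s l) m) (?j (toggle s l) m (?j s l j))))"
      unfolding tate_def using l x zc w by (intro finsum_smult_ldistr) auto
    also have "\<dots> = (\<Oplus>\<^bsub>M\<^esub>m\<in>{..<c}. f l m)"
      using l x zc w by (intro M.finsum_cong') (auto simp: f_def smult_assoc1)
    finally show "?C s l \<odot>\<^bsub>M\<^esub> tate R x z c M w (toggle s l) (?j s l j) = (\<Oplus>\<^bsub>M\<^esub>m\<in>{..<c}. f l m)" .
  next
    show "(\<lambda>l. \<Oplus>\<^bsub>M\<^esub>m\<in>{..<c}. f l m) \<in> {..<c} \<rightarrow> carrier M"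
      using x zc w by (auto simp: f_def intro!: M.finsum_closed)
  qed simp
  also have "\<dots> = (\<Oplus>\<^bsub>M\<^esub>l\<in>{..<c}. f l l)"
  proof (rule M.finsum_alternating)
    fix l m assume lm: "l < c" "m < c"
    show "f l m \<in> carrier M" using lm x zc w by (simp add: f_def)
    assume ne: "l \<noteq> m"
    have j: "?j (toggle s l) m (?j s l j) = ?j (toggle s m) l (?j s m j)"
      using ne by (simp add: toggle_simps)
    show "f l m = \<ominus>\<^bsub>M\<^esub> f m l"
      unfolding f_def j toggle_simps(4)[of s l m] tate_coeff_anticommute[OF x[OF lm(1)] zc x[OF lm(2)] zc ne]
      using lm x zc w by (intro smult_l_minus) auto
  qed
  also have "\<dots> = (\<Oplus>\<^bsub>M\<^esub>l\<in>{..<c}. (z l \<otimes> x l) \<odot>\<^bsub>M\<^esub> w s (Suc j))"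
    using x zc w by (intro M.finsum_cong') (auto simp: f_def tate_coeff_square toggle_simps)
  also have "\<dots> = (\<Oplus>l\<in>{..<c}. z l \<otimes> x l) \<odot>\<^bsub>M\<^esub> w s (Suc j)"
    using x zc w by (intro finsum_smult_rdistr[symmetric]) auto
  also have "(\<Oplus>l\<in>{..<c}. z l \<otimes> x l) = \<zero>" using z by (simp add: relations_def lin_def)
  finally show ?thesis using w by simp
qed

lemma tate_empty:
  assumes x: "\<And>l. l < c \<Longrightarrow> x l \<in> carrier R" and w: "\<And>s j. w s j \<in> carrier M"
  shows "tate R x z c M w {} j = (\<Oplus>\<^bsub>M\<^esub>l\<in>{..<c}. x l \<odot>\<^bsub>M\<^esub> w {l} j)"
  unfolding tate_def using x w by (intro M.finsum_cong') (auto simp: tate_coeff_def toggle_def)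

text \<open>The chain map to the periodic complex in odd degree: \<open>e_l y^(j)\<close> goes to
  the class of \<open>e_l\<close> modulo \<open>T\<close>, and basis elements with at least two
  factors \<open>e\<close> go to zero. The latter is compatible with the differential because
  \<open>T\<close> contains the Koszul boundaries.\<close>

lemma tate_singleton:
  assumes T: "vector_submodule R c T" "koszul_boundaries R x c \<subseteq> T"
    and x: "\<And>l. l < c \<Longrightarrow> x l \<in> carrier R" and z: "\<And>l. z l \<in> carrier R" and w: "\<And>s j. w s j \<in> carrier M"
  shows "(\<lambda>l. tate R x z c M w {l} j \<ominus>\<^bsub>M\<^esub> z l \<odot>\<^bsub>M\<^esub> w {} (Suc j)) \<in> tensor_image c T M"
proof -
  \<comment> \<open>The coefficients at pairs \<open>{l, m}\<close> as an alternating matrix, the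
    order of the indices deciding the sign.\<close>
  define \<beta> where "\<beta> l m = (if l = m then \<zero>\<^bsub>M\<^esub> else if m < l then w {l, m} j else \<ominus>\<^bsub>M\<^esub> w {l, m} j)" for l m
  have \<beta>: "\<beta> l m \<in> carrier M" "\<beta> l m = \<ominus>\<^bsub>M\<^esub> \<beta> m l" "\<beta> l l = \<zero>\<^bsub>M\<^esub>" for l m
  proof -
    show "\<beta> l m = \<ominus>\<^bsub>M\<^esub> \<beta> m l"
    proof (cases "l = m")
      case True
      then show ?thesis by (simp only: \<beta>_def M.neg_zero if_True simp_thms)
    qed (use w in \<open>auto simp: \<beta>_def insert_commute\<close>)
  qed (use w in \<open>auto simp: \<beta>_def\<close>)
  have "(\<lambda>l. \<Oplus>\<^bsub>M\<^esub>m\<in>{..<c}. x m \<odot>\<^bsub>M\<^esub> \<beta> l m) \<in> tensor_image c T M"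
    by (rule tensor_image_koszul[OF T x \<beta>])
  then show ?thesis
  proof (rule tensor_image_cong[OF T(1)])
    fix l assume l: "l < c"
    have zw: "z l \<odot>\<^bsub>M\<^esub> w {} (Suc j) \<in> carrier M" using z w by simp
    have xb: "x m \<odot>\<^bsub>M\<^esub> \<beta> l m \<in> carrier M" if "m < c" for m using x[OF that] \<beta>(1) by simp
    have "tate R x z c M w {l} j
      = (\<Oplus>\<^bsub>M\<^esub>m\<in>{..<c}. (if m = l then z l \<odot>\<^bsub>M\<^esub> w {} (Suc j) else \<zero>\<^bsub>M\<^esub>) \<oplus>\<^bsub>M\<^esub> x m \<odot>\<^bsub>M\<^esub> \<beta> l m)"
      unfolding tate_def
    proof (rule M.finsum_cong')
      fix m assume m: "m \<in> {..<c}"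
      have xm: "x m \<in> carrier R" using x m by simp
      consider "m = l" | "m < l" | "m > l" by linarith
      then show "tate_coeff R x z {l} m \<odot>\<^bsub>M\<^esub> w (toggle {l} m) (if m \<in> {l} then Suc j else j)
        = (if m = l then z l \<odot>\<^bsub>M\<^esub> w {} (Suc j) else \<zero>\<^bsub>M\<^esub>) \<oplus>\<^bsub>M\<^esub> x m \<odot>\<^bsub>M\<^esub> \<beta> l m"
      proof cases
        case 1
        have e: "{i. i = l \<and> i < l} = {}" by auto
        show ?thesis using 1 xm z w by (simp add: tate_coeff_def toggle_def \<beta>_def e)
      next
        case 2
        then have e: "{i. i = l \<and> i < m} = {}" by auto
        show ?thesis using 2 xm z w by (simp add: tate_coeff_def toggle_def \<beta>_def insert_commute e)
      next
        case 3
        then have e: "{i. i = l \<and> i < m} = {l}" by auto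
        show ?thesis using 3 xm z w
          by (simp add: tate_coeff_def toggle_def \<beta>_def insert_commute e l_minus smult_l_minus smult_r_minus)
      qed
    qed (use zw xb in auto)
    also have "\<dots> = (\<Oplus>\<^bsub>M\<^esub>m\<in>{..<c}. if m = l then z l \<odot>\<^bsub>M\<^esub> w {} (Suc j) else \<zero>\<^bsub>M\<^esub>) \<oplus>\<^bsub>M\<^esub> (\<Oplus>\<^bsub>M\<^esub>m\<in>{..<c}. x m \<odot>\<^bsub>M\<^esub> \<beta> l m)"
      using zw xb by (intro M.finsum_addf) auto
    also have "(\<Oplus>\<^bsub>M\<^esub>m\<in>{..<c}. if m = l then z l \<odot>\<^bsub>M\<^esub> w {} (Suc j) else \<zero>\<^bsub>M\<^esub>) = z l \<odot>\<^bsub>M\<^esub> w {} (Suc j)"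
      using M.finsum_single[of "{..<c}" l "\<lambda>m. if m = l then z l \<odot>\<^bsub>M\<^esub> w {} (Suc j) else \<zero>\<^bsub>M\<^esub>"] l zw by simp
    finally have "tate R x z c M w {l} j = z l \<odot>\<^bsub>M\<^esub> w {} (Suc j) \<oplus>\<^bsub>M\<^esub> (\<Oplus>\<^bsub>M\<^esub>m\<in>{..<c}. x m \<odot>\<^bsub>M\<^esub> \<beta> l m)" .
    moreover have "(\<Oplus>\<^bsub>M\<^esub>m\<in>{..<c}. x m \<odot>\<^bsub>M\<^esub> \<beta> l m) \<in> carrier M" using xb by (intro M.finsum_closed) auto
    ultimately show "tate R x z c M w {l} j \<ominus>\<^bsub>M\<^esub> z l \<odot>\<^bsub>M\<^esub> w {} (Suc j) = (\<Oplus>\<^bsub>M\<^esub>m\<in>{..<c}. x m \<odot>\<^bsub>M\<^esub> \<beta> l m)"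
      using zw by (simp add: a_minus_def M.a_ac M.r_neg M.r_neg1 M.r_neg2)
  qed
qed

end

lemma tate_hom:
  assumes "module R M" "module R N" "f \<in> module_homs R M N"
    and "\<And>l. l < c \<Longrightarrow> x l \<in> carrier R" "\<And>l. z l \<in> carrier R" "\<And>s j. w s j \<in> carrier M"
  shows "f (tate R x z c M w s j) = tate R x z c N (\<lambda>s j. f (w s j)) s j"
proof -
  interpret M: module R M by fact
  interpret N: module R N by fact
  note fD = module_homsD[OF assms(3)]
  have c: "tate_coeff R x z s l \<in> carrier R" if "l < c" for l using assms(4)[OF that] assms(5) by simp
  have "f (tate R x z c M w s j)
    = (\<Oplus>\<^bsub>N\<^esub>l\<in>{..<c}. f (tate_coeff R x z s l \<odot>\<^bsub>M\<^esub> w (toggle s l) (if l \<in> s then Suc j else j)))"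
    unfolding tate_def using c assms(6) by (intro module_homs_finsum[OF assms(1-3)]) auto
  also have "\<dots> = tate R x z c N (\<lambda>s j. f (w s j)) s j"
    unfolding tate_def using c assms(6) fD(1,3) by (intro N.M.finsum_cong') auto
  finally show ?thesis .
qed

section \<open>Comparison with the periodic complex\<close>

lemma linear_image_hom:
  fixes c :: nat
  assumes "module R M" "module R N" "f \<in> module_homs R M N"
    and x: "\<And>l. l < c \<Longrightarrow> x l \<in> carrier R" and v: "\<And>l. v l \<in> carrier M"
  shows "f (\<Oplus>\<^bsub>M\<^esub>l\<in>{..<c}. x l \<odot>\<^bsub>M\<^esub> v l) = (\<Oplus>\<^bsub>N\<^esub>l\<in>{..<c}. x l \<odot>\<^bsub>N\<^esub> f (v l))"
proof -
  interpret M: module R M by fact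
  interpret N: module R N by fact
  note fD = module_homsD[OF assms(3)]
  have "f (\<Oplus>\<^bsub>M\<^esub>l\<in>{..<c}. x l \<odot>\<^bsub>M\<^esub> v l) = (\<Oplus>\<^bsub>N\<^esub>l\<in>{..<c}. f (x l \<odot>\<^bsub>M\<^esub> v l))"
    using x v by (intro module_homs_finsum[OF assms(1-3)]) auto
  also have "\<dots> = (\<Oplus>\<^bsub>N\<^esub>l\<in>{..<c}. x l \<odot>\<^bsub>N\<^esub> f (v l))"
    using x v fD(1,3) by (intro N.M.finsum_cong') auto
  finally show ?thesis .
qed

text \<open>\<open>ZT\<close> and \<open>Tz\<close> are the exactness of the periodic complex at its
  two kinds of terms: modulo \<open>T\<close> every relation is a multiple of \<open>z\<close>, and
  only elements of \<open>\<mm>\<close> can annihilate the class of \<open>z\<close>.\<close>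

locale singular_data = local_noetherian_ring +
  fixes x z :: "nat \<Rightarrow> 'a" and c :: nat and T :: "(nat \<Rightarrow> 'a) set"
  assumes x: "\<And>l. l < c \<Longrightarrow> x l \<in> carrier R" and span: "span_ideal R x c = max_ideal R"
    and z: "z \<in> relations R x c"
    and T: "vector_submodule R c T" "koszul_boundaries R x c \<subseteq> T"
    and ZT: "\<And>q. q \<in> relations R x c \<Longrightarrow> \<exists>r \<in> carrier R. (\<lambda>l. q l \<ominus> r \<otimes> z l) \<in> T"
    and Tz: "\<And>a. a \<in> carrier R \<Longrightarrow> (\<lambda>l. a \<otimes> z l) \<in> T \<Longrightarrow> a \<in> max_ideal R"
begin

lemma zv: "z \<in> vectors R c" using z by (simp add: relations_def)

lemma zc: "z l \<in> carrier R" using zv by (simp add: vectors_def)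

text \<open>One step of the comparison of the double complexes, in even and in odd total degree. Here
  \<open>w\<close> and \<open>w'\<close> are consecutive components of a cycle of the tensor product of Tate's complex with
  \<open>P'' \<rightarrow> P' \<rightarrow> P\<close>.\<close>

lemma even_step:
  fixes P :: "('a, ('a, 'e) resolution_elem) module"
  assumes P: "projective_module R P" and P': "module R P'"
    and d: "d \<in> module_homs R P' P" and d': "d' \<in> module_homs R P'' P'"
    and dd: "\<And>v. v \<in> carrier P'' \<Longrightarrow> d (d' v) = \<zero>\<^bsub>P\<^esub>"
    and w: "\<And>s j. w s j \<in> carrier P" "\<And>s j. w' s j \<in> carrier P'" "\<And>s j. d (w' s j) = tate R x z c P w s j"
    and v: "\<And>l. v l \<in> carrier P''" and r: "r \<in> carrier P'"
    and odd: "(\<lambda>l. (w' {l} j \<ominus>\<^bsub>P'\<^esub> d' (v l)) \<ominus>\<^bsub>P'\<^esub> z l \<odot>\<^bsub>P'\<^esub> r) \<in> tensor_image c T P'"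
  shows "\<exists>e \<in> linear_image x c P. w {} (Suc j) = d r \<oplus>\<^bsub>P\<^esub> e"
proof -
  have mP: "module R P" using P by (simp add: projective_module_def)
  interpret P: module R P by (rule mP)
  interpret P': module R P' by (rule P')
  note dD = module_homsD[OF d] and d0 = module_homs_zero_neg[OF P' mP d]
  have d'v: "d' (v l) \<in> carrier P'" for l using module_homsD(1)[OF d' v] .
  have zr: "z l \<odot>\<^bsub>P'\<^esub> r \<in> carrier P'" for l using zc r by simp
  have zdr: "z l \<odot>\<^bsub>P\<^esub> d r \<in> carrier P" for l using zc dD(1)[OF r] by simp
  have tc: "tate R x z c P w s j \<in> carrier P" for s j using x zc w(1) by (intro P.tate_closed)
  \<comment> \<open>Applying \<open>d\<close> to the odd statement removes \<open>d' (v l)\<close>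
    and turns \<open>w'\<close> into Tate's differential of \<open>w\<close>. Comparison with
    \<open>tate_singleton\<close> leaves \<open>z\<close> times \<open>w {} (Suc j) - d r\<close>,
    to which exactness applies.\<close>
  have "(\<lambda>l. d ((w' {l} j \<ominus>\<^bsub>P'\<^esub> d' (v l)) \<ominus>\<^bsub>P'\<^esub> z l \<odot>\<^bsub>P'\<^esub> r)) \<in> tensor_image c T P"
    by (rule tensor_image_hom[OF P' mP d T(1) odd])
  moreover have "d ((w' {l} j \<ominus>\<^bsub>P'\<^esub> d' (v l)) \<ominus>\<^bsub>P'\<^esub> z l \<odot>\<^bsub>P'\<^esub> r) = tate R x z c P w {l} j \<ominus>\<^bsub>P\<^esub> z l \<odot>\<^bsub>P\<^esub> d r" for l
  proof -
    have "d ((w' {l} j \<ominus>\<^bsub>P'\<^esub> d' (v l)) \<ominus>\<^bsub>P'\<^esub> z l \<odot>\<^bsub>P'\<^esub> r) = (d (w' {l} j) \<ominus>\<^bsub>P\<^esub> d (d' (v l))) \<ominus>\<^bsub>P\<^esub> d (z l \<odot>\<^bsub>P'\<^esub> r)"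
      using d0(3) w(2) d'v zr by simp
    then show ?thesis
      by (simp only: w(3) dd[OF v] dD(3)[OF zc r] P.M.minus_zero_right[OF tc])
  qed
  ultimately have 1: "(\<lambda>l. tate R x z c P w {l} j \<ominus>\<^bsub>P\<^esub> z l \<odot>\<^bsub>P\<^esub> d r) \<in> tensor_image c T P" by simp
  have 2: "(\<lambda>l. tate R x z c P w {l} j \<ominus>\<^bsub>P\<^esub> z l \<odot>\<^bsub>P\<^esub> w {} (Suc j)) \<in> tensor_image c T P"
    using T x zc w(1) by (intro P.tate_singleton)
  define q where "q = w {} (Suc j) \<ominus>\<^bsub>P\<^esub> d r"
  have q: "q \<in> carrier P" using w(1) dD(1)[OF r] by (simp add: q_def)
  have "(\<lambda>l. (tate R x z c P w {l} j \<ominus>\<^bsub>P\<^esub> z l \<odot>\<^bsub>P\<^esub> d r) \<ominus>\<^bsub>P\<^esub> (tate R x z c P w {l} j \<ominus>\<^bsub>P\<^esub> z l \<odot>\<^bsub>P\<^esub> w {} (Suc j)))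
      \<in> tensor_image c T P"
    by (rule P.tensor_image_minus[OF T(1) 1 2])
  then have "(\<lambda>l. z l \<odot>\<^bsub>P\<^esub> q) \<in> tensor_image c T P"
  proof (rule P.tensor_image_cong[OF T(1)])
    fix l
    have zw: "z l \<odot>\<^bsub>P\<^esub> w {} (Suc j) \<in> carrier P" using zc w(1) by simp
    have "z l \<odot>\<^bsub>P\<^esub> q = z l \<odot>\<^bsub>P\<^esub> w {} (Suc j) \<ominus>\<^bsub>P\<^esub> z l \<odot>\<^bsub>P\<^esub> d r"
      unfolding q_def a_minus_def using zc w(1) dD(1)[OF r] by (simp add: P.smult_r_distr P.smult_r_minus)
    also have "\<dots> = (tate R x z c P w {l} j \<ominus>\<^bsub>P\<^esub> z l \<odot>\<^bsub>P\<^esub> d r) \<ominus>\<^bsub>P\<^esub> (tate R x z c P w {l} j \<ominus>\<^bsub>P\<^esub> z l \<odot>\<^bsub>P\<^esub> w {} (Suc j))"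
      using zw zdr[of l] tc[of "{l}" j]
      by (simp add: a_minus_def P.M.minus_add P.M.a_ac P.M.r_neg P.M.r_neg1 P.M.r_neg2)
    finally show "z l \<odot>\<^bsub>P\<^esub> q = (tate R x z c P w {l} j \<ominus>\<^bsub>P\<^esub> z l \<odot>\<^bsub>P\<^esub> d r) \<ominus>\<^bsub>P\<^esub> (tate R x z c P w {l} j \<ominus>\<^bsub>P\<^esub> z l \<odot>\<^bsub>P\<^esub> w {} (Suc j))" .
  qed
  then have "q \<in> linear_image x c P"
    using projective_exact_even[OF P T(1) x zv _ q] Tz span by simp
  moreover have "w {} (Suc j) = d r \<oplus>\<^bsub>P\<^esub> q"
    unfolding q_def using w(1)[of "{}" "Suc j"] dD(1)[OF r]
    by (simp add: a_minus_def P.M.a_ac P.M.r_neg P.M.r_neg1 P.M.r_neg2)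
  ultimately show ?thesis by blast
qed

lemma odd_step:
  fixes P :: "('a, ('a, 'e) resolution_elem) module"
  assumes P: "projective_module R P" and P': "module R P'"
    and d: "d \<in> module_homs R P' P" and d': "d' \<in> module_homs R P'' P'"
    and dd: "\<And>v. v \<in> carrier P'' \<Longrightarrow> d (d' v) = \<zero>\<^bsub>P\<^esub>"
    and w: "\<And>s j. w s j \<in> carrier P" "\<And>s j. w' s j \<in> carrier P'" "\<And>s j. d (w' s j) = tate R x z c P w s j"
    and v: "v \<in> carrier P''" and even: "e \<in> linear_image x c P'" "w' {} j = d' v \<oplus>\<^bsub>P'\<^esub> e"
  shows "\<exists>v. (\<forall>l. v l \<in> carrier P') \<and> (\<exists>r \<in> carrier P.
    (\<lambda>l. (w {l} j \<ominus>\<^bsub>P\<^esub> d (v l)) \<ominus>\<^bsub>P\<^esub> z l \<odot>\<^bsub>P\<^esub> r) \<in> tensor_image c T P)"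
proof -
  have mP: "module R P" using P by (simp add: projective_module_def)
  interpret P: module R P by (rule mP)
  interpret P': module R P' by (rule P')
  note dD = module_homsD[OF d]
  obtain u where u: "\<And>l. u l \<in> carrier P'" "e = (\<Oplus>\<^bsub>P'\<^esub>l\<in>{..<c}. x l \<odot>\<^bsub>P'\<^esub> u l)"
    using even(1) unfolding linear_image_def by blast
  have ec: "e \<in> carrier P'" unfolding u(2) using x u(1) by (intro P'.M.finsum_closed) auto
  \<comment> \<open>With \<open>e = \<Sum> x_l u_l\<close>, the cycle condition says that
    \<open>d e\<close> equals \<open>\<Sum> x_l w {l} j\<close>. So the vector with entries
    \<open>w {l} j - d (u l)\<close> is killed by \<open>x\<close>, and exactness provides
    \<open>r\<close>.\<close>
  have "(\<Oplus>\<^bsub>P\<^esub>l\<in>{..<c}. x l \<odot>\<^bsub>P\<^esub> (w {l} j \<ominus>\<^bsub>P\<^esub> d (u l)))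
    = (\<Oplus>\<^bsub>P\<^esub>l\<in>{..<c}. x l \<odot>\<^bsub>P\<^esub> w {l} j \<oplus>\<^bsub>P\<^esub> \<ominus>\<^bsub>P\<^esub> (x l \<odot>\<^bsub>P\<^esub> d (u l)))"
    using x w(1) dD(1)[OF u(1)]
    by (intro P.M.finsum_cong') (auto simp: a_minus_def P.smult_r_distr P.smult_r_minus)
  also have "\<dots> = (\<Oplus>\<^bsub>P\<^esub>l\<in>{..<c}. x l \<odot>\<^bsub>P\<^esub> w {l} j) \<oplus>\<^bsub>P\<^esub> (\<Oplus>\<^bsub>P\<^esub>l\<in>{..<c}. \<ominus>\<^bsub>P\<^esub> (x l \<odot>\<^bsub>P\<^esub> d (u l)))"
    using x w(1) dD(1)[OF u(1)] by (intro P.M.finsum_addf) auto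
  also have "(\<Oplus>\<^bsub>P\<^esub>l\<in>{..<c}. \<ominus>\<^bsub>P\<^esub> (x l \<odot>\<^bsub>P\<^esub> d (u l))) = \<ominus>\<^bsub>P\<^esub> (\<Oplus>\<^bsub>P\<^esub>l\<in>{..<c}. x l \<odot>\<^bsub>P\<^esub> d (u l))"
    using x dD(1)[OF u(1)] by (intro P.M.finsum_neg) auto
  also have "(\<Oplus>\<^bsub>P\<^esub>l\<in>{..<c}. x l \<odot>\<^bsub>P\<^esub> d (u l)) = d e"
    unfolding u(2) using x u(1) by (intro linear_image_hom[OF P' mP d, symmetric])
  also have "(\<Oplus>\<^bsub>P\<^esub>l\<in>{..<c}. x l \<odot>\<^bsub>P\<^esub> w {l} j) = d (w' {} j)"
    unfolding w(3) using x w(1) by (intro P.tate_empty[symmetric])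
  also have "\<dots> = d e"
    unfolding even(2) using dD(2)[OF module_homsD(1)[OF d' v] ec] dd[OF v] dD(1)[OF ec] by simp
  also have "d e \<oplus>\<^bsub>P\<^esub> \<ominus>\<^bsub>P\<^esub> d e = \<zero>\<^bsub>P\<^esub>" using dD(1)[OF ec] by (rule P.M.r_neg)
  finally have zero: "(\<Oplus>\<^bsub>P\<^esub>l\<in>{..<c}. x l \<odot>\<^bsub>P\<^esub> (w {l} j \<ominus>\<^bsub>P\<^esub> d (u l))) = \<zero>\<^bsub>P\<^esub>" .
  have "\<exists>r \<in> carrier P. (\<lambda>l. (w {l} j \<ominus>\<^bsub>P\<^esub> d (u l)) \<ominus>\<^bsub>P\<^esub> z l \<odot>\<^bsub>P\<^esub> r) \<in> tensor_image c T P"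
  proof (rule projective_exact_odd[OF P T(1) x zv ZT _ zero])
    show "w {l} j \<ominus>\<^bsub>P\<^esub> d (u l) \<in> carrier P" for l using w(1) dD(1)[OF u(1)] by simp
  qed
  then show ?thesis using u(1) by blast
qed

text \<open>Every \<open>u \<in> M\<close> gives a cycle \<open>y\<^bsup>(j)\<^esup> \<otimes> u\<close>, since \<open>z\<close> annihilates \<open>M\<close>. Lifting it along the
  finite resolution and descending again through the periodic complex shows that it bounds,
  so \<open>u \<in> \<mm>M\<close>.\<close>

lemma finite_resolution_linear_image:
  fixes M :: "('a, 'e, 's) module_scheme" and P :: "nat \<Rightarrow> ('a, ('a, 'e) resolution_elem) module"
  assumes M: "module R M" and res: "projective_resolution R M P d \<epsilon>"
    and finite: "\<And>i. i > p \<Longrightarrow> carrier (P i) = {\<zero>\<^bsub>P i\<^esub>}"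
    and ann: "\<And>l u. u \<in> carrier M \<Longrightarrow> z l \<odot>\<^bsub>M\<^esub> u = \<zero>\<^bsub>M\<^esub>"
  shows "carrier M \<subseteq> linear_image x c M"
proof
  fix u assume u: "u \<in> carrier M"
  interpret M: module R M by fact
  have proj: "projective_module R (P i)" and d: "d i \<in> module_homs R (P (Suc i)) (P i)"
    and \<epsilon>: "\<epsilon> \<in> module_homs R (P 0) M" "\<epsilon> ` carrier (P 0) = carrier M"
    and ker0: "d 0 ` carrier (P 1) = a_kernel (P 0) M \<epsilon>"
    and ker: "d (Suc i) ` carrier (P (Suc (Suc i))) = a_kernel (P (Suc i)) (P i) (d i)" for i
    using res by (simp_all add: projective_resolution_def)
  have mP: "module R (P i)" for i using proj by (simp add: projective_module_def)
  have dc: "v \<in> carrier (P (Suc i)) \<Longrightarrow> d i v \<in> carrier (P i)" for i v using module_homsD(1)[OF d] .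
  have dd: "d i (d (Suc i) v) = \<zero>\<^bsub>P i\<^esub>" if "v \<in> carrier (P (Suc (Suc i)))" for i v
    using ker[of i] that by (auto simp: a_kernel_def')
  have \<epsilon>d: "\<epsilon> (d 0 v) = \<zero>\<^bsub>M\<^esub>" if "v \<in> carrier (P 1)" for v
    using ker0 that by (auto simp: a_kernel_def')
  note \<epsilon>D = module_homsD[OF \<epsilon>(1)] and \<epsilon>0 = module_homs_zero_neg(1)[OF mP M \<epsilon>(1)]
  obtain u0 where u0: "u0 \<in> carrier (P 0)" "\<epsilon> u0 = u" using \<epsilon>(2) u by (metis imageE)
  \<comment> \<open>The descent raises \<open>j\<close> by one while going down two places in the
    resolution, from \<open>j = 0\<close> in place \<open>2 * j0\<close> to \<open>j = j0\<close> in
    place \<open>0\<close>. This choice puts the start beyond \<open>p\<close>, where the resolution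
    is zero.\<close>
  define j0 where "j0 = Suc p"
  define w0 where "w0 s j = (if s = {} \<and> j = j0 then u0 else \<zero>\<^bsub>P 0\<^esub>)" for s :: "nat set" and j
  let ?D = "\<lambda>i. tate R x z c (P i)"
  have zeroP: "\<zero>\<^bsub>P i\<^esub> \<in> carrier (P i)" for i
  proof -
    interpret Pi: module R "P i" by (rule mP)
    show ?thesis by simp
  qed
  have w0c: "w0 s j \<in> carrier (P 0)" for s j using u0(1) zeroP by (simp add: w0_def)
  have tc: "?D i w s j \<in> carrier (P i)" if "\<And>s j. w s j \<in> carrier (P i)" for i w s j
    using module.tate_closed[OF mP, of c x z w i s j] x zc that by blast
  \<comment> \<open>The invariant of the lifting: Tate's differential of a component can be lifted
    through \<open>d i\<close>. The clause for \<open>i = 0\<close> pins the first component to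
    \<open>w0\<close> during the dependent choice.\<close>
  define Q where "Q i w \<longleftrightarrow> (\<forall>s j. w s j \<in> carrier (P i)) \<and>
    (\<forall>s j. ?D i w s j \<in> d i ` carrier (P (Suc i))) \<and> (i = 0 \<longrightarrow> w = w0)" for i w
  have "Q 0 w0"
  proof -
    \<comment> \<open>Only terms with \<open>s = {l}\<close> could survive, and these carry the
      factor \<open>z l\<close>, which annihilates \<open>u\<close>.\<close>
    have "\<epsilon> (?D 0 w0 s j) = \<zero>\<^bsub>M\<^esub>" for s j
    proof -
      have "\<epsilon> (?D 0 w0 s j) = tate R x z c M (\<lambda>s j. \<epsilon> (w0 s j)) s j"
        using x zc w0c by (intro tate_hom[OF mP M \<epsilon>(1)])
      also have "\<dots> = (\<Oplus>\<^bsub>M\<^esub>l\<in>{..<c}. \<zero>\<^bsub>M\<^esub>)"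
        unfolding tate_def
      proof (rule M.M.finsum_cong')
        fix l assume l: "l \<in> {..<c}"
        have tl: "tate_coeff R x z s l \<in> carrier R" using x zc l by simp
        show "tate_coeff R x z s l \<odot>\<^bsub>M\<^esub> \<epsilon> (w0 (toggle s l) (if l \<in> s then Suc j else j)) = \<zero>\<^bsub>M\<^esub>"
        proof (cases "toggle s l = {} \<and> (if l \<in> s then Suc j else j) = j0")
          case True
          then have "l \<in> s" by (auto simp: toggle_def split: if_splits)
          then have "tate_coeff R x z s l \<odot>\<^bsub>M\<^esub> u
            = (if even (card {i \<in> s. i < l}) then \<one> else \<ominus> \<one>) \<odot>\<^bsub>M\<^esub> (z l \<odot>\<^bsub>M\<^esub> u)"
            using zc u M.smult_assoc1[of "if even (card {i \<in> s. i < l}) then \<one> else \<ominus> \<one>" "z l" u]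
            by (simp add: tate_coeff_def)
          also have "\<dots> = \<zero>\<^bsub>M\<^esub>" unfolding ann[OF u] by simp
          finally show ?thesis using True u0(2) by (simp add: w0_def)
        next
          case False
          then have "w0 (toggle s l) (if l \<in> s then Suc j else j) = \<zero>\<^bsub>P 0\<^esub>" unfolding w0_def by (rule if_not_P)
          then show ?thesis using \<epsilon>0 tl by simp
        qed
      qed auto
      also have "\<dots> = \<zero>\<^bsub>M\<^esub>" by simp
      finally show ?thesis .
    qed
    then have "?D 0 w0 s j \<in> d 0 ` carrier (P (Suc 0))" for s j
      using ker0 tc[of w0 0 s j] w0c by (simp add: a_kernel_def')
    then show ?thesis using w0c by (simp add: Q_def)
  qed
  moreover have "\<exists>w'. Q (Suc i) w' \<and> (\<forall>s j. d i (w' s j) = ?D i w s j)" if "Q i w" for i w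
  proof -
    have wc: "w s j \<in> carrier (P i)" and im: "?D i w s j \<in> d i ` carrier (P (Suc i))" for s j
      using that by (auto simp: Q_def)
    have "\<forall>s j. \<exists>v. v \<in> carrier (P (Suc i)) \<and> d i v = ?D i w s j" using im by (metis imageE)
    then obtain w' where w': "\<And>s j. w' s j \<in> carrier (P (Suc i))" "\<And>s j. d i (w' s j) = ?D i w s j" by metis
    have "?D (Suc i) w' s j \<in> d (Suc i) ` carrier (P (Suc (Suc i)))" for s j
    proof -
      have "d i (?D (Suc i) w' s j) = ?D i (\<lambda>s j. d i (w' s j)) s j"
        using x zc w'(1) by (intro tate_hom[OF mP mP d])
      also have "\<dots> = ?D i (?D i w) s j" by (simp add: w'(2))
      also have "\<dots> = \<zero>\<^bsub>P i\<^esub>" using x z wc by (intro module.tate_tate[OF mP])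
      finally show ?thesis using ker[of i] tc[of w' "Suc i" s j] w'(1) by (simp add: a_kernel_def')
    qed
    then show ?thesis using w' by (intro exI[of _ w']) (simp add: Q_def)
  qed
  ultimately obtain W where W: "\<And>i. Q i (W i)" "\<And>i s j. d i (W (Suc i) s j) = ?D i (W i) s j"
    using dependent_nat_choice[of Q "\<lambda>i w w'. \<forall>s j. d i (w' s j) = ?D i w s j"] by blast
  have Wc: "W i s j \<in> carrier (P i)" for i s j using W(1)[of i] by (simp add: Q_def)
  have W0: "W 0 = w0" using W(1)[of 0] by (simp add: Q_def)
  \<comment> \<open>\<open>W i {} j\<close> is a boundary, up to the images of the two incoming
    maps: \<open>d i\<close> from the resolution and \<open>x\<close> from the periodic
    complex.\<close>
  define E where "E i j \<longleftrightarrow> (\<exists>v \<in> carrier (P (Suc i)). \<exists>e \<in> linear_image x c (P i). W i {} j = d i v \<oplus>\<^bsub>P i\<^esub> e)" for i j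
  have step: "E i (Suc j)" if E: "E (Suc (Suc i)) j" for i j
  proof -
    obtain v e where ve: "v \<in> carrier (P (Suc (Suc (Suc i))))" "e \<in> linear_image x c (P (Suc (Suc i)))"
      "W (Suc (Suc i)) {} j = d (Suc (Suc i)) v \<oplus>\<^bsub>P (Suc (Suc i))\<^esub> e" using E unfolding E_def by blast
    have "\<exists>v. (\<forall>l. v l \<in> carrier (P (Suc (Suc i)))) \<and> (\<exists>r \<in> carrier (P (Suc i)).
      (\<lambda>l. (W (Suc i) {l} j \<ominus>\<^bsub>P (Suc i)\<^esub> d (Suc i) (v l)) \<ominus>\<^bsub>P (Suc i)\<^esub> z l \<odot>\<^bsub>P (Suc i)\<^esub> r)
        \<in> tensor_image c T (P (Suc i)))"
      by (rule odd_step[where w = "W (Suc i)" and w' = "W (Suc (Suc i))" and d = "d (Suc i)"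
            and d' = "d (Suc (Suc i))" and v = v and e = e and P'' = "P (Suc (Suc (Suc i)))"])
        (fact proj mP d ve | simp add: dd Wc W(2))+
    then obtain v' r where v': "\<And>l. v' l \<in> carrier (P (Suc (Suc i)))" and r: "r \<in> carrier (P (Suc i))"
      and odd: "(\<lambda>l. (W (Suc i) {l} j \<ominus>\<^bsub>P (Suc i)\<^esub> d (Suc i) (v' l)) \<ominus>\<^bsub>P (Suc i)\<^esub> z l \<odot>\<^bsub>P (Suc i)\<^esub> r)
        \<in> tensor_image c T (P (Suc i))" by blast
    have "\<exists>e \<in> linear_image x c (P i). W i {} (Suc j) = d i r \<oplus>\<^bsub>P i\<^esub> e"
      by (rule even_step[where w = "W i" and w' = "W (Suc i)" and d = "d i" and r = r
            and d' = "d (Suc i)" and v = v' and P' = "P (Suc i)" and P'' = "P (Suc (Suc i))"])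
        (fact proj mP d v' r odd | simp add: dd Wc W(2))+
    then show ?thesis unfolding E_def using r by blast
  qed
  have "E (2 * (j0 - m)) m" if "m \<le> j0" for m
    using that
  proof (induction m)
    case 0
    define k where "k = 2 * (j0 - 0)"
    have "k > p" by (simp add: k_def j0_def)
    interpret Pk: module R "P k" by (rule mP)
    have "W k {} 0 = \<zero>\<^bsub>P k\<^esub>" using Wc[of k "{}" 0] finite[OF \<open>k > p\<close>] by blast
    moreover have "d k \<zero>\<^bsub>P (Suc k)\<^esub> = \<zero>\<^bsub>P k\<^esub>"
      by (rule module_homs_zero_neg(1)[OF mP mP d])
    ultimately have "W k {} 0 = d k \<zero>\<^bsub>P (Suc k)\<^esub> \<oplus>\<^bsub>P k\<^esub> \<zero>\<^bsub>P k\<^esub>" by simp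
    moreover have "\<zero>\<^bsub>P k\<^esub> \<in> linear_image x c (P k)"
      by (rule Pk.linear_image_closed(2)) (rule x)
    ultimately show ?case unfolding E_def k_def[symmetric] using zeroP by blast
  next
    case (Suc m)
    have "2 * (j0 - m) = Suc (Suc (2 * (j0 - Suc m)))" using Suc.prems by simp
    then show ?case using Suc step by simp
  qed
  then have "E 0 j0" by fastforce
  \<comment> \<open>Now \<open>u0\<close> lies in the image of \<open>d 0\<close> up to an element
    of \<open>\<mm> P_0\<close>; \<open>\<epsilon>\<close> kills the former and carries the latter
    into \<open>\<mm> M\<close>.\<close>
  then obtain v e where v: "v \<in> carrier (P 1)" and e: "e \<in> linear_image x c (P 0)" and eq: "u0 = d 0 v \<oplus>\<^bsub>P 0\<^esub> e"
    unfolding E_def W0 w0_def by auto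
  obtain y where y: "\<And>l. y l \<in> carrier (P 0)" "e = (\<Oplus>\<^bsub>P 0\<^esub>l\<in>{..<c}. x l \<odot>\<^bsub>P 0\<^esub> y l)"
    using e unfolding linear_image_def by blast
  interpret P0: module R "P 0" by (rule mP)
  have ec: "e \<in> carrier (P 0)" unfolding y(2) using x y(1) by (intro P0.M.finsum_closed) auto
  have "u = \<epsilon> (d 0 v) \<oplus>\<^bsub>M\<^esub> \<epsilon> e" using \<epsilon>D(2)[OF dc ec] v u0(2) eq by simp
  also have "\<dots> = \<epsilon> e" using \<epsilon>d[OF v] \<epsilon>D(1)[OF ec] by simp
  also have "\<dots> = (\<Oplus>\<^bsub>M\<^esub>l\<in>{..<c}. x l \<odot>\<^bsub>M\<^esub> \<epsilon> (y l))"
    unfolding y(2) using x y(1) by (intro linear_image_hom[OF mP M \<epsilon>(1)])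
  finally show "u \<in> linear_image x c M"
    unfolding linear_image_def using \<epsilon>D(1)[OF y(1)] by (intro CollectI exI[of _ "\<lambda>l. \<epsilon> (y l)"]) simp
qed

end

section \<open>The lower bound for the Loewy length\<close>

theorem theorem1p1:
  fixes A :: "('a, 'r) ring_scheme" and M :: "('a, 'b, 's) module_scheme"
  assumes "gorenstein_local_ring A"
    and "module A M"
    and "carrier M \<noteq> {\<zero>\<^bsub>M\<^esub>}"
    and "finitely_generated_module A M"
    and "projective_dimension A M < \<infinity>"
  shows "loewy_length A M \<ge> enat (local_ring_order A)"
proof (rule ccontr)
  assume "\<not> ?thesis"
  then have "loewy_length A M < enat (local_ring_order A)" by simp
  then obtain i where i: "i < local_ring_order A"
    and zero: "ideal_smult A (max_ideal_power A i) M = {\<zero>\<^bsub>M\<^esub>}"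
    unfolding loewy_length_def Inf_less_iff by auto
  interpret A: local_noetherian_ring A using assms(1) by (rule gorenstein_local_ring.axioms)
  interpret M: module A M by fact
  have ann: "a \<odot>\<^bsub>M\<^esub> u = \<zero>\<^bsub>M\<^esub>" if "a \<in> max_ideal_power A i" "u \<in> carrier M" for a u
  proof -
    have "a \<odot>\<^bsub>M\<^esub> u \<in> ideal_smult A (max_ideal_power A i) M"
      unfolding ideal_smult_def generated_submodule_def by (rule subsetD[OF hull_subset]) (use that in blast)
    then show ?thesis using zero by simp
  qed
  show False
  proof (cases "regular_local_ring A")
    case True
    \<comment> \<open>A regular ring has order 1, so \<open>M\<close> would be annihilated by the
      zeroth power of \<open>\<mm>\<close>, which contains \<open>1\<close>.\<close>
    then have "i = 0" using i by (simp add: local_ring_order_def)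
    then have "\<one>\<^bsub>A\<^esub> \<odot>\<^bsub>M\<^esub> u = \<zero>\<^bsub>M\<^esub>" if "u \<in> carrier M" for u
      using ann that A.max_ideal_power_0 by simp
    then have "carrier M = {\<zero>\<^bsub>M\<^esub>}" using M.M.zero_closed by auto
    then show False using assms(3) by simp
  next
    case False
    define c where "c = embedding_dimension A"
    obtain x where gens: "minimal_generators A x c" using A.exists_minimal_generators unfolding c_def by blast
    have x: "x l \<in> carrier A" if "l < c" for l using gens that by (simp add: minimal_generators_def)
    have span: "span_ideal A x c = max_ideal A" using gens by (simp add: minimal_generators_def)
    have xm: "x l \<in> max_ideal A" if "l < c" for l using A.span_ideal_mem[of c x l, OF x that] span by simp
    \<comment> \<open>As \<open>i\<close> is below the order, the length at \<open>i\<close> is not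
      less than the binomial coefficient. This is exactly the degree up to which the entries of
      \<open>z\<close> must be pushed to lie in \<open>\<mm>^i\<close>, the ideal annihilating
      \<open>M\<close>.\<close>
    have len: "enat ((i + c) choose i) \<le> module_length A (quotient_module (regular_module A) (max_ideal_power A (i + 1)))"
      using not_less_Least[OF i[unfolded local_ring_order_def if_not_P[OF False]]] by (simp add: c_def)
    obtain z' where z': "z' \<in> relations A x c" "z' \<notin> koszul_boundaries A x c"
      using A.exists_non_boundary_relation[OF gens c_def False] by blast
    obtain z where z: "z \<in> relations A x c" "z \<notin> koszul_boundaries A x c" "\<And>l. z l \<in> max_ideal_power A i"
      using A.exists_deep_relation[of c x, OF x span len z'] by blast
    have Z: "vector_submodule A c (relations A x c)" using A.relations_submodule x .
    have B: "vector_submodule A c (koszul_boundaries A x c)" using A.koszul_boundaries_submodule x .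
    have BZ: "koszul_boundaries A x c \<subseteq> relations A x c" using A.koszul_boundaries_relations x .
    have mZ: "(\<lambda>l. a \<otimes>\<^bsub>A\<^esub> q l) \<in> koszul_boundaries A x c" if "a \<in> max_ideal A" "q \<in> relations A x c" for a q
      using A.mult_max_ideal_boundary[of c x a q] x span that by blast
    obtain T where T: "vector_submodule A c T" "koszul_boundaries A x c \<subseteq> T" "T \<subseteq> relations A x c"
      "\<And>q. q \<in> relations A x c \<Longrightarrow> \<exists>r \<in> carrier A. (\<lambda>l. q l \<ominus>\<^bsub>A\<^esub> r \<otimes>\<^bsub>A\<^esub> z l) \<in> T"
      "\<And>a. a \<in> carrier A \<Longrightarrow> (\<lambda>l. a \<otimes>\<^bsub>A\<^esub> z l) \<in> T \<Longrightarrow> a \<in> max_ideal A"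
      by (rule A.exists_hyperplane[OF Z B BZ z(1,2)]) (erule (1) mZ, rule that)
    interpret D: singular_data A x z c T
      by unfold_locales (fact x span z T)+
    have "projective_dimension A M \<noteq> \<infinity>" using assms(5) by simp
    then obtain p P d \<epsilon> where res: "projective_resolution A M P d \<epsilon>"
      and finite: "\<forall>i > p. carrier (P i) = {\<zero>\<^bsub>(P i :: ('a, ('a, 'b) resolution_elem) module)\<^esub>}"
      unfolding projective_dimension_def Inf_enat_def by (auto split: if_splits)
    have "carrier M \<subseteq> linear_image x c M"
    proof (rule D.finite_resolution_linear_image[OF assms(2) res])
      show "carrier (P i) = {\<zero>\<^bsub>P i\<^esub>}" if "i > p" for i using finite that by blast
      show "z l \<odot>\<^bsub>M\<^esub> u = \<zero>\<^bsub>M\<^esub>" if "u \<in> carrier M" for l u using ann z(3) that by blast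
    qed
    from A.module_nakayama[OF assms(2,4) xm this] have "carrier M = {\<zero>\<^bsub>M\<^esub>}" by simp
    then show False using assms(3) by simp
  qed
qed

end
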